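(* Let $X$ be a symplectic polytope in $\mathbb{R}^4$, and let $\gamma$ be a nondegenerate Type 1 combinatorial Reeb orbit for $X$. Then there is $\epsilon_0>0$ and, for every $\epsilon\in(0,\epsilon_0)$, a (distinguished) Reeb orbit $\gamma_\epsilon$ on $\partial X_\epsilon$ such that: (i) $\gamma_\epsilon$ converges in $C^0$ to $\gamma$ as $\epsilon\to 0$. (ii) $\lim_{\epsilon\to 0}\mathcal{A}(\gamma_\epsilon)=\mathcal{A}_{\mathrm{comb}}(\gamma)$. (iii) $\gamma_\epsilon$ is linearizable and nondegenerate, $\rho(\gamma_\epsilon)=\rho_{\mathrm{comb}}(\gamma)$, and $\mathrm{CZ}(\gamma_\epsilon)=\mathrm{CZ}_{\mathrm{comb}}(\gamma)$.
   Context: **Polytopes and cones.** $\mathbb{R}^{4}=\mathbb{C}^2$ with coordinates $z_j=x_j+\sqrt{-1}\,y_j$; $\mathbf{i}$ is the standard complex structure; $\omega_0=\sum_j dx_j\wedge dy_j$; $\lambda_0=\frac12\sum_j(x_j\,dy_j-y_j\,dx_j)$. A convex polytope is a compact finite intersection of closed half-spaces; a $k$-face is a $k$-dimensional subset of $\partial X$ which is the relative interior of the intersection with $\partial X$ of some set of the defining hyperplanes. A symplectic polytope is a convex polytope $X\subset\mathbb{R}^4$ with $0\in\operatorname{int}(X)$ such that $\omega_0$ is nonzero on each 2-face. For $y\in\partial X$, $T_y^+X$ is the closure of $\{v: y+\epsilon v\in X\text{ for some }\epsilon>0\}$, $N_y^+X=\{v:\langle x-y,v\rangle\le0\ \forall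 x\in X\}$, and the Reeb cone is $R_y^+X=T_y^+X\cap\mathbf{i}N_y^+X$; these depend only on the face $F$ containing $y$ (notation $R_F^+X$ etc.), and for symplectic polytopes each $R_F^+X$ is a ray. On a 3-face $E$ with outward unit normal $\nu$ the Reeb vector field is the constant vector $R_E=2\mathbf{i}\nu/\langle\nu,y\rangle$ ($y\in E$). **Combinatorial Reeb orbits.** A combinatorial Reeb orbit is a finite sequence $\gamma=(\Gamma_1,\dots,\Gamma_k)$ of oriented line segments in $\partial X$, modulo cyclic permutations, such that the final endpoint of $\Gamma_i$ is the initial endpoint of $\Gamma_{i+1 \bmod k}$, and for each $i$ there is a face $F$ with $\operatorname{int}(\Gamma_i)\subset F$, the endpoints of $\Gamma_i$ on the boundary of $\overline F$, and $\Gamma_i$ pointing in the direction of $R_F^+X$. Its action is $\mathcal{A}_{\mathrm{comb}}(\gamma)=\sum_i\int_{\Gamma_i}\lambda_0$. It is Type 1 if it does not meet the 1-skeleton of $X$. A Type 1 orbit thus consists of segments $\Gamma_i$ in 3-faces $E_i$ from $p_i\in F_i$ to $p_{i+1}\in F_{i+1}$, with $F_i$ 2-faces, parallel to $R_{E_i}$. It is regarded as a loop of period $\mathcal{A}_{\mathrm{comb}}(\gamma)$ traversing each $\Gamma_i$ with velocity $R_{E_i}$. **Rotation number.** $\mathrm{Sp}(2)$ is the group of $2\times2$ real symplectic matrices and $\widetilde{\mathrm{Sp}}(2)$ its universal cover. $\mathrm{Diff}(S^1)$ is the group of orientation-preserving $C^1$ diffeomorphisms of $S^1=\mathbb{R}/\mathbb{Z}$;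 its universal cover is the group of $C^1$ diffeomorphisms $\Phi$ of $\mathbb{R}$ with $\Phi(t+1)=\Phi(t)+1$, and $\rho(\Phi)=\lim_{n\to\infty}(\Phi^n(t)-t)/n$ (independent of $t$). The action of $\mathrm{Sp}(2)$ on positive rays in $\mathbb{R}^2$ ($t\leftrightarrow$ ray through $e^{2\pi it}$) lifts to $\widetilde{\mathrm{Sp}}(2)\to\widetilde{\mathrm{Diff}}(S^1)$, by which $\rho$ is pulled back. **Combinatorial rotation number.** Fix $\mathbf{i},\mathbf{j},\mathbf{k}\in \mathrm{SO}(4)$ satisfying the quaternion relations, with $\mathbf{i}$ standard. For a 2-face $F$ let $E$ be the unique 3-face adjacent to $F$ into which its Reeb vector field points from $F$, $\nu$ its outward unit normal; put $\tau_F:TF\to\mathbb{R}^2$, $\tau_F(V)=(\langle V,\mathbf{j}\nu\rangle,\langle V,\mathbf{k}\nu\rangle)$ (a symplectic isomorphism). If the Reeb flow on a 3-face $E$ takes some point of a 2-face $F_1$ to some point of a 2-face $F_2$ (along a segment of positive length in $E$), let $\phi_e$ be the affine flow map from its domain in $F_1$ to $F_2$, and let $\widetilde\phi_e\in\widetilde{\mathrm{Sp}}(2)$ be the lift of $\tau_{F_2}\circ T\phi_e\circ\tau_{F_1}^{-1}$ with rotation number in $(-1/2,1/2]$. For a Type 1 orbit with flow maps $\phi_{e_i}:F_i\to F_{i+1}$, $\rho_{\mathrm{comb}}(\gamma)=\rho(\widetilde\phi_{e_k}\circ\cdots\circ\widetilde\phi_{e_1})$. It is nondegenerate if $T(\phi_{e_k}\circ\cdots\circ\phi_{e_1}):TF_1\to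 TF_1$ does not have eigenvalue 1; then $\mathrm{CZ}_{\mathrm{comb}}(\gamma)=\lfloor\rho_{\mathrm{comb}}(\gamma)\rfloor+\lceil\rho_{\mathrm{comb}}(\gamma)\rceil$. **Smoothings.** $X_\epsilon=\{z:\operatorname{dist}(z,X)\le\epsilon\}$; $Y_\epsilon=\partial X_\epsilon$ is a $C^1$ hypersurface, $C^\infty$ except along the strata $\partial F+\{v\in N_F^+X:|v|=\epsilon\}$, $F$ a face. With $\nu$ the outward unit normal at $y\in Y_\epsilon$, the Reeb vector field is $R_y=2\mathbf{i}\nu/\langle\nu,y\rangle$, $\xi_y=\ker(\lambda_0|_{T_yY_\epsilon})$, and $\tau:\xi_y\to\mathbb{R}^2$ is $\tau(V)=(\langle V,\mathbf{j}\nu\rangle,\langle V,\mathbf{k}\nu\rangle)$. A Reeb orbit is $\gamma:\mathbb{R}/T\mathbb{Z}\to Y_\epsilon$, $T>0$, $\gamma'=R(\gamma)$, modulo reparametrization; $\mathcal{A}(\gamma)=\int\gamma^*\lambda_0=T$. It is linearizable if it is transverse to the strata where $Y_\epsilon$ is not $C^\infty$, so that the Reeb flow near $\gamma$ has a well-defined linearization. A linearizable orbit is nondegenerate if the linearized return map $\xi_{\gamma(0)}\to\xi_{\gamma(0)}$ does not have eigenvalue 1. Its rotation number $\rho(\gamma)$ is the rotation number of the element of $\widetilde{\mathrm{Sp}}(2)$ given by the linearized Reeb flow along $\gamma$ in the trivialization $\tau$, and if nondegenerate $\mathrm{CZ}(\gamma)=\lfloor\rho(\gamma)\rfloor+\lceil\rho(\gamma)\rceil$.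 **$C^0$ convergence** of loops with different periods is understood after linearly rescaling the domains to $\mathbb{R}/\mathbb{Z}$ and choosing starting points suitably. *)

theory Defs
  imports "HOL-Analysis.Analysis"
begin

subsection \<open>Linear algebra on R^4 = C^2\<close>

text \<open>The coordinates of a point of R^4 are ordered as (x1, y1, x2, y2).\<close>

definition omega0 :: "real^4 \<Rightarrow> real^4 \<Rightarrow> real" where
  "omega0 v w = (v$1 * w$2 - v$2 * w$1) + (v$3 * w$4 - v$4 * w$3)"

definition lambda0 :: "real^4 \<Rightarrow> real^4 \<Rightarrow> real" where
  "lambda0 z v = ((z$1 * v$2 - z$2 * v$1) + (z$3 * v$4 - z$4 * v$3)) / 2"

definition quat_i :: "real^4^4" where
  "quat_i = vector [vector [0, -1, 0, 0],
                    vector [1, 0, 0, 0],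
                    vector [0, 0, 0, -1],
                    vector [0, 0, 1, 0]]"

text \<open>\<^term>\<open>rotation_matrix\<close> is membership in SO(n).\<close>

definition quaternionic_frame :: "real^4^4 \<Rightarrow> real^4^4 \<Rightarrow> bool" where
  "quaternionic_frame J K \<longleftrightarrow>
     rotation_matrix J \<and> rotation_matrix K \<and>
     quat_i ** quat_i = - mat 1 \<and> J ** J = - mat 1 \<and> K ** K = - mat 1 \<and>
     quat_i ** J ** K = - mat 1"

definition lambda0_integral :: "real \<Rightarrow> real \<Rightarrow> (real \<Rightarrow> real^4) \<Rightarrow> real" where
  "lambda0_integral a b c =
     integral {a..b} (\<lambda>t. lambda0 (c t) (vector_derivative c (at t within {a..b})))"


subsection \<open>Polytopes, faces and cones\<close>

text \<open>Faces are relatively open: a k-face is the relative interior of a k-dimensional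
  proper face in the sense of \<^term>\<open>(face_of)\<close>. For a polyhedron with nonempty interior
  the nonempty proper faces are exactly the nonempty intersections of the boundary with
  nonempty sets of defining hyperplanes.\<close>

definition kface :: "(real^4) set \<Rightarrow> nat \<Rightarrow> (real^4) set \<Rightarrow> bool" where
  "kface X k F \<longleftrightarrow>
     (\<exists>G. G face_of X \<and> G \<noteq> X \<and> aff_dim G = int k \<and> F = rel_interior G)"

definition is_face :: "(real^4) set \<Rightarrow> (real^4) set \<Rightarrow> bool" where
  "is_face X F \<longleftrightarrow> (\<exists>k. kface X k F)"

definition tangent_space :: "(real^4) set \<Rightarrow> (real^4) set" where
  "tangent_space F = span {x - y |x y. x \<in> F \<and> y \<in> F}"

definition symplectic_polytope :: "(real^4) set \<Rightarrow> bool" where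
  "symplectic_polytope X \<longleftrightarrow>
     polyhedron X \<and> compact X \<and> 0 \<in> interior X \<and>
     (\<forall>F. kface X 2 F \<longrightarrow>
        (\<exists>v \<in> tangent_space F. \<exists>w \<in> tangent_space F. omega0 v w \<noteq> 0))"

definition tangent_cone :: "(real^4) set \<Rightarrow> real^4 \<Rightarrow> (real^4) set" where
  "tangent_cone X y = closure {v. \<exists>\<epsilon>>0. y + \<epsilon> *\<^sub>R v \<in> X}"

definition normal_cone :: "(real^4) set \<Rightarrow> real^4 \<Rightarrow> (real^4) set" where
  "normal_cone X y = {v. \<forall>x\<in>X. (x - y) \<bullet> v \<le> 0}"

definition reeb_cone :: "(real^4) set \<Rightarrow> real^4 \<Rightarrow> (real^4) set" where
  "reeb_cone X y = tangent_cone X y \<inter> (\<lambda>v. quat_i *v v) ` normal_cone X y"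

text \<open>The cones are constant along a face \<open>F\<close>, so the intersections below are the
  common values.\<close>

definition face_normal_cone :: "(real^4) set \<Rightarrow> (real^4) set \<Rightarrow> (real^4) set" where
  "face_normal_cone X F = (\<Inter>y\<in>F. normal_cone X y)"

definition face_reeb_cone :: "(real^4) set \<Rightarrow> (real^4) set \<Rightarrow> (real^4) set" where
  "face_reeb_cone X F = (\<Inter>y\<in>F. reeb_cone X y)"

definition face_normal :: "(real^4) set \<Rightarrow> (real^4) set \<Rightarrow> real^4" where
  "face_normal X E = (THE n. norm n = 1 \<and> n \<in> face_normal_cone X E)"

definition face_reeb :: "(real^4) set \<Rightarrow> (real^4) set \<Rightarrow> real^4" where
  "face_reeb X E =
     (THE R. \<forall>y\<in>E. R = (2 / (face_normal X E \<bullet> y)) *\<^sub>R (quat_i *v face_normal X E))"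

text \<open>The faces partition the boundary of \<open>X\<close>.\<close>

definition face_at :: "(real^4) set \<Rightarrow> real^4 \<Rightarrow> (real^4) set" where
  "face_at X y = (THE F. is_face X F \<and> y \<in> F)"


subsection \<open>Combinatorial Reeb orbits\<close>

text \<open>An oriented segment is the pair of its (distinct) initial and final endpoints. An orbit
  is represented by a nonempty list of segments; lists that differ by a cyclic permutation
  represent the same orbit.\<close>

type_synonym seg = "(real^4) \<times> (real^4)"

definition comb_reeb_orbit :: "(real^4) set \<Rightarrow> seg list \<Rightarrow> bool" where
  "comb_reeb_orbit X \<gamma> \<longleftrightarrow>
     \<gamma> \<noteq> [] \<and>
     (\<forall>i<length \<gamma>. snd (\<gamma> ! i) = fst (\<gamma> ! (Suc i mod length \<gamma>))) \<and>
     (\<forall>(p, q) \<in> set \<gamma>. p \<noteq> q \<and> closed_segment p q \<subseteq> frontier X \<and>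
        (\<exists>F. is_face X F \<and> open_segment p q \<subseteq> F \<and>
             p \<in> rel_frontier (closure F) \<and> q \<in> rel_frontier (closure F) \<and>
             q - p \<in> face_reeb_cone X F))"

definition one_skeleton :: "(real^4) set \<Rightarrow> (real^4) set" where
  "one_skeleton X = \<Union>{F. kface X 0 F \<or> kface X 1 F}"

definition type1 :: "(real^4) set \<Rightarrow> seg list \<Rightarrow> bool" where
  "type1 X \<gamma> \<longleftrightarrow> (\<forall>(p, q) \<in> set \<gamma>. closed_segment p q \<inter> one_skeleton X = {})"

definition comb_action :: "seg list \<Rightarrow> real" where
  "comb_action \<gamma> = (\<Sum>(p, q)\<leftarrow>\<gamma>. lambda0_integral 0 1 (linepath p q))"

definition seg_face :: "(real^4) set \<Rightarrow> seg \<Rightarrow> (real^4) set" where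
  "seg_face X s = (THE E. is_face X E \<and> open_segment (fst s) (snd s) \<subseteq> E)"

definition seg_time :: "(real^4) set \<Rightarrow> seg \<Rightarrow> real" where
  "seg_time X s = norm (snd s - fst s) / norm (face_reeb X (seg_face X s))"

text \<open>The \<open>[]\<close> equation below is a dummy value: for a Type 1 orbit the traversal times add up
  to \<^term>\<open>comb_action \<gamma>\<close>, and \<open>comb_loop\<close> only evaluates at smaller times.\<close>

fun comb_path :: "(real^4) set \<Rightarrow> seg list \<Rightarrow> real \<Rightarrow> real^4" where
  "comb_path X [] t = 0"
| "comb_path X (s # \<gamma>) t =
     (if t \<le> seg_time X s then fst s + t *\<^sub>R face_reeb X (seg_face X s)
      else comb_path X \<gamma> (t - seg_time X s))"

definition comb_loop :: "(real^4) set \<Rightarrow> seg list \<Rightarrow> real \<Rightarrow> real^4" where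
  "comb_loop X \<gamma> t = comb_path X \<gamma> (comb_action \<gamma> * frac (t / comb_action \<gamma>))"

text \<open>The flow map along the Reeb vector field of the 3-face \<open>E\<close> to the 2-face \<open>F\<close>; it is
  meaningful at those points from which the flow reaches \<open>F\<close>.\<close>

definition flow_map ::
    "(real^4) set \<Rightarrow> (real^4) set \<Rightarrow> (real^4) set \<Rightarrow> real^4 \<Rightarrow> real^4" where
  "flow_map X E F x =
     (THE y. y \<in> F \<and> open_segment x y \<subseteq> E \<and> (\<exists>t>0. y = x + t *\<^sub>R face_reeb X E))"

definition seg_flow :: "(real^4) set \<Rightarrow> seg \<Rightarrow> real^4 \<Rightarrow> real^4" where
  "seg_flow X s = flow_map X (seg_face X s) (face_at X (snd s))"

text \<open>\<open>fold\<close> applies the flow map of the first segment first.\<close>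

definition comb_nondegenerate :: "(real^4) set \<Rightarrow> seg list \<Rightarrow> bool" where
  "comb_nondegenerate X \<gamma> \<longleftrightarrow>
     (let p = fst (hd \<gamma>); F = face_at X p in
      \<exists>L. (fold (seg_flow X) \<gamma> has_derivative L) (at p within F) \<and>
          \<not> (\<exists>v \<in> tangent_space F. v \<noteq> 0 \<and> L v = v))"


subsection \<open>The universal cover of Sp(2) and rotation numbers\<close>

definition Sp2 :: "(real^2^2) set" where
  "Sp2 = {A. \<forall>v w. (A *v v)$1 * (A *v w)$2 - (A *v v)$2 * (A *v w)$1 = v$1 * w$2 - v$2 * w$1}"

definition circle_pt :: "real \<Rightarrow> real^2" where
  "circle_pt t = vector [cos (2 * pi * t), sin (2 * pi * t)]"

text \<open>\<open>\<Phi>\<close> is a lift to the real line of the action of \<open>A\<close> on positive rays. Such a \<open>\<Phi>\<close> is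
  automatically a smooth diffeomorphism.\<close>

definition ray_lift :: "real^2^2 \<Rightarrow> (real \<Rightarrow> real) \<Rightarrow> bool" where
  "ray_lift A \<Phi> \<longleftrightarrow>
     continuous_on UNIV \<Phi> \<and> (\<forall>t. \<Phi> (t + 1) = \<Phi> t + 1) \<and>
     (\<forall>t. \<exists>r>0. A *v circle_pt t = r *\<^sub>R circle_pt (\<Phi> t))"

text \<open>The universal cover of Sp(2), realized as the pullback along the action on rays of
  the universal cover of \<open>Diff(S\<^sup>1)\<close>. This is a connected covering with deck group the integers
  (integer translations of \<open>\<Phi>\<close>): the loop of rotations lifts to a path from \<open>\<Phi>\<close> to \<open>\<Phi> + 1\<close>.\<close>

type_synonym sp2c = "(real^2^2) \<times> (real \<Rightarrow> real)"

definition Sp2_cover :: "sp2c set" where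
  "Sp2_cover = {(A, \<Phi>). A \<in> Sp2 \<and> ray_lift A \<Phi>}"

definition cover_mult :: "sp2c \<Rightarrow> sp2c \<Rightarrow> sp2c" where
  "cover_mult a b = (fst a ** fst b, snd a \<circ> snd b)"

definition cover_one :: sp2c where
  "cover_one = (mat 1, id)"

definition translation_number :: "(real \<Rightarrow> real) \<Rightarrow> real" where
  "translation_number \<Phi> =
     (THE r. \<forall>t. (\<lambda>n. ((\<Phi> ^^ n) t - t) / real n) \<longlonglongrightarrow> r)"

definition rot :: "sp2c \<Rightarrow> real" where
  "rot a = translation_number (snd a)"

text \<open>The endpoint \<open>a\<close> of the lift, starting at the identity, of the path \<open>A\<close> in Sp(2)
  defined on \<open>[0,T]\<close>.\<close>

definition path_lift_end :: "real \<Rightarrow> (real \<Rightarrow> real^2^2) \<Rightarrow> sp2c \<Rightarrow> bool" where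
  "path_lift_end T A a \<longleftrightarrow>
     (\<exists>\<Phi>. continuous_on {0..T} A \<and> (\<forall>s. continuous_on {0..T} (\<lambda>t. \<Phi> t s)) \<and>
          (\<forall>t\<in>{0..T}. (A t, \<Phi> t) \<in> Sp2_cover) \<and>
          (A 0, \<Phi> 0) = cover_one \<and> (A T, \<Phi> T) = a)"

text \<open>\<open>A\<close> is the matrix of the derivative at \<open>y\<close> of the map \<open>f\<close> on \<open>S\<close>, restricted to a
  subspace \<open>V\<close> of the tangent space of \<open>S\<close> at \<open>y\<close>, in the trivializations \<open>\<tau>\<^sub>1\<close> of \<open>V\<close> and
  \<open>\<tau>\<^sub>2\<close> of its image. The derivative within \<open>S\<close> is only determined on vectors tangent to \<open>S\<close>,
  and only its values on \<open>V\<close> are used.\<close>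

definition derivative_matrix ::
    "(real^4 \<Rightarrow> real^4) \<Rightarrow> (real^4) set \<Rightarrow> real^4 \<Rightarrow> (real^4) set \<Rightarrow>
     (real^4 \<Rightarrow> real^2) \<Rightarrow> (real^4 \<Rightarrow> real^2) \<Rightarrow> real^2^2 \<Rightarrow> bool" where
  "derivative_matrix f S y V \<tau>\<^sub>1 \<tau>\<^sub>2 A \<longleftrightarrow>
     (\<exists>L. (f has_derivative L) (at y within S) \<and> (\<forall>v\<in>V. \<tau>\<^sub>2 (L v) = A *v \<tau>\<^sub>1 v))"

definition quat_triv :: "real^4^4 \<Rightarrow> real^4^4 \<Rightarrow> real^4 \<Rightarrow> real^4 \<Rightarrow> real^2" where
  "quat_triv J K \<nu> V = vector [V \<bullet> (J *v \<nu>), V \<bullet> (K *v \<nu>)]"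

definition CZ_index :: "real \<Rightarrow> int" where
  "CZ_index \<rho> = \<lfloor>\<rho>\<rfloor> + \<lceil>\<rho>\<rceil>"


subsection \<open>Combinatorial rotation number\<close>

text \<open>The 3-face adjacent to the 2-face \<open>F\<close> into which its Reeb vector field points from \<open>F\<close>.\<close>

definition exit_face :: "(real^4) set \<Rightarrow> (real^4) set \<Rightarrow> (real^4) set" where
  "exit_face X F =
     (THE E. kface X 3 E \<and> F \<subseteq> closure E \<and>
             (\<forall>x\<in>F. \<exists>\<delta>>0. \<forall>t. 0 < t \<and> t < \<delta> \<longrightarrow> x + t *\<^sub>R face_reeb X E \<in> E))"

definition face_triv ::
    "real^4^4 \<Rightarrow> real^4^4 \<Rightarrow> (real^4) set \<Rightarrow> (real^4) set \<Rightarrow> real^4 \<Rightarrow> real^2" where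
  "face_triv J K X F = quat_triv J K (face_normal X (exit_face X F))"

definition seg_matrix :: "real^4^4 \<Rightarrow> real^4^4 \<Rightarrow> (real^4) set \<Rightarrow> seg \<Rightarrow> real^2^2" where
  "seg_matrix J K X s =
     (let F\<^sub>1 = face_at X (fst s); F\<^sub>2 = face_at X (snd s) in
      THE A. derivative_matrix (seg_flow X s) F\<^sub>1 (fst s) (tangent_space F\<^sub>1)
               (face_triv J K X F\<^sub>1) (face_triv J K X F\<^sub>2) A)"

definition small_lift :: "real^2^2 \<Rightarrow> sp2c" where
  "small_lift A = (THE a. a \<in> Sp2_cover \<and> fst a = A \<and> - 1/2 < rot a \<and> rot a \<le> 1/2)"

definition rho_comb :: "real^4^4 \<Rightarrow> real^4^4 \<Rightarrow> (real^4) set \<Rightarrow> seg list \<Rightarrow> real" where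
  "rho_comb J K X \<gamma> =
     rot (fold (\<lambda>s a. cover_mult (small_lift (seg_matrix J K X s)) a) \<gamma> cover_one)"

definition CZ_comb :: "real^4^4 \<Rightarrow> real^4^4 \<Rightarrow> (real^4) set \<Rightarrow> seg list \<Rightarrow> int" where
  "CZ_comb J K X \<gamma> = CZ_index (rho_comb J K X \<gamma>)"


subsection \<open>Smoothings and their Reeb orbits\<close>

definition thicken :: "(real^4) set \<Rightarrow> real \<Rightarrow> (real^4) set" where
  "thicken X \<epsilon> = {z. infdist z X \<le> \<epsilon>}"

text \<open>In the following, \<open>S\<close> is a compact convex body whose boundary is \<open>C\<^sup>1\<close>, so that the normal
  cone at a boundary point is a ray.\<close>

definition outward_normal :: "(real^4) set \<Rightarrow> real^4 \<Rightarrow> real^4" where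
  "outward_normal S y = (THE n. norm n = 1 \<and> n \<in> normal_cone S y)"

definition reeb_field :: "(real^4) set \<Rightarrow> real^4 \<Rightarrow> real^4" where
  "reeb_field S y = (2 / (outward_normal S y \<bullet> y)) *\<^sub>R (quat_i *v outward_normal S y)"

definition tangent_hyperplane :: "(real^4) set \<Rightarrow> real^4 \<Rightarrow> (real^4) set" where
  "tangent_hyperplane S y = {v. v \<bullet> outward_normal S y = 0}"

definition contact_plane :: "(real^4) set \<Rightarrow> real^4 \<Rightarrow> (real^4) set" where
  "contact_plane S y = {v \<in> tangent_hyperplane S y. lambda0 y v = 0}"

definition contact_triv ::
    "real^4^4 \<Rightarrow> real^4^4 \<Rightarrow> (real^4) set \<Rightarrow> real^4 \<Rightarrow> real^4 \<Rightarrow> real^2" where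
  "contact_triv J K S y = quat_triv J K (outward_normal S y)"

definition reeb_trajectory :: "(real^4) set \<Rightarrow> (real \<Rightarrow> real^4) \<Rightarrow> bool" where
  "reeb_trajectory S c \<longleftrightarrow>
     (\<forall>t. c t \<in> frontier S \<and> (c has_vector_derivative reeb_field S (c t)) (at t))"

text \<open>A Reeb orbit is given by its period \<open>T\<close> (not necessarily minimal) and a \<open>T\<close>-periodic
  trajectory on the real line.\<close>

definition reeb_orbit :: "(real^4) set \<Rightarrow> real \<Rightarrow> (real \<Rightarrow> real^4) \<Rightarrow> bool" where
  "reeb_orbit S T c \<longleftrightarrow> T > 0 \<and> (\<forall>t. c (t + T) = c t) \<and> reeb_trajectory S c"

definition orbit_action :: "real \<Rightarrow> (real \<Rightarrow> real^4) \<Rightarrow> real" where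
  "orbit_action T c = lambda0_integral 0 T c"

definition reeb_flow :: "(real^4) set \<Rightarrow> real \<Rightarrow> real^4 \<Rightarrow> real^4" where
  "reeb_flow S t y = (THE c. reeb_trajectory S c \<and> c 0 = y) t"

text \<open>The boundary of \<open>X\<^sub>\<epsilon>\<close> fails to be smooth along the sets
  \<open>\<partial>F + {v \<in> N\<^sub>F. |v| = \<epsilon>}\<close>, \<open>F\<close> a face. Their union is the disjoint union of the smooth
  manifolds \<open>stratum X \<epsilon> G F\<close>, for \<open>F\<close> a face and \<open>G\<close> a face contained in \<open>\<partial>F\<close>, of dimension
  dim G + 3 - dim F: a vector \<open>v\<close> in the relative boundary of \<open>N\<^sub>F\<close> is in the relative interior of
  the normal cone of a larger face.\<close>

definition stratum :: "(real^4) set \<Rightarrow> real \<Rightarrow> (real^4) set \<Rightarrow> (real^4) set \<Rightarrow> (real^4) set" where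
  "stratum X \<epsilon> G F =
     {x + v |x v. x \<in> G \<and> v \<in> rel_interior (face_normal_cone X F) \<and> norm v = \<epsilon>}"

text \<open>Velocities at \<open>y\<close> of curves in \<open>M\<close>: the tangent space if \<open>M\<close> is a submanifold.\<close>

definition tangent_vectors :: "(real^4) set \<Rightarrow> real^4 \<Rightarrow> (real^4) set" where
  "tangent_vectors M y =
     {w. \<exists>c. c 0 = y \<and> (\<forall>\<^sub>F t in nhds (0::real). c t \<in> M) \<and> (c has_vector_derivative w) (at 0)}"

text \<open>Transversality to every stratum, inside the 3-manifold \<open>\<partial>X\<^sub>\<epsilon>\<close>. In particular the
  orbit avoids the strata of dimension less than 2.\<close>

definition linearizable :: "(real^4) set \<Rightarrow> real \<Rightarrow> (real \<Rightarrow> real^4) \<Rightarrow> bool" where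
  "linearizable X \<epsilon> c \<longleftrightarrow>
     (\<forall>F G t. is_face X F \<and> is_face X G \<and> G \<subseteq> rel_frontier F \<and> c t \<in> stratum X \<epsilon> G F \<longrightarrow>
        tangent_hyperplane (thicken X \<epsilon>) (c t)
          = span (insert (reeb_field (thicken X \<epsilon>) (c t))
                         (tangent_vectors (stratum X \<epsilon> G F) (c t))))"

definition orbit_nondegenerate :: "(real^4) set \<Rightarrow> real \<Rightarrow> (real \<Rightarrow> real^4) \<Rightarrow> bool" where
  "orbit_nondegenerate S T c \<longleftrightarrow>
     (\<exists>L. (reeb_flow S T has_derivative L) (at (c 0) within frontier S) \<and>
          \<not> (\<exists>v \<in> contact_plane S (c 0). v \<noteq> 0 \<and> L v = v))"

definition linearized_flow ::
    "real^4^4 \<Rightarrow> real^4^4 \<Rightarrow> (real^4) set \<Rightarrow> (real \<Rightarrow> real^4) \<Rightarrow> real \<Rightarrow> real^2^2" where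
  "linearized_flow J K S c t =
     (THE A. derivative_matrix (reeb_flow S t) (frontier S) (c 0) (contact_plane S (c 0))
               (contact_triv J K S (c 0)) (contact_triv J K S (c t)) A)"

definition orbit_rho ::
    "real^4^4 \<Rightarrow> real^4^4 \<Rightarrow> (real^4) set \<Rightarrow> real \<Rightarrow> (real \<Rightarrow> real^4) \<Rightarrow> real" where
  "orbit_rho J K S T c = rot (THE a. path_lift_end T (linearized_flow J K S c) a)"

definition orbit_CZ ::
    "real^4^4 \<Rightarrow> real^4^4 \<Rightarrow> (real^4) set \<Rightarrow> real \<Rightarrow> (real \<Rightarrow> real^4) \<Rightarrow> int" where
  "orbit_CZ J K S T c = CZ_index (orbit_rho J K S T c)"


subsection \<open>Convergence of loops\<close>

text \<open>\<open>C\<^sup>0\<close> convergence, as \<open>\<epsilon>\<close> tends to 0 from the right, of loops \<open>c \<epsilon>\<close> of period \<open>T \<epsilon>\<close> to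
  the loop \<open>d\<close> of period \<open>A\<close>: all domains are rescaled to period 1 and \<open>s \<epsilon>\<close> shifts the
  starting point.\<close>

definition C0_converges ::
    "(real \<Rightarrow> real) \<Rightarrow> (real \<Rightarrow> real \<Rightarrow> real^4) \<Rightarrow> real \<Rightarrow> (real \<Rightarrow> real^4) \<Rightarrow> bool" where
  "C0_converges T c A d \<longleftrightarrow>
     (\<exists>s. uniform_limit UNIV (\<lambda>\<epsilon> t. c \<epsilon> (T \<epsilon> * (t + s \<epsilon>))) (\<lambda>t. d (A * t)) (at_right 0))"

end

theory Submission
  imports Defs
begin

text \<open>On the part of \<open>\<partial>X\<^sub>\<epsilon>\<close> over a 3-face the Reeb field is constant. Over a 2-face \<open>F\<close> between the 3-faces \<open>E\<close>
  and \<open>E'\<close> the normal turns along the arc from \<open>\<nu>\<close> to \<open>\<nu>'\<close> at a rate that does not depend on the point of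
  \<open>F\<close>, because \<open>F\<close> is orthogonal to the arc; crossing this part therefore translates \<open>F\<close> by \<open>\<epsilon>\<close> times a
  constant vector. Hence the return map of the smoothing near \<open>\<gamma>\<close> is the affine combinatorial return map
  plus \<open>\<epsilon>\<close> times a constant. Nondegeneracy gives it a unique fixed point, which depends affinely on \<open>\<epsilon>\<close>;
  the orbit \<open>\<gamma>\<^sub>\<epsilon>\<close> through it is explicit, and so are its period and its limit.

  In the quaternionic trivialization the linearized flow is constant over the 3-faces, and turning the
  normal by \<open>\<theta>\<close> over a 2-face contributes \<open>exp (\<theta> B)\<close> with \<open>B\<^sup>2 = - 1\<close>. For \<open>\<theta>\<close> up to the exterior angle
  \<open>\<alpha> < \<pi>\<close> its lift has rotation number in \<open>[0, 1/2]\<close>, and \<open>exp (\<alpha> B)\<close> is the matrix of the combinatorial flow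
  map. So the two lifts agree segment by segment, and with them the rotation numbers.\<close>

section \<open>Global trajectories of Lipschitz vector fields\<close>

text \<open>The hypersurface is only C^1, so its Reeb field is merely Lipschitz and the flow need
  not be differentiable at every point. Two devices deal with this. The field is extended to a
  bounded Lipschitz field on the whole space that preserves the distance to \<open>X\<close>; hence
  the flow exists for all times, and an explicit curve solving the equation is a flow line. And the
  orbit is cut at points over the 3-faces, where the hypersurface is locally a hyperplane: there
  every nearby trajectory is one explicit curve, translated and delayed by affine functions of the
  starting point, so the chain rule differentiates the flow even across places where the normal is
  not smooth.

  The contact planes of the smoothing and the tangent planes of the 2-faces are different planes.
  Both are complements of the Reeb direction in a tangent hyperplane, and the quaternionic
  trivialization forgets exactly this direction; that is why the two linearizations can have the
  same matrices. Rotation numbers are not additive under products, so the comparison is made in the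
  universal cover.\<close>

lemma continuous_antiderivative:
  fixes w :: "real \<Rightarrow> 'a::euclidean_space"
  assumes "continuous_on UNIV w"
  obtains W where "W 0 = 0" "\<And>t. (W has_vector_derivative w t) (at t)"
proof -
  \<comment> \<open>The integral is oriented, so \<open>W\<close> is an antiderivative at negative
    times too.\<close>
  define W where "W = (\<lambda>u::real. LBINT y=(0::real)..u. w y)"
  have "W 0 = 0" by (simp add: W_def)
  moreover have "(W has_vector_derivative w t) (at t)" for t
  proof -
    define b where "b = \<bar>t\<bar> + 1"
    have b: "-b \<le> 0" "0 \<le> b" "-b \<le> t" "t \<le> b" "t \<in> interior {-b..b}" by (auto simp: b_def)
    have "(W has_vector_derivative w t) (at t within {-b..b})"
      unfolding W_def
      by (rule interval_integral_FTC2[OF b(1,2) _ b(3,4)]) (rule continuous_on_subset[OF assms], simp)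
    then show ?thesis
      by (simp only: at_within_interior[OF b(5)])
  qed
  ultimately show thesis by (rule that)
qed

lemma has_vector_derivative_reflect:
  fixes f :: "real \<Rightarrow> 'a::real_normed_vector"
  assumes "(f has_vector_derivative d) (at (- s))"
  shows "((\<lambda>s. f (- s)) has_vector_derivative - d) (at s)"
proof -
  have "(uminus has_vector_derivative - 1) (at s)"
    using has_vector_derivative_minus[OF has_vector_derivative_id] by (simp add: id_def)
  from vector_diff_chain_at[OF this assms] show ?thesis by (simp add: o_def)
qed

lemma vector_derivative_bound_nonneg:
  fixes f :: "real \<Rightarrow> 'a::real_normed_vector" and \<phi> :: "real \<Rightarrow> real"
  assumes f: "\<And>s. (f has_vector_derivative f' s) (at s)"
    and \<phi>: "\<And>s. (\<phi> has_real_derivative \<phi>' s) (at s)"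
    and b: "\<And>s. s \<ge> 0 \<Longrightarrow> norm (f' s) \<le> \<phi>' s" and t: "t \<ge> 0"
  shows "norm (f t - f 0) \<le> \<phi> t - \<phi> 0"
proof (cases "t = 0")
  case False
  show ?thesis
  proof (rule differentiable_bound_general[where f' = f' and \<phi>' = \<phi>'])
    show "continuous_on {0..t} f"
      using has_vector_derivative_continuous[OF f] by (simp add: continuous_at_imp_continuous_on)
    show "continuous_on {0..t} \<phi>"
      using DERIV_isCont[OF \<phi>] by (simp add: continuous_at_imp_continuous_on)
    show "0 < t" using False t by simp
    show "norm (f' x) \<le> \<phi>' x" if "0 < x" for x using b[of x] that by simp
    show "(f has_vector_derivative f' x) (at x)" for x by (rule f)
    show "(\<phi> has_vector_derivative \<phi>' x) (at x)" for x
      using \<phi>[of x] by (simp add: has_real_derivative_iff_has_vector_derivative)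
  qed
qed auto

text \<open>Reflecting time reduces negative \<open>t\<close> to positive \<open>t\<close>. The
  bound is even in time, as is the weight \<open>exp (k * \<bar>s\<bar>)\<close> for which it is
  used.\<close>

lemma vector_derivative_bound_abs:
  fixes f :: "real \<Rightarrow> 'a::real_normed_vector" and \<phi> :: "real \<Rightarrow> real"
  assumes f: "\<And>s. (f has_vector_derivative f' s) (at s)"
    and \<phi>: "\<And>s. (\<phi> has_real_derivative \<phi>' s) (at s)"
    and b: "\<And>s. norm (f' s) \<le> \<phi>' \<bar>s\<bar>"
  shows "norm (f t - f 0) \<le> \<phi> \<bar>t\<bar> - \<phi> 0"
proof (cases "t \<ge> 0")
  case True
  have b': "norm (f' s) \<le> \<phi>' s" if "s \<ge> 0" for s using b[of s] that by simp
  have "norm (f t - f 0) \<le> \<phi> t - \<phi> 0"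
    by (rule vector_derivative_bound_nonneg[OF f \<phi> b' True])
  with True show ?thesis by simp
next
  case False
  have rev: "((\<lambda>s. f (- s)) has_vector_derivative - f' (- s)) (at s)" for s
    by (rule has_vector_derivative_reflect[OF f])
  have b': "norm (- f' (- s)) \<le> \<phi>' s" if "s \<ge> 0" for s using b[of "- s"] that by simp
  from rev have "norm (f (- (- t)) - f (- 0)) \<le> \<phi> (- t) - \<phi> 0"
    by (rule vector_derivative_bound_nonneg[OF _ \<phi>]) (use b' False in auto)
  with False show ?thesis by simp
qed

text \<open>Banach's fixed point theorem for \<open>u(t) = (c(t) - y) exp(- k \<bar>t\<bar>)\<close>, \<open>k = 2 L\<close>.\<close>

lemma lipschitz_field_trajectory:
  fixes V :: "'a::euclidean_space \<Rightarrow> 'a"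
  assumes lip: "\<And>x y. norm (V x - V y) \<le> L * norm (x - y)" and bd: "\<And>x. norm (V x) \<le> M"
  obtains c where "c (0::real) = y" "\<And>t. (c has_vector_derivative V (c t)) (at t)"
proof -
  \<comment> \<open>The factor 2 makes the contraction constant \<open>\<bar>L\<bar> / k\<close> at
    most 1/2; the summand 1 keeps \<open>k\<close> positive when \<open>L\<close> is 0.\<close>
  define k where "k = 2 * (\<bar>L\<bar> + 1)"
  have k: "k > 0" "\<bar>L\<bar> / k \<le> 1/2" by (auto simp: k_def field_simps)
  have lip': "norm (V x - V y) \<le> \<bar>L\<bar> * norm (x - y)" for x y
    by (rule order_trans[OF lip]) (auto intro: mult_right_mono)
  have M: "M \<ge> 0" using bd[of 0] norm_ge_zero order_trans by blast
  have contV: "continuous_on UNIV V"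
    by (rule lipschitz_on_continuous_on[where L="\<bar>L\<bar>"]) (use lip' in \<open>auto simp: lipschitz_on_def dist_norm\<close>)
  \<comment> \<open>The function \<open>u\<close> encodes the curve
    \<open>y + exp (k * \<bar>s\<bar>) *\<^sub>R u s\<close>; \<open>w u\<close> is the field along
    it, and \<open>T u\<close> below is the Picard iterate in the same encoding. The bound
    \<open>M\<close> on the field is what makes \<open>T u\<close> bounded.\<close>
  define w where "w u s = V (y + exp (k * \<bar>s\<bar>) *\<^sub>R apply_bcontfun u s)" for u :: "real \<Rightarrow>\<^sub>C 'a" and s
  have contw: "continuous_on UNIV (w u)" for u
    unfolding w_def
    by (rule continuous_on_compose2[OF contV]) (auto intro!: continuous_intros)
  have "\<exists>W. W 0 = 0 \<and> (\<forall>t. (W has_vector_derivative w u t) (at t))" for u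
    using continuous_antiderivative[OF contw] by metis
  then obtain W where W0: "\<And>u. W u 0 = 0" and W: "\<And>u t. (W u has_vector_derivative w u t) (at t)"
    by metis
  define T where "T u t = exp (- k * \<bar>t\<bar>) *\<^sub>R W u t" for u t
  have cancel: "exp (- (k * r)) * (a * exp (k * r)) = a" "exp (- (k * r)) * (a * exp (k * r) / k) = a / k" for a r
    by (simp_all add: exp_minus)
  have exps: "((\<lambda>t. exp (k * t) / k) has_real_derivative exp (k * t)) (at t)" for t
    using k by (auto intro!: derivative_eq_intros)
  have Wb: "norm (W u t) \<le> M * (exp (k * \<bar>t\<bar>) / k)" for u t
  proof -
    have "norm (W u t - W u 0) \<le> M * (exp (k * \<bar>t\<bar>) / k) - M * (exp (k * 0) / k)"
    proof (rule vector_derivative_bound_abs[OF W])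
      show "((\<lambda>t. M * (exp (k * t) / k)) has_real_derivative M * exp (k * s)) (at s)" for s
        by (rule DERIV_cmult[OF exps])
      show "norm (w u s) \<le> M * exp (k * \<bar>s\<bar>)" for s
      proof -
        have "M * 1 \<le> M * exp (k * \<bar>s\<bar>)" using M k by (intro mult_left_mono) auto
        then show ?thesis unfolding w_def using bd by (metis mult.right_neutral order_trans)
      qed
    qed
    moreover have "0 \<le> M * (exp (k * 0) / k)" using M k by auto
    ultimately show ?thesis using W0 by simp
  qed
  have T: "T u \<in> bcontfun" for u
  proof (rule bcontfun_normI)
    have "continuous_on UNIV (W u)"
      using W by (auto intro!: continuous_at_imp_continuous_on intro: has_vector_derivative_continuous)
    then show "continuous_on UNIV (T u)"
      unfolding T_def by (auto intro!: continuous_intros)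
    show "norm (T u t) \<le> M / k" for t
      using mult_left_mono[OF Wb[of u t], of "exp (-k * \<bar>t\<bar>)"] by (simp add: T_def cancel)
  qed
  define F where "F u = Bcontfun (T u)" for u
  have F: "apply_bcontfun (F u) = T u" for u
    by (simp add: F_def Bcontfun_inverse T)
  have "\<exists>!u. F u = u"
  proof (rule banach_fix_type[of "1/2"])
    show "\<forall>u v. dist (F u) (F v) \<le> 1/2 * dist u v"
    proof (intro allI dist_bound)
      fix u v :: "real \<Rightarrow>\<^sub>C 'a" and t :: real
      define \<delta> where "\<delta> = dist u v"
      have \<delta>: "\<delta> \<ge> 0" by (simp add: \<delta>_def)
      have "norm ((W u t - W v t) - (W u 0 - W v 0))
              \<le> (\<bar>L\<bar> * \<delta>) * (exp (k * \<bar>t\<bar>) / k) - (\<bar>L\<bar> * \<delta>) * (exp (k * 0) / k)"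
      proof (rule vector_derivative_bound_abs)
        show "((\<lambda>t. W u t - W v t) has_vector_derivative (w u s - w v s)) (at s)" for s
          by (intro derivative_intros W)
        show "((\<lambda>t. (\<bar>L\<bar> * \<delta>) * (exp (k * t) / k)) has_real_derivative (\<bar>L\<bar> * \<delta>) * exp (k * s)) (at s)" for s
          by (rule DERIV_cmult[OF exps])
        show "norm (w u s - w v s) \<le> (\<bar>L\<bar> * \<delta>) * exp (k * \<bar>s\<bar>)" for s
        proof -
          have "norm (w u s - w v s) \<le> \<bar>L\<bar> * norm (exp (k * \<bar>s\<bar>) *\<^sub>R (apply_bcontfun u s - apply_bcontfun v s))"
            unfolding w_def by (rule order_trans[OF lip']) (simp add: algebra_simps)
          also have "\<dots> \<le> \<bar>L\<bar> * (exp (k * \<bar>s\<bar>) * \<delta>)"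
            using dist_bounded[of u s v] by (auto intro!: mult_left_mono simp: dist_norm \<delta>_def)
          finally show ?thesis by (simp add: mult_ac)
        qed
      qed
      moreover have "0 \<le> (\<bar>L\<bar> * \<delta>) * (exp (k * 0) / k)" using \<delta> k by auto
      ultimately have "norm (W u t - W v t) \<le> (\<bar>L\<bar> * \<delta>) * (exp (k * \<bar>t\<bar>) / k)" by (simp add: W0)
      from mult_left_mono[OF this, of "exp (-k * \<bar>t\<bar>)"]
      have "norm (T u t - T v t) \<le> (\<bar>L\<bar> / k) * \<delta>"
        by (simp add: T_def cancel flip: scaleR_diff_right)
      also have "\<dots> \<le> 1/2 * \<delta>" using k \<delta> by (intro mult_right_mono) auto
      finally show "dist (apply_bcontfun (F u) t) (apply_bcontfun (F v) t) \<le> 1/2 * dist u v"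
        by (simp add: F dist_norm \<delta>_def)
    qed
  qed auto
  then obtain u where "F u = u" by blast
  then have u: "apply_bcontfun u t = T u t" for t using F[of u] by simp
  have "y + exp (k * \<bar>t\<bar>) *\<^sub>R apply_bcontfun u t = y + W u t" for t
    by (simp add: u T_def exp_minus)
  then have "w u t = V (y + W u t)" for t by (simp add: w_def)
  then have "((\<lambda>t. y + W u t) has_vector_derivative V (y + W u t)) (at t)" for t
    using W[of u t] by (auto intro!: derivative_eq_intros)
  then show thesis by (intro that[of "\<lambda>t. y + W u t"]) (auto simp: W0)
qed

text \<open>Gronwall: the squared distance of the curves, damped by \<open>exp (- 2 L t)\<close>, is
  nonincreasing and starts at 0. The Lipschitz bound is asked on \<open>S\<close> only, because the
  Reeb field makes sense only on the hypersurface, and one-sided derivatives admit explicit curves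
  known on an interval.\<close>

lemma lipschitz_field_unique_forward:
  fixes V :: "'a::real_inner \<Rightarrow> 'a"
  assumes lip: "\<And>x y. x \<in> S \<Longrightarrow> y \<in> S \<Longrightarrow> norm (V x - V y) \<le> L * norm (x - y)"
    and c: "\<And>t. t \<in> {0..b} \<Longrightarrow> c t \<in> S \<and> (c has_vector_derivative V (c t)) (at t within {0..b})"
    and d: "\<And>t. t \<in> {0..b} \<Longrightarrow> d t \<in> S \<and> (d has_vector_derivative V (d t)) (at t within {0..b})"
    and "c 0 = d 0" and t: "t \<in> {0..b}"
  shows "c t = d t"
proof -
  define f where "f s = exp (- (2 * L) * s) * ((c s - d s) \<bullet> (c s - d s))" for s
  define f' where "f' s = exp (- (2 * L) * s) * (2 * ((c s - d s) \<bullet> (V (c s) - V (d s)))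
      - 2 * L * ((c s - d s) \<bullet> (c s - d s)))" for s
  have der: "(f has_derivative (\<lambda>h. h * f' s)) (at s within {0..b})" if "s \<in> {0..b}" for s
  proof -
    have *: "((\<lambda>s. c s - d s) has_derivative (\<lambda>h. h *\<^sub>R (V (c s) - V (d s)))) (at s within {0..b})"
      using has_vector_derivative_diff[OF conjunct2[OF c[OF that]] conjunct2[OF d[OF that]]]
      by (simp add: has_vector_derivative_def)
    have "((\<lambda>s. exp (- (2 * L) * s)) has_derivative (\<lambda>h. h * (- (2 * L) * exp (- (2 * L) * s)))) (at s within {0..b})"
      by (auto intro!: derivative_eq_intros)
    from has_derivative_mult[OF this has_derivative_inner[OF * *]] show ?thesis
      unfolding f_def f'_def
      by (rule has_derivative_eq_rhs) (auto simp: fun_eq_iff inner_commute algebra_simps)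
  qed
  have "f' s \<le> 0" if "s \<in> {0..b}" for s
  proof -
    have "(c s - d s) \<bullet> (V (c s) - V (d s)) \<le> norm (c s - d s) * norm (V (c s) - V (d s))"
      by (rule norm_cauchy_schwarz)
    also have "\<dots> \<le> norm (c s - d s) * (L * norm (c s - d s))"
      using lip c d that by (intro mult_left_mono) auto
    also have "\<dots> = L * ((c s - d s) \<bullet> (c s - d s))"
      by (simp add: dot_square_norm power2_eq_square)
    finally show ?thesis unfolding f'_def by (intro mult_nonneg_nonpos) auto
  qed
  moreover have "\<exists>\<xi>\<in>{0..t}. f t - f 0 = t * f' \<xi>"
  proof -
    have "(f has_derivative (\<lambda>h. h * f' s)) (at s within {0..t})" if "0 \<le> s" "s \<le> t" for s
      by (rule has_derivative_subset[OF der]) (use t that in auto)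
    from mvt_very_simple[of 0 t f, OF _ this] t show ?thesis by simp
  qed
  ultimately have "f t \<le> f 0"
    using t by (smt (verit) atLeastAtMost_iff mult_nonneg_nonpos)
  also have "f 0 = 0" using assms by (simp add: f_def)
  finally have "(c t - d t) \<bullet> (c t - d t) \<le> 0"
    by (simp add: f_def mult_le_0_iff)
  then show ?thesis by (metis inner_gt_zero_iff not_less right_minus_eq)
qed

lemma lipschitz_field_unique:
  fixes V :: "'a::real_inner \<Rightarrow> 'a"
  assumes lip: "\<And>x y. x \<in> S \<Longrightarrow> y \<in> S \<Longrightarrow> norm (V x - V y) \<le> L * norm (x - y)"
    and c: "\<And>t. c t \<in> S \<and> (c has_vector_derivative V (c t)) (at t)"
    and d: "\<And>t. d t \<in> S \<and> (d has_vector_derivative V (d t)) (at t)"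
    and 0: "c 0 = d 0"
  shows "c t = d t"
proof (cases "t \<ge> 0")
  case True
  show ?thesis
    by (rule lipschitz_field_unique_forward[of S V L t c d t])
       (use assms True in \<open>auto intro: has_vector_derivative_at_within\<close>)
next
  case False
  have rev: "((\<lambda>s. e (- s)) has_vector_derivative - V (e (- s))) (at s within A)"
    if "\<And>t. (e has_vector_derivative V (e t)) (at t)" for s e A
  proof -
    have "((\<lambda>s. e (- s)) has_vector_derivative - V (e (- s))) (at s)"
      by (rule has_vector_derivative_reflect[OF that])
    then show ?thesis by (rule has_vector_derivative_at_within)
  qed
  have "c (- (- t)) = d (- (- t))"
    by (rule lipschitz_field_unique_forward[of S "\<lambda>x. - V x" L "-t" "\<lambda>s. c (- s)" "\<lambda>s. d (- s)" "-t"])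
       (use c d False 0 lip in \<open>auto intro!: rev simp: norm_minus_commute\<close>)
  then show ?thesis by simp
qed

section \<open>Convex bodies and their smoothings\<close>

lemma vector_4_nth [simp]:
  fixes a b c d :: "'a::zero"
  shows "(vector [a,b,c,d] :: 'a^4)$1 = a" "(vector [a,b,c,d] :: 'a^4)$2 = b"
    "(vector [a,b,c,d] :: 'a^4)$3 = c" "(vector [a,b,c,d] :: 'a^4)$4 = d"
  unfolding vector_def by auto

lemma quat_i_nth [simp]:
  "(quat_i *v v)$1 = - v$2" "(quat_i *v v)$2 = v$1" "(quat_i *v v)$3 = - v$4" "(quat_i *v v)$4 = v$3"
  by (simp_all add: quat_i_def matrix_vector_mult_def sum_4)

lemma inner_R4: "(v::real^4) \<bullet> w = v$1 * w$1 + v$2 * w$2 + v$3 * w$3 + v$4 * w$4"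
  by (simp add: inner_vec_def sum_4)

lemma quat_i_quat_i [simp]: "quat_i *v (quat_i *v v) = - v"
  by (simp add: vec_eq_iff forall_4)

lemma quat_i_inner [simp]: "(quat_i *v v) \<bullet> (quat_i *v w) = v \<bullet> w"
  by (simp add: inner_R4)

lemma quat_i_inner_swap: "(quat_i *v v) \<bullet> w = - (v \<bullet> (quat_i *v w))"
  by (simp add: inner_R4)

lemma quat_i_inner_self [simp]: "(quat_i *v v) \<bullet> v = 0" "v \<bullet> (quat_i *v v) = 0"
  by (simp_all add: inner_R4)

lemma norm_quat_i [simp]: "norm (quat_i *v v) = norm v"
  by (simp add: norm_eq_sqrt_inner)

lemma quat_i_inj [simp]: "quat_i *v v = quat_i *v w \<longleftrightarrow> v = w"
  by (metis neg_equal_iff_equal quat_i_quat_i)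

lemma omega0_eq: "omega0 v w = (quat_i *v v) \<bullet> w"
  by (simp add: omega0_def inner_R4)

lemma lambda0_eq: "lambda0 z v = ((quat_i *v z) \<bullet> v) / 2"
  by (simp add: lambda0_def inner_R4)

lemma has_derivative_quadratic_bound:
  fixes f :: "'a::real_normed_vector \<Rightarrow> 'b::real_normed_vector"
  assumes "bounded_linear D" and b: "\<And>z. norm (f z - f y - D (z - y)) \<le> C * (norm (z - y))\<^sup>2"
  shows "(f has_derivative D) (at y)"
  unfolding has_derivative_at_alt
proof (intro conjI allI impI assms)
  fix e :: real assume e: "e > 0"
  show "\<exists>d>0. \<forall>z. norm (z - y) < d \<longrightarrow> norm (f z - f y - D (z - y)) \<le> e * norm (z - y)"
  proof (intro exI[of _ "e / (\<bar>C\<bar> + 1)"] conjI allI impI)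
    fix z assume z: "norm (z - y) < e / (\<bar>C\<bar> + 1)"
    have "norm (f z - f y - D (z - y)) \<le> ((\<bar>C\<bar> + 1) * norm (z - y)) * norm (z - y)"
      using b[of z] mult_right_mono[of C "\<bar>C\<bar> + 1" "(norm (z - y))\<^sup>2"] abs_ge_self[of C]
      by (simp add: power2_eq_square mult.assoc)
    also have "\<dots> \<le> e * norm (z - y)"
      using z by (intro mult_right_mono) (auto simp: field_simps)
    finally show "norm (f z - f y - D (z - y)) \<le> e * norm (z - y)" .
  qed (use e in auto)
qed

section \<open>Closest points and the distance to a convex body\<close>

locale convex_body =
  fixes X :: "(real^4) set"
  assumes compact_X: "compact X" and convex_X: "convex X" and zero_interior: "0 \<in> interior X"
begin

text \<open>Outside \<open>X\<close> this is the distance to \<open>X\<close> times the outward unit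
  normal of the parallel body through \<open>y\<close>. It thus extends the normals of all
  smoothings at once to a Lipschitz map on the whole space.\<close>

definition offset :: "real^4 \<Rightarrow> real^4" where
  "offset y = y - closest_point X y"

lemma closed_X: "closed X" and X_nonempty: "X \<noteq> {}" and zero_in: "0 \<in> X"
  using compact_X zero_interior interior_subset by (auto simp: compact_imp_closed)

lemma closest_in [simp]: "closest_point X y \<in> X"
  by (rule closest_point_in_set[OF closed_X X_nonempty])

lemma closest_plus_offset: "closest_point X y + offset y = y"
  by (simp add: offset_def)

lemma offset_normal: "offset y \<in> normal_cone X (closest_point X y)"
  unfolding normal_cone_def offset_def
  using closest_point_dot[OF convex_X closed_X] by (auto simp: inner_commute)

text \<open>In the square of the distance from \<open>x + v\<close> to \<open>z\<close> the mixed
  term has the right sign. Being the converse of \<open>offset_normal\<close>, this recognizes a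
  point of the smoothing from its foot point and normal.\<close>

lemma closest_point_normal:
  assumes "x \<in> X" "v \<in> normal_cone X x"
  shows "closest_point X (x + v) = x"
proof (rule closest_point_unique[OF convex_X closed_X, symmetric])
  show "\<forall>z\<in>X. dist (x + v) x \<le> dist (x + v) z"
  proof
    fix z assume z: "z \<in> X"
    have "(x + v - z) \<bullet> (x + v - z) = v \<bullet> v - 2 * ((z - x) \<bullet> v) + (z - x) \<bullet> (z - x)"
      by (simp add: algebra_simps inner_commute)
    moreover have "(z - x) \<bullet> v \<le> 0" "0 \<le> (z - x) \<bullet> (z - x)" using assms z by (auto simp: normal_cone_def)
    ultimately have "v \<bullet> v \<le> (x + v - z) \<bullet> (x + v - z)" by linarith
    then show "dist (x + v) x \<le> dist (x + v) z" by (simp add: dist_norm norm_le)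
  qed
qed (use assms in auto)

lemma offset_normal_eq:
  assumes "x \<in> X" "v \<in> normal_cone X x"
  shows "offset (x + v) = v"
  by (simp add: offset_def closest_point_normal[OF assms])

lemma infdist_eq: "infdist y X = norm (offset y)"
  by (simp add: infdist_eq_setdist setdist_closest_point[OF closed_X X_nonempty] dist_norm offset_def)

lemma offset_lipschitz: "norm (offset y - offset z) \<le> 2 * norm (y - z)"
proof -
  have "norm (closest_point X z - closest_point X y) \<le> norm (y - z)"
    using closest_point_lipschitz[OF convex_X closed_X X_nonempty, of z y]
    by (simp add: dist_norm norm_minus_commute)
  moreover have "offset y - offset z = (y - z) + (closest_point X z - closest_point X y)"
    by (simp add: offset_def)
  ultimately show ?thesis using norm_triangle_ineq[of "y - z" "closest_point X z - closest_point X y"] by simp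
qed

lemma continuous_offset: "continuous_on A offset"
  by (rule lipschitz_on_continuous_on[where L=2])
     (use offset_lipschitz in \<open>auto simp: lipschitz_on_def dist_norm\<close>)

text \<open>The closest point of \<open>y\<close> competes with that of \<open>z\<close>, which
  bounds the squared distance at \<open>z\<close> from above; exchanging the roles bounds it from
  below. The constant 5 is 1 from the quadratic term plus 2 * 2 from the Lipschitz constant of
  \<open>offset\<close>.\<close>

lemma norm_offset_sq_derivative:
  "((\<lambda>y. offset y \<bullet> offset y) has_derivative (\<lambda>h. 2 * (offset y \<bullet> h))) (at y)"
proof (rule has_derivative_quadratic_bound[where C=5])
  show "bounded_linear (\<lambda>h. 2 * (offset y \<bullet> h))"
    by (intro bounded_linear_const_mult bounded_linear_inner_right)
  have up: "offset z \<bullet> offset z \<le> offset y \<bullet> offset y + 2 * (offset y \<bullet> (z - y)) + (z - y) \<bullet> (z - y)" for y z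
  proof -
    have "norm (offset z) \<le> norm (z - closest_point X y)"
      using closest_point_le[OF closed_X closest_in, of z y] by (simp add: offset_def dist_norm)
    then have "offset z \<bullet> offset z \<le> (z - closest_point X y) \<bullet> (z - closest_point X y)"
      by (simp add: norm_le)
    also have "z - closest_point X y = offset y + (z - y)" by (simp add: offset_def)
    finally show ?thesis by (simp add: algebra_simps inner_commute)
  qed
  fix z
  have 1: "offset z \<bullet> offset z \<le> offset y \<bullet> offset y + 2 * (offset y \<bullet> (z - y)) + (norm (z - y))\<^sup>2"
    using up[of z y] by (simp add: power2_norm_eq_inner)
  have "offset y \<bullet> offset y \<le> offset z \<bullet> offset z + 2 * (offset z \<bullet> (y - z)) + (norm (y - z))\<^sup>2"
    using up[of y z] by (simp add: power2_norm_eq_inner)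
  moreover have "offset z \<bullet> (y - z) = - (offset y \<bullet> (z - y)) - (offset z - offset y) \<bullet> (z - y)"
    by (simp add: algebra_simps)
  moreover have "\<bar>(offset z - offset y) \<bullet> (z - y)\<bar> \<le> 2 * (norm (z - y))\<^sup>2"
    using order_trans[OF Cauchy_Schwarz_ineq2 mult_right_mono[OF offset_lipschitz[of z y] norm_ge_zero]]
    by (simp add: power2_eq_square mult.assoc)
  ultimately have 2: "offset y \<bullet> offset y \<le> offset z \<bullet> offset z - 2 * (offset y \<bullet> (z - y)) + 5 * (norm (z - y))\<^sup>2"
    by (simp add: norm_minus_commute)
  show "norm (offset z \<bullet> offset z - offset y \<bullet> offset y - 2 * (offset y \<bullet> (z - y))) \<le> 5 * (norm (z - y))\<^sup>2"
    using 1 2 by (auto simp: abs_le_iff)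
qed

text \<open>The normal cone inequality, tested at the point of the inner ball farthest in the normal
  direction: supporting hyperplanes have distance at least \<open>r\<close> from 0. This controls
  the denominator of the Reeb field.\<close>

lemma offset_dot_ge:
  assumes "cball 0 r \<subseteq> X" "r \<ge> 0"
  shows "(norm (offset y))\<^sup>2 + r * norm (offset y) \<le> offset y \<bullet> y"
proof (cases "offset y = 0")
  case False
  have "(r / norm (offset y)) *\<^sub>R offset y \<in> cball 0 r" using assms False by (simp add: dist_norm)
  then have "((r / norm (offset y)) *\<^sub>R offset y - closest_point X y) \<bullet> offset y \<le> 0"
    using offset_normal[of y] assms(1) unfolding normal_cone_def by blast
  then have "r * norm (offset y) \<le> closest_point X y \<bullet> offset y"
    using False by (simp add: inner_diff_left dot_square_norm power2_eq_square)
  moreover have "offset y \<bullet> y = offset y \<bullet> offset y + offset y \<bullet> closest_point X y"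
    by (metis closest_plus_offset inner_add_right add.commute)
  ultimately show ?thesis by (simp add: inner_commute dot_square_norm)
qed auto

lemma inner_ball_exists: obtains r where "r > 0" "cball 0 r \<subseteq> X"
  using zero_interior mem_interior_cball by blast

end

section \<open>The parallel body, its Reeb field and its Reeb flow\<close>

locale smoothing = convex_body +
  fixes \<epsilon> :: real
  assumes eps: "\<epsilon> > 0"
begin

abbreviation "S \<equiv> thicken X \<epsilon>"

lemma thicken_eq: "S = {y. norm (offset y) \<le> \<epsilon>}"
  by (simp add: thicken_def infdist_eq)

lemma frontier_eq: "frontier S = {y. norm (offset y) = \<epsilon>}"
proof -
  have cl: "closed S"
    unfolding thicken_eq by (intro closed_Collect_le continuous_intros continuous_offset)
  have "open {y. norm (offset y) < \<epsilon>}" by (intro open_Collect_less continuous_intros continuous_offset)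
  then have 1: "{y. norm (offset y) < \<epsilon>} \<subseteq> interior S"
    by (intro interior_maximal) (auto simp: thicken_eq)
  have 2: "y \<notin> interior S" if "norm (offset y) = \<epsilon>" for y
  proof
    assume "y \<in> interior S"
    then obtain e where e: "e > 0" "ball y e \<subseteq> S" by (meson mem_interior)
    \<comment> \<open>Moving \<open>y\<close> outward by \<open>t *\<^sub>R offset y\<close>
      multiplies its distance to \<open>X\<close> by \<open>1 + t\<close>; this \<open>t\<close>
      makes the step half as long as the radius of the ball.\<close>
    define t where "t = e / (2 * \<epsilon>)"
    have t: "t > 0" using e eps by (simp add: t_def)
    have "(1 + t) *\<^sub>R offset y \<in> normal_cone X (closest_point X y)"
      using offset_normal[of y] t by (auto simp: normal_cone_def intro: mult_nonneg_nonpos)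
    then have "offset (closest_point X y + (1 + t) *\<^sub>R offset y) = (1 + t) *\<^sub>R offset y"
      by (intro offset_normal_eq) auto
    moreover have "closest_point X y + (1 + t) *\<^sub>R offset y = y + t *\<^sub>R offset y"
      by (simp add: offset_def algebra_simps)
    ultimately have "norm (offset (y + t *\<^sub>R offset y)) = (1 + t) * \<epsilon>" using t that by simp
    moreover have "y + t *\<^sub>R offset y \<in> ball y e"
      using that e eps by (simp add: dist_norm t_def)
    then have "norm (offset (y + t *\<^sub>R offset y)) \<le> \<epsilon>" using e by (auto simp: thicken_eq)
    ultimately show False using mult_pos_pos[OF eps t] by (simp add: algebra_simps)
  qed
  show ?thesis
    unfolding frontier_def closure_closed[OF cl]
    using 1 2 by (auto simp: thicken_eq) (use leI le_less in blast)
qed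

lemma outward_normal_eq:
  assumes y: "y \<in> frontier S"
  shows "outward_normal S y = (1 / \<epsilon>) *\<^sub>R offset y"
  unfolding outward_normal_def
proof (rule the_equality)
  have q: "norm (offset y) = \<epsilon>" using y by (simp add: frontier_eq)
  have "(z - y) \<bullet> offset y \<le> 0" if "z \<in> S" for z
  proof -
    have "z - y = (closest_point X z - closest_point X y) + (offset z - offset y)" by (simp add: offset_def)
    moreover have "(closest_point X z - closest_point X y) \<bullet> offset y \<le> 0"
      using offset_normal[of y] by (simp add: normal_cone_def)
    moreover have "(offset z - offset y) \<bullet> offset y \<le> 0"
    proof -
      have "offset z \<bullet> offset y \<le> norm (offset z) * norm (offset y)" by (rule norm_cauchy_schwarz)
      also have "\<dots> \<le> \<epsilon> * \<epsilon>" using that q eps by (intro mult_mono) (auto simp: thicken_eq)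
      finally show ?thesis using q by (simp add: inner_diff_left dot_square_norm power2_eq_square)
    qed
    ultimately show ?thesis by (simp add: inner_add_left)
  qed
  then show "norm ((1 / \<epsilon>) *\<^sub>R offset y) = 1 \<and> (1 / \<epsilon>) *\<^sub>R offset y \<in> normal_cone S y"
    using eps q by (auto simp: normal_cone_def divide_le_0_iff)
  fix n assume n: "norm n = 1 \<and> n \<in> normal_cone S y"
  \<comment> \<open>For uniqueness the normal \<open>n\<close> is tested at the point reached from
    the same foot point by going \<open>\<epsilon>\<close> in direction \<open>n\<close>. The
    resulting inequality is the equality case of Cauchy-Schwarz.\<close>
  have "infdist (closest_point X y + \<epsilon> *\<^sub>R n) X \<le> dist (closest_point X y + \<epsilon> *\<^sub>R n) (closest_point X y)"
    by (rule infdist_le) simp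
  then have "closest_point X y + \<epsilon> *\<^sub>R n \<in> S"
    using n eps by (simp add: thicken_def dist_norm)
  then have "(closest_point X y + \<epsilon> *\<^sub>R n - y) \<bullet> n \<le> 0" using n by (simp add: normal_cone_def)
  then have "(\<epsilon> *\<^sub>R n - offset y) \<bullet> n \<le> 0" by (simp add: offset_def algebra_simps)
  then have "\<epsilon> \<le> offset y \<bullet> n" using n by (simp add: inner_diff_left dot_square_norm)
  then have "\<epsilon> * \<epsilon> \<le> \<epsilon> * (offset y \<bullet> n)" using eps by (intro mult_left_mono) auto
  moreover have "offset y \<bullet> offset y = \<epsilon> * \<epsilon>" "n \<bullet> n = 1"
    using n q by (simp_all add: dot_square_norm power2_eq_square)
  moreover have "(offset y - \<epsilon> *\<^sub>R n) \<bullet> (offset y - \<epsilon> *\<^sub>R n)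
      = offset y \<bullet> offset y - 2 * (\<epsilon> * (offset y \<bullet> n)) + \<epsilon> * \<epsilon> * (n \<bullet> n)"
    by (simp add: inner_diff_left inner_diff_right inner_commute)
  ultimately have "(offset y - \<epsilon> *\<^sub>R n) \<bullet> (offset y - \<epsilon> *\<^sub>R n) \<le> 0" by simp
  then have "offset y = \<epsilon> *\<^sub>R n" by (metis inner_gt_zero_iff not_less right_minus_eq)
  then show "n = (1 / \<epsilon>) *\<^sub>R offset y" using eps by simp
qed

lemma offset_dot_pos: "y \<in> frontier S \<Longrightarrow> offset y \<bullet> y \<ge> \<epsilon>\<^sup>2"
proof -
  assume y: "y \<in> frontier S"
  have "(norm (offset y))\<^sup>2 + 0 * norm (offset y) \<le> offset y \<bullet> y"
    by (rule offset_dot_ge) (use zero_in in auto)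
  then show ?thesis using y by (simp add: frontier_eq)
qed

lemma reeb_field_eq:
  assumes y: "y \<in> frontier S"
  shows "reeb_field S y = (2 / (offset y \<bullet> y)) *\<^sub>R (quat_i *v offset y)"
  using eps by (simp add: reeb_field_def outward_normal_eq[OF y] matrix_vector_mult_scaleR)

text \<open>The existence theorem wants a field on the whole space. On the hypersurface the maximum
  is attained by \<open>offset y \<bullet> y\<close>, by \<open>offset_dot_pos\<close>; elsewhere
  \<open>\<epsilon>\<^sup>2\<close> keeps the denominator positive, in particular on
  \<open>X\<close>, where \<open>offset\<close> vanishes.\<close>

definition ext_field :: "real^4 \<Rightarrow> real^4" where
  "ext_field y = (2 / max (\<epsilon>\<^sup>2) (offset y \<bullet> y)) *\<^sub>R (quat_i *v offset y)"

lemma ext_field_eq: "y \<in> frontier S \<Longrightarrow> ext_field y = reeb_field S y"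
  using offset_dot_pos by (simp add: ext_field_def reeb_field_eq max_absorb2)

lemma offset_quotient_bound:
  assumes r: "r > 0" "cball 0 r \<subseteq> X"
  shows "norm (offset y) / max (\<epsilon>\<^sup>2) (offset y \<bullet> y) \<le> 1 / r"
proof -
  have "r * norm (offset y) \<le> max (\<epsilon>\<^sup>2) (offset y \<bullet> y)"
    using offset_dot_ge[OF r(2), of y] r by (simp add: le_max_iff_disj) (smt (verit) zero_le_power2)
  moreover have "max (\<epsilon>\<^sup>2) (offset y \<bullet> y) > 0" using eps by (simp add: less_max_iff_disj)
  ultimately show ?thesis using r by (simp add: field_simps)
qed

lemma ext_field_bound:
  assumes r: "r > 0" "cball 0 r \<subseteq> X"
  shows "norm (ext_field y) \<le> 2 / r"
proof -
  have "max (\<epsilon>\<^sup>2) (offset y \<bullet> y) > 0" using eps by (simp add: less_max_iff_disj)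
  then have "norm (ext_field y) = 2 * (norm (offset y) / max (\<epsilon>\<^sup>2) (offset y \<bullet> y))"
    by (simp add: ext_field_def)
  also have "\<dots> \<le> 2 * (1 / r)" by (intro mult_left_mono offset_quotient_bound r) auto
  finally show ?thesis by simp
qed

lemma reeb_field_bound:
  assumes "r > 0" "cball 0 r \<subseteq> X" "y \<in> frontier S"
  shows "norm (reeb_field S y) \<le> 2 / r"
  using ext_field_bound[OF assms(1,2), of y] ext_field_eq[OF assms(3)] by simp

text \<open>The difference of the quotients is split as in the quotient rule. The factors
  \<open>y\<close> and \<open>offset y\<close> are unbounded, but they only enter divided by the
  denominator, which dominates \<open>r\<close> times the norm of the offset and its square;
  \<open>D\<close> bounds the remaining part of \<open>y\<close>, its closest point.\<close>

lemma ext_field_lipschitz: obtains L where "\<And>y z. norm (ext_field y - ext_field z) \<le> L * norm (y - z)"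
proof -
  obtain r where r: "r > 0" "cball 0 r \<subseteq> X" using inner_ball_exists .
  obtain D where D: "D > 0" "\<And>x. x \<in> X \<Longrightarrow> norm x \<le> D"
    using compact_X by (meson bounded_pos compact_imp_bounded)
  define m where "m = \<epsilon>\<^sup>2"
  have m: "m > 0" using eps by (simp add: m_def)
  define L where "L = 2 * (2 / m + (1/r) * (2 * (1/r + D/m)) + 1 / m)"
  have "norm (ext_field y - ext_field z) \<le> L * norm (y - z)" for y z
  proof -
    define a where "a = max m (offset y \<bullet> y)"
    define b where "b = max m (offset z \<bullet> z)"
    have ab: "a > 0" "b > 0" "m \<le> a" "m \<le> b" using m by (auto simp: a_def b_def less_max_iff_disj)
    have qa: "norm (offset y) / a \<le> 1 / r" and qb: "norm (offset z) / b \<le> 1 / r"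
      using offset_quotient_bound[OF r] by (auto simp: a_def b_def m_def)
    have "norm y \<le> norm (offset y) + D"
      using norm_triangle_ineq[of "closest_point X y" "offset y"] D(2)[of "closest_point X y"] by (simp add: offset_def)
    then have "norm y / a \<le> norm (offset y) / a + D / a"
      using ab by (simp add: field_simps)
    also have "\<dots> \<le> 1 / r + D / m" using qa ab m D by (intro add_mono divide_left_mono) auto
    finally have ya: "norm y / a \<le> 1 / r + D / m" .
    have "(norm (offset z))\<^sup>2 + 0 * norm (offset z) \<le> offset z \<bullet> z"
      by (rule offset_dot_ge) (use zero_in in auto)
    then have qb2: "(norm (offset z))\<^sup>2 / b \<le> 1" using ab by (simp add: b_def le_max_iff_disj)
    have "\<bar>b - a\<bar> \<le> \<bar>offset y \<bullet> y - offset z \<bullet> z\<bar>" by (auto simp: a_def b_def)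
    also have "offset y \<bullet> y - offset z \<bullet> z = (offset y - offset z) \<bullet> y + offset z \<bullet> (y - z)"
      by (simp add: algebra_simps)
    also have "\<bar>\<dots>\<bar> \<le> norm (offset y - offset z) * norm y + norm (offset z) * norm (y - z)"
      by (intro order_trans[OF abs_triangle_ineq] add_mono Cauchy_Schwarz_ineq2)
    also have "\<dots> \<le> (2 * norm (y - z)) * norm y + norm (offset z) * norm (y - z)"
      by (intro add_mono mult_right_mono offset_lipschitz) auto
    finally have ba: "\<bar>b - a\<bar> \<le> (2 * norm y + norm (offset z)) * norm (y - z)" by (simp add: algebra_simps)
    have "ext_field y - ext_field z = 2 *\<^sub>R (quat_i *v ((1/a) *\<^sub>R (offset y - offset z) + ((b - a) / (a * b)) *\<^sub>R offset z))"
      using ab unfolding ext_field_def m_def[symmetric] a_def[symmetric] b_def[symmetric]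
      by (simp add: matrix_vector_mult_scaleR matrix_vector_right_distrib matrix_vector_mult_diff_distrib
          algebra_simps diff_divide_distrib flip: scaleR_add_left)
    then have "norm (ext_field y - ext_field z)
        = 2 * norm ((1/a) *\<^sub>R (offset y - offset z) + ((b - a) / (a * b)) *\<^sub>R offset z)" by simp
    also have "\<dots> \<le> 2 * (norm (offset y - offset z) / a + \<bar>b - a\<bar> * (norm (offset z) / (a * b)))"
      using ab by (intro mult_left_mono order_trans[OF norm_triangle_ineq]) (auto simp: abs_mult)
    also have "\<dots> \<le> 2 * ((2 * norm (y - z)) / a + ((2 * norm y + norm (offset z)) * norm (y - z)) * (norm (offset z) / (a * b)))"
      using ab by (intro mult_left_mono add_mono divide_right_mono mult_right_mono ba offset_lipschitz) auto
    also have "\<dots> = 2 * (2 / a + (norm (offset z) / b) * (2 * (norm y / a)) + ((norm (offset z))\<^sup>2 / b) / a) * norm (y - z)"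
      using ab by (simp add: field_simps power2_eq_square)
    also have "\<dots> \<le> L * norm (y - z)"
    proof -
      have "2 / a \<le> 2 / m" using ab m by (simp add: frac_le)
      moreover have "(norm (offset z) / b) * (2 * (norm y / a)) \<le> (1/r) * (2 * (1/r + D/m))"
        using ab m D qb ya r by (intro mult_mono) auto
      moreover have "((norm (offset z))\<^sup>2 / b) / a \<le> 1 / m"
        using qb2 ab m by (intro frac_le) auto
      ultimately show ?thesis unfolding L_def by (intro mult_right_mono mult_left_mono) auto
    qed
    finally show ?thesis .
  qed
  then show thesis by (rule that)
qed

text \<open>The extended field is orthogonal to \<open>offset\<close>, which is half the gradient of
  the squared distance. So a global trajectory keeps its distance from \<open>X\<close> and stays in
  the hypersurface, where the extension is the Reeb field.\<close>

lemma trajectory_exists: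
  assumes y: "y \<in> frontier S"
  obtains c where "reeb_trajectory S c" "c 0 = y"
proof -
  obtain L where L: "\<And>y z. norm (ext_field y - ext_field z) \<le> L * norm (y - z)"
    using ext_field_lipschitz by blast
  obtain r where r: "r > 0" "cball 0 r \<subseteq> X" using inner_ball_exists .
  obtain c where c: "c (0::real) = y" "\<And>t. (c has_vector_derivative ext_field (c t)) (at t)"
    using lipschitz_field_trajectory[OF L ext_field_bound[OF r]] by blast
  have "((\<lambda>t. offset (c t) \<bullet> offset (c t)) has_derivative (\<lambda>h. 0)) (at t within UNIV)" for t
  proof -
    have "(c has_derivative (\<lambda>h. h *\<^sub>R ext_field (c t))) (at t)"
      using c(2) by (simp add: has_vector_derivative_def)
    from has_derivative_compose[OF this norm_offset_sq_derivative] show ?thesis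
      by (simp add: ext_field_def)
  qed
  then have "offset (c t) \<bullet> offset (c t) = offset (c 0) \<bullet> offset (c 0)" for t
    using has_derivative_zero_unique[of UNIV "\<lambda>t. offset (c t) \<bullet> offset (c t)" t] by auto
  then have "norm (offset (c t)) = norm (offset (c 0))" for t
    by (simp add: norm_eq_sqrt_inner)
  then have fr: "c t \<in> frontier S" for t using y c(1) by (simp add: frontier_eq)
  then have "reeb_trajectory S c"
    using c(2) ext_field_eq by (simp add: reeb_trajectory_def)
  then show thesis using that c by blast
qed

lemma reeb_lipschitz:
  obtains L where "\<And>y z. y \<in> frontier S \<Longrightarrow> z \<in> frontier S \<Longrightarrow>
    norm (reeb_field S y - reeb_field S z) \<le> L * norm (y - z)"
  using ext_field_lipschitz ext_field_eq by metis

lemma trajectory_unique: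
  assumes "reeb_trajectory S c" "reeb_trajectory S d" "c 0 = d 0"
  shows "c = d"
proof
  fix t
  obtain L where L: "\<And>y z. y \<in> frontier S \<Longrightarrow> z \<in> frontier S \<Longrightarrow>
    norm (reeb_field S y - reeb_field S z) \<le> L * norm (y - z)" using reeb_lipschitz by blast
  show "c t = d t"
    by (rule lipschitz_field_unique[OF L]) (use assms in \<open>auto simp: reeb_trajectory_def\<close>)
qed

lemma flow_trajectory:
  assumes y: "y \<in> frontier S"
  shows "reeb_trajectory S (\<lambda>t. reeb_flow S t y)" "reeb_flow S 0 y = y"
proof -
  obtain c where c: "reeb_trajectory S c" "c 0 = y" using trajectory_exists[OF y] .
  have "(THE c. reeb_trajectory S c \<and> c 0 = y) = c"
    using c trajectory_unique by (intro the_equality) auto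
  then have "(\<lambda>t. reeb_flow S t y) = c" by (simp add: reeb_flow_def fun_eq_iff)
  then show "reeb_trajectory S (\<lambda>t. reeb_flow S t y)" "reeb_flow S 0 y = y"
    using c by (simp_all add: fun_eq_iff)
qed

lemma flow_in_frontier: "y \<in> frontier S \<Longrightarrow> reeb_flow S t y \<in> frontier S"
  using flow_trajectory(1) by (auto simp: reeb_trajectory_def)

lemma flow_unique: "reeb_trajectory S c \<Longrightarrow> c t = reeb_flow S t (c 0)"
proof -
  assume c: "reeb_trajectory S c"
  then have "c 0 \<in> frontier S" by (simp add: reeb_trajectory_def)
  from trajectory_unique[OF c flow_trajectory(1)[OF this]] flow_trajectory(2)[OF this]
  show ?thesis by metis
qed

lemma trajectory_shift:
  assumes "reeb_trajectory S c"
  shows "reeb_trajectory S (\<lambda>t. c (t + a))"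
proof -
  have "((\<lambda>t. c (t + a)) has_vector_derivative reeb_field S (c (t + a))) (at t)" for t
  proof -
    have "((\<lambda>t. t + a) has_vector_derivative 1) (at t)"
      by (auto intro!: derivative_eq_intros simp: has_vector_derivative_def)
    moreover have "(c has_vector_derivative reeb_field S (c (t + a))) (at (t + a))"
      using assms by (simp add: reeb_trajectory_def)
    ultimately show ?thesis using vector_diff_chain_at[of "\<lambda>t. t + a" 1 t c] by (simp add: o_def)
  qed
  then show ?thesis using assms by (simp add: reeb_trajectory_def)
qed

lemma flow_add:
  assumes "y \<in> frontier S"
  shows "reeb_flow S (t + a) y = reeb_flow S t (reeb_flow S a y)"
  using flow_unique[OF trajectory_shift[OF flow_trajectory(1)[OF assms], of a], of t] by simp

text \<open>By uniqueness, an explicit solution on an interval computes the flow there; later this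
  identifies the curve built over two 3-faces and the 2-face between them.\<close>

lemma flow_local:
  assumes Y: "\<And>t. t \<in> {0..b} \<Longrightarrow> Y t \<in> frontier S \<and> (Y has_vector_derivative reeb_field S (Y t)) (at t within {0..b})"
    and t: "t \<in> {0..b}"
  shows "reeb_flow S t (Y 0) = Y t"
proof -
  have Y0: "Y 0 \<in> frontier S" using Y t by auto
  obtain L where L: "\<And>y z. y \<in> frontier S \<Longrightarrow> z \<in> frontier S \<Longrightarrow>
    norm (reeb_field S y - reeb_field S z) \<le> L * norm (y - z)" using reeb_lipschitz by blast
  show ?thesis
    by (rule lipschitz_field_unique_forward[OF L, where b=b])
       (use Y t flow_trajectory[OF Y0] in \<open>auto simp: reeb_trajectory_def intro: has_vector_derivative_at_within\<close>)
qed

text \<open>The factor \<open>2 / (offset y \<bullet> y)\<close> is the normalization that gives the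
  value 1, and because of it the action of an orbit is its period.\<close>

lemma lambda0_reeb:
  assumes y: "y \<in> frontier S"
  shows "lambda0 y (reeb_field S y) = 1"
  using offset_dot_pos[OF y] eps
  by (simp add: reeb_field_eq[OF y] lambda0_eq inner_commute)
     (smt (verit) zero_less_power2 divide_self_if)

lemma action_eq_period:
  assumes c: "reeb_trajectory S c" and T: "T > 0"
  shows "orbit_action T c = T"
proof -
  have "vector_derivative c (at t within {0..T}) = reeb_field S (c t)" if "t \<in> {0..T}" for t
  proof -
    have "(c has_vector_derivative reeb_field S (c t)) (at t within {0..T})"
      using c by (simp add: reeb_trajectory_def has_vector_derivative_at_within)
    then show ?thesis
      using that T by (intro vector_derivative_within_closed_interval)
  qed
  then have "integral {0..T} (\<lambda>t. lambda0 (c t) (vector_derivative c (at t within {0..T}))) = integral {0..T} (\<lambda>t. 1)"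
    using c lambda0_reeb by (intro integral_cong) (simp add: reeb_trajectory_def)
  then show ?thesis using T by (simp add: orbit_action_def lambda0_integral_def)
qed

end

section \<open>Translation numbers and lifts\<close>

lemma continuous_integer_valued_constant:
  fixes f :: "'a::topological_space \<Rightarrow> real"
  assumes "connected A" "continuous_on A f" "\<And>x. x \<in> A \<Longrightarrow> f x \<in> \<int>" "x \<in> A" "y \<in> A"
  shows "f x = f y"
proof -
  have "f constant_on A"
  proof (rule continuous_discrete_range_constant[OF assms(1,2)])
    fix x assume x: "x \<in> A"
    have "1 \<le> norm (f y - f x)" if "y \<in> A" "f y \<noteq> f x" for y
    proof -
      have "f y - f x \<in> \<int>" using assms(3) x that by (intro Ints_diff) auto
      then obtain k :: int where k: "f y - f x = k" by (metis Ints_cases)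
      then have "k \<noteq> 0" using that by auto
      then have "1 \<le> \<bar>real_of_int k\<bar>" by linarith
      then show ?thesis using k by simp
    qed
    then show "\<exists>e>0. \<forall>y. y \<in> A \<and> f y \<noteq> f x \<longrightarrow> e \<le> norm (f y - f x)"
      by (intro exI[of _ 1]) auto
  qed
  then obtain c where "\<forall>x\<in>A. f x = c" unfolding constant_on_def by blast
  then show ?thesis using assms(4,5) by simp
qed

lemma circle_pt_nth [simp]:
  "circle_pt t $ 1 = cos (2 * pi * t)" "circle_pt t $ 2 = sin (2 * pi * t)"
  by (simp_all add: circle_pt_def)

lemma circle_pt_same_ray:
  assumes "a *\<^sub>R circle_pt s = b *\<^sub>R circle_pt t" "a > 0" "b > 0"
  obtains k :: int where "s = t + k"
proof -
  have c: "a * cos (2 * pi * s) = b * cos (2 * pi * t)" "a * sin (2 * pi * s) = b * sin (2 * pi * t)"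
    using assms(1) by (simp_all add: vec_eq_iff forall_2)
  have "a\<^sup>2 = (a * cos (2 * pi * s))\<^sup>2 + (a * sin (2 * pi * s))\<^sup>2"
    by (simp add: power_mult_distrib flip: distrib_left)
  also have "\<dots> = b\<^sup>2" unfolding c by (simp add: power_mult_distrib flip: distrib_left)
  finally have "a = b" using assms by (simp add: power2_eq_iff)
  then obtain n :: int where "2 * pi * s = 2 * pi * t + 2 * pi * n"
    using c assms sin_cos_eq_iff[of "2 * pi * s" "2 * pi * t"] by auto
  then have "2 * pi * s = 2 * pi * (t + n)" by (simp add: algebra_simps)
  then have "s = t + n" by simp
  then show thesis by (rule that)
qed

lemma ray_lift_shift_nat:
  assumes "ray_lift A \<Phi>" shows "\<Phi> (t + real n) = \<Phi> t + real n"
proof (induction n)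
  case (Suc n)
  have "\<Phi> (t + real (Suc n)) = \<Phi> ((t + real n) + 1)" by (simp add: algebra_simps)
  also have "\<dots> = \<Phi> (t + real n) + 1" using assms unfolding ray_lift_def by blast
  finally show ?case using Suc by simp
qed auto

lemma ray_lift_shift_int:
  assumes "ray_lift A \<Phi>" shows "\<Phi> (t + of_int k) = \<Phi> t + of_int k"
proof (cases "k \<ge> 0")
  case True
  then show ?thesis using ray_lift_shift_nat[OF assms, of t "nat k"] by simp
next
  case False
  then show ?thesis using ray_lift_shift_nat[OF assms, of "t + of_int k" "nat (- k)"] by simp
qed

lemma ray_lift_same:
  assumes "ray_lift A \<Phi>" "ray_lift A \<Psi>"
  shows "\<Phi> t - \<Psi> t \<in> \<int>"
proof -
  obtain a b where "A *v circle_pt t = a *\<^sub>R circle_pt (\<Phi> t)" "a > 0"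
     "A *v circle_pt t = b *\<^sub>R circle_pt (\<Psi> t)" "b > 0"
    using assms unfolding ray_lift_def by blast
  then obtain k :: int where "\<Phi> t = \<Psi> t + k" using circle_pt_same_ray by metis
  then show ?thesis by simp
qed

text \<open>The difference of two lifts is continuous with integer values, and the line is
  connected.\<close>

lemma ray_lift_unique:
  assumes "ray_lift A \<Phi>" "ray_lift A \<Psi>"
  obtains k :: int where "\<Phi> = (\<lambda>t. \<Psi> t + k)"
proof -
  have c: "continuous_on UNIV (\<lambda>t. \<Phi> t - \<Psi> t)"
    using assms by (intro continuous_intros) (simp_all add: ray_lift_def)
  obtain k :: int where "\<Phi> 0 - \<Psi> 0 = k" using ray_lift_same[OF assms] by (metis Ints_cases)
  moreover have "\<Phi> t - \<Psi> t = \<Phi> 0 - \<Psi> 0" for t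
    by (rule continuous_integer_valued_constant[OF connected_UNIV c]) (use ray_lift_same[OF assms] in auto)
  ultimately have "\<Phi> = (\<lambda>t. \<Psi> t + k)" by (simp add: fun_eq_iff algebra_simps)
  then show thesis by (rule that)
qed

lemma matrix_mult_add_left: "(A + B) ** C = A ** C + (B ** C :: real^'n^'m)"
  by (simp add: matrix_matrix_mult_def vec_eq_iff distrib_right sum.distrib)

lemma Sp2_det: "A \<in> Sp2 \<longleftrightarrow> A$1$1 * A$2$2 - A$1$2 * A$2$1 = 1"
proof
  assume "A \<in> Sp2"
  then have "(A *v axis 1 1)$1 * (A *v axis 2 1)$2 - (A *v axis 1 1)$2 * (A *v axis 2 1)$1
     = (axis 1 1 :: real^2)$1 * (axis 2 1 :: real^2)$2 - (axis 1 1 :: real^2)$2 * (axis 2 1 :: real^2)$1"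
    unfolding Sp2_def by blast
  then show "A$1$1 * A$2$2 - A$1$2 * A$2$1 = 1"
    by (simp add: matrix_vector_mult_def sum_2 axis_def algebra_simps)
next
  assume *: "A$1$1 * A$2$2 - A$1$2 * A$2$1 = 1"
  have "(A *v v)$1 * (A *v w)$2 - (A *v v)$2 * (A *v w)$1 =
      (A$1$1 * A$2$2 - A$1$2 * A$2$1) * (v$1 * w$2 - v$2 * w$1)" for v w :: "real^2"
    by (simp add: matrix_vector_mult_def sum_2 algebra_simps)
  then show "A \<in> Sp2" by (simp add: Sp2_def *)
qed

lemma Sp2_inj:
  assumes A: "A \<in> Sp2" and "A *v v = A *v w" shows "v = w"
proof -
  have 1: "(A *v (v - w))$1 * (A *v u)$2 - (A *v (v - w))$2 * (A *v u)$1 = (v - w)$1 * u$2 - (v - w)$2 * u$1" for u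
    using A unfolding Sp2_def by blast
  have "A *v (v - w) = 0" using assms by (simp add: matrix_vector_mult_diff_distrib)
  then show ?thesis using 1[of "axis 1 1"] 1[of "axis 2 1"] by (auto simp: vec_eq_iff forall_2 axis_def)
qed

text \<open>A continuous injective function is monotone on an interval. The interval is extended to
  \<open>x + real n\<close>, where \<open>\<Phi>\<close> exceeds its value at \<open>x\<close> by
  \<open>n\<close>; this excludes that it decreases.\<close>

lemma ray_lift_strict_mono:
  assumes A: "A \<in> Sp2" and \<Phi>: "ray_lift A \<Phi>"
  shows "strict_mono \<Phi>"
proof (rule strict_monoI)
  have inj: "s = t" if eq: "\<Phi> s = \<Phi> t" for s t
  proof -
    obtain a b where ab: "A *v circle_pt s = a *\<^sub>R circle_pt (\<Phi> s)" "a > 0"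
      "A *v circle_pt t = b *\<^sub>R circle_pt (\<Phi> t)" "b > 0"
      using \<Phi> unfolding ray_lift_def by blast
    have "A *v (b *\<^sub>R circle_pt s) = A *v (a *\<^sub>R circle_pt t)"
      using ab eq by (simp add: matrix_vector_mult_scaleR mult.commute)
    then have "b *\<^sub>R circle_pt s = a *\<^sub>R circle_pt t" by (rule Sp2_inj[OF A])
    then obtain k :: int where "s = t + k" using circle_pt_same_ray ab by metis
    then show ?thesis using ray_lift_shift_int[OF \<Phi>, of t k] eq by simp
  qed
  fix x y :: real assume xy: "x < y"
  obtain n where n: "y - x < real n" using reals_Archimedean2 by blast
  have "(\<Phi> x < \<Phi> y \<and> \<Phi> y < \<Phi> (x + real n)) \<or> (\<Phi> (x + real n) < \<Phi> y \<and> \<Phi> y < \<Phi> x)"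
  proof (rule continuous_inj_imp_mono[of x y "x + real n" \<Phi>])
    show "continuous_on {x..x + real n} \<Phi>"
      using \<Phi> continuous_on_subset[of UNIV \<Phi>] by (simp add: ray_lift_def)
    show "inj_on \<Phi> {x..x + real n}" using inj by (auto simp: inj_on_def)
  qed (use xy n in auto)
  then show "\<Phi> x < \<Phi> y" using ray_lift_shift_nat[OF \<Phi>, of x n] by auto
qed

lemma ray_lift_compose:
  assumes "ray_lift A \<Phi>" "ray_lift B \<Psi>"
  shows "ray_lift (A ** B) (\<Phi> \<circ> \<Psi>)"
  unfolding ray_lift_def
proof (intro conjI allI)
  show "continuous_on UNIV (\<Phi> \<circ> \<Psi>)"
    using assms continuous_on_subset[of UNIV \<Phi>] by (intro continuous_on_compose) (auto simp: ray_lift_def)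
  show "(\<Phi> \<circ> \<Psi>) (t + 1) = (\<Phi> \<circ> \<Psi>) t + 1" for t using assms by (simp add: ray_lift_def)
  fix t
  obtain b where b: "b > 0" "B *v circle_pt t = b *\<^sub>R circle_pt (\<Psi> t)"
    using assms unfolding ray_lift_def by blast
  obtain a where a: "a > 0" "A *v circle_pt (\<Psi> t) = a *\<^sub>R circle_pt (\<Phi> (\<Psi> t))"
    using assms unfolding ray_lift_def by blast
  have "(A ** B) *v circle_pt t = (b * a) *\<^sub>R circle_pt ((\<Phi> \<circ> \<Psi>) t)"
    using a b by (simp add: matrix_vector_mult_scaleR flip: matrix_vector_mul_assoc)
  then show "\<exists>r>0. (A ** B) *v circle_pt t = r *\<^sub>R circle_pt ((\<Phi> \<circ> \<Psi>) t)"
    using a b by (intro exI[of _ "b * a"]) auto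
qed

lemma Sp2_mult: "A \<in> Sp2 \<Longrightarrow> B \<in> Sp2 \<Longrightarrow> A ** B \<in> Sp2"
  unfolding Sp2_def by (simp flip: matrix_vector_mul_assoc)

lemma cover_mult_in: "a \<in> Sp2_cover \<Longrightarrow> b \<in> Sp2_cover \<Longrightarrow> cover_mult a b \<in> Sp2_cover"
  by (auto simp: Sp2_cover_def cover_mult_def intro: Sp2_mult ray_lift_compose)

lemma ray_lift_one: "ray_lift (mat 1) id"
  by (auto simp: ray_lift_def intro!: exI[of _ 1])

lemma cover_one_in: "cover_one \<in> Sp2_cover"
  using ray_lift_one by (simp add: cover_one_def Sp2_cover_def Sp2_def)

lemma ray_lift_funpow:
  assumes A: "A \<in> Sp2" and \<Phi>: "ray_lift A \<Phi>"
  obtains B where "B \<in> Sp2" "ray_lift B (\<Phi> ^^ n)"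
proof -
  have "\<exists>B. B \<in> Sp2 \<and> ray_lift B (\<Phi> ^^ n)"
  proof (induction n)
    case 0
    then show ?case using cover_one_in by (auto simp: cover_one_def Sp2_cover_def id_def)
  next
    case (Suc n)
    then show ?case using A \<Phi> Sp2_mult ray_lift_compose by (metis funpow.simps(2))
  qed
  then show thesis using that by blast
qed

text \<open>Poincare: the displacement of \<open>\<Phi>\<^sup>n\<close> varies by at most 1, so \<open>a n = \<Phi>\<^sup>n 0\<close> satisfies
  \<open>\<bar>a (m n) - m a n\<bar> \<le> m\<close>, and \<open>a n / n\<close> is a Cauchy sequence.\<close>

lemma translation_number_exists:
  assumes A: "A \<in> Sp2" and \<Phi>: "ray_lift A \<Phi>"
  obtains r where "\<And>t. (\<lambda>n. ((\<Phi> ^^ n) t - t) / real n) \<longlonglongrightarrow> r"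
proof -
  define a where "a n = (\<Phi> ^^ n) 0" for n
  have key: "\<bar>(\<Phi> ^^ n) t - t - a n\<bar> \<le> 1" for n t
  proof -
    obtain B where B: "B \<in> Sp2" "ray_lift B (\<Phi> ^^ n)" using ray_lift_funpow[OF A \<Phi>] .
    have m: "mono (\<Phi> ^^ n)" using ray_lift_strict_mono[OF B] by (rule strict_mono_mono)
    define k where "k = \<lfloor>t\<rfloor>"
    have k: "of_int k \<le> t" "t \<le> of_int (k + 1)" unfolding k_def by linarith+
    have "a n + of_int k \<le> (\<Phi> ^^ n) t" "(\<Phi> ^^ n) t \<le> a n + of_int (k + 1)"
      using monoD[OF m k(1)] monoD[OF m k(2)] ray_lift_shift_int[OF B(2), of 0 k]
        ray_lift_shift_int[OF B(2), of 0 "k + 1"] by (simp_all add: a_def)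
    then show ?thesis using k by auto
  qed
  have mult: "\<bar>a (m * n) - real m * a n\<bar> \<le> real m" for m n
  proof (induction m)
    case 0 then show ?case by (simp add: a_def)
  next
    case (Suc m)
    have "a (Suc m * n) = (\<Phi> ^^ n) (a (m * n))" by (simp add: a_def funpow_add)
    then show ?case using key[of n "a (m * n)"] Suc by (auto simp: abs_le_iff algebra_simps)
  qed
  \<comment> \<open>Both \<open>m * a n\<close> and \<open>n * a m\<close> are close to
    \<open>a (m * n)\<close>.\<close>
  have close: "\<bar>a m / real m - a n / real n\<bar> \<le> 1 / real m + 1 / real n" if "m > 0" "n > 0" for m n
  proof -
    have "\<bar>real m * a n - real n * a m\<bar> \<le> real m + real n"
      using mult[of m n] mult[of n m] by (simp add: mult.commute abs_le_iff)
    then have "\<bar>real n * a m - real m * a n\<bar> / (real m * real n) \<le> (real m + real n) / (real m * real n)"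
      using that by (intro divide_right_mono) (auto simp: abs_minus_commute)
    moreover have "\<bar>a m / real m - a n / real n\<bar> = \<bar>(real n * a m - real m * a n) / (real m * real n)\<bar>"
      using that by (simp add: field_simps)
    ultimately show ?thesis using that by (simp add: abs_divide add_divide_distrib)
  qed
  have "Cauchy (\<lambda>n. a n / real n)"
  proof (rule CauchyI)
    fix e :: real assume e: "e > 0"
    obtain N where N: "2 / e < real N" using reals_Archimedean2 by blast
    then have N0: "N > 0" using e by (metis divide_pos_pos gr0I less_asym of_nat_0 zero_less_numeral)
    show "\<exists>M. \<forall>m\<ge>M. \<forall>n\<ge>M. norm (a m / real m - a n / real n) < e"
    proof (intro exI[of _ N] allI impI)
      fix m n assume mn: "m \<ge> N" "n \<ge> N"
      have "1 / real m \<le> 1 / real N" "1 / real n \<le> 1 / real N" using mn N0 by (auto intro!: divide_left_mono)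
      moreover have "1 / real N + 1 / real N < e" using N N0 e by (simp add: field_simps)
      ultimately show "norm (a m / real m - a n / real n) < e"
        using close[of m n] mn N0 by auto
    qed
  qed
  then obtain r where r: "(\<lambda>n. a n / real n) \<longlonglongrightarrow> r" by (auto simp: Cauchy_convergent_iff convergent_def)
  have "(\<lambda>n. ((\<Phi> ^^ n) t - t) / real n) \<longlonglongrightarrow> r" for t
  proof -
    have "(\<lambda>n. ((\<Phi> ^^ n) t - t - a n) / real n) \<longlonglongrightarrow> 0"
    proof (rule Lim_null_comparison)
      show "\<forall>\<^sub>F n in sequentially. norm (((\<Phi> ^^ n) t - t - a n) / real n) \<le> 1 / real n"
        using key by (auto simp: abs_divide intro!: always_eventually divide_right_mono)
      show "(\<lambda>n. 1 / real n) \<longlonglongrightarrow> 0" by (rule lim_1_over_n)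
    qed
    from tendsto_add[OF this r] show ?thesis by (simp add: diff_divide_distrib)
  qed
  then show thesis by (rule that)
qed

lemma translation_number_eq:
  assumes "\<And>t. (\<lambda>n. ((\<Phi> ^^ n) t - t) / real n) \<longlonglongrightarrow> r"
  shows "translation_number \<Phi> = r"
  unfolding translation_number_def
  by (rule the_equality) (use assms LIMSEQ_unique in blast)+

lemma translation_number_shift:
  assumes A: "A \<in> Sp2" and \<Phi>: "ray_lift A \<Phi>"
  shows "translation_number (\<lambda>t. \<Phi> t + of_int k) = translation_number \<Phi> + of_int k"
proof -
  obtain r where r: "\<And>t. (\<lambda>n. ((\<Phi> ^^ n) t - t) / real n) \<longlonglongrightarrow> r" using translation_number_exists[OF A \<Phi>] by metis
  have pow: "((\<lambda>t. \<Phi> t + of_int k) ^^ n) t = (\<Phi> ^^ n) t + of_int (int n * k)" for n t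
  proof (induction n)
    case (Suc n)
    then show ?case using ray_lift_shift_int[OF \<Phi>, of "(\<Phi> ^^ n) t" "int n * k"] by (simp add: algebra_simps)
  qed auto
  have "(\<lambda>n. (((\<lambda>t. \<Phi> t + of_int k) ^^ n) t - t) / real n) \<longlonglongrightarrow> r + of_int k" for t
  proof (rule Lim_transform_eventually)
    show "(\<lambda>n. ((\<Phi> ^^ n) t - t) / real n + of_int k) \<longlonglongrightarrow> r + of_int k"
      by (intro tendsto_intros r)
    show "\<forall>\<^sub>F n in sequentially. ((\<Phi> ^^ n) t - t) / real n + of_int k = (((\<lambda>t. \<Phi> t + of_int k) ^^ n) t - t) / real n"
      using eventually_gt_at_top[of 0] by eventually_elim (simp only: pow, simp add: field_simps)
  qed
  from translation_number_eq[OF this] translation_number_eq[OF r] show ?thesis by simp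
qed

lemma translation_number_bounds:
  assumes A: "A \<in> Sp2" and \<Phi>: "ray_lift A \<Phi>" and b: "\<And>t. l \<le> \<Phi> t - t \<and> \<Phi> t - t \<le> u"
  shows "l \<le> translation_number \<Phi>" "translation_number \<Phi> \<le> u"
proof -
  obtain r where r: "\<And>t. (\<lambda>n. ((\<Phi> ^^ n) t - t) / real n) \<longlonglongrightarrow> r" using translation_number_exists[OF A \<Phi>] by metis
  have "real n * l \<le> (\<Phi> ^^ n) 0 \<and> (\<Phi> ^^ n) 0 \<le> real n * u" for n
  proof (induction n)
    case (Suc n)
    then show ?case using b[of "(\<Phi> ^^ n) 0"] by (auto simp: algebra_simps)
  qed auto
  then have "l \<le> ((\<Phi> ^^ n) 0 - 0) / real n \<and> ((\<Phi> ^^ n) 0 - 0) / real n \<le> u" if "n \<ge> 1" for n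
    using that by (simp add: field_simps)
  then have "\<exists>N. \<forall>n\<ge>N. l \<le> ((\<Phi> ^^ n) 0 - 0) / real n" "\<exists>N. \<forall>n\<ge>N. ((\<Phi> ^^ n) 0 - 0) / real n \<le> u"
    by (auto intro: exI[of _ 1])
  then have "l \<le> r" "r \<le> u" using LIMSEQ_le_const[OF r[of 0]] LIMSEQ_le_const2[OF r[of 0]] by auto
  then show "l \<le> translation_number \<Phi>" "translation_number \<Phi> \<le> u" using translation_number_eq[OF r] by auto
qed

text \<open>Displacements in \<open>[0, 1/2]\<close> give a rotation number in that interval, and
  every other lift differs by a nonzero integer, which leads out of the window of
  \<open>small_lift\<close>. So small lifts are recognized by their displacement, without computing
  a rotation number.\<close>

lemma small_lift_eq:
  assumes A: "A \<in> Sp2" and \<Phi>: "ray_lift A \<Phi>" and b: "\<And>t. 0 \<le> \<Phi> t - t \<and> \<Phi> t - t \<le> 1/2"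
  shows "small_lift A = (A, \<Phi>)"
  unfolding small_lift_def
proof (rule the_equality)
  have rot: "0 \<le> translation_number \<Phi>" "translation_number \<Phi> \<le> 1/2"
    using translation_number_bounds[OF A \<Phi> b] by auto
  then show "(A, \<Phi>) \<in> Sp2_cover \<and> fst (A, \<Phi>) = A \<and> - 1/2 < rot (A, \<Phi>) \<and> rot (A, \<Phi>) \<le> 1/2"
    using A \<Phi> by (simp add: Sp2_cover_def rot_def)
  fix a assume a: "a \<in> Sp2_cover \<and> fst a = A \<and> - 1/2 < rot a \<and> rot a \<le> 1/2"
  then have "ray_lift A (snd a)" by (auto simp: Sp2_cover_def)
  then obtain k :: int where k: "snd a = (\<lambda>t. \<Phi> t + k)" using ray_lift_unique \<Phi> by metis
  then have "rot a = translation_number \<Phi> + k" using translation_number_shift[OF A \<Phi>] by (simp add: rot_def)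
  then have "real_of_int k < 1" "- 1 < real_of_int k" using a rot by auto
  then have "k = 0" by linarith
  then show "a = (A, \<Phi>)" using a k by (simp add: prod_eq_iff fun_eq_iff)
qed

text \<open>Two lifts of a path differ by an integer that varies continuously in time and is 0 at
  the start. Hence the definite description in \<open>orbit_rho\<close> denotes whichever lift gets
  constructed.\<close>

lemma path_lift_end_unique:
  assumes a: "path_lift_end T A a" and b: "path_lift_end T A b" and T: "T \<ge> 0"
  shows "a = b"
proof -
  obtain \<Phi> where \<Phi>: "\<And>s. continuous_on {0..T} (\<lambda>t. \<Phi> t s)" "\<And>t. t \<in> {0..T} \<Longrightarrow> (A t, \<Phi> t) \<in> Sp2_cover"
    "(A 0, \<Phi> 0) = cover_one" "(A T, \<Phi> T) = a" using a unfolding path_lift_end_def by blast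
  obtain \<Psi> where \<Psi>: "\<And>s. continuous_on {0..T} (\<lambda>t. \<Psi> t s)" "\<And>t. t \<in> {0..T} \<Longrightarrow> (A t, \<Psi> t) \<in> Sp2_cover"
    "(A 0, \<Psi> 0) = cover_one" "(A T, \<Psi> T) = b" using b unfolding path_lift_end_def by blast
  have "\<Phi> T s - \<Psi> T s = \<Phi> 0 s - \<Psi> 0 s" for s
  proof (rule continuous_integer_valued_constant[of "{0..T}" "\<lambda>t. \<Phi> t s - \<Psi> t s"])
    show "continuous_on {0..T} (\<lambda>t. \<Phi> t s - \<Psi> t s)" by (intro continuous_intros \<Phi> \<Psi>)
    show "\<Phi> t s - \<Psi> t s \<in> \<int>" if "t \<in> {0..T}" for t
      using \<Phi>(2)[OF that] \<Psi>(2)[OF that] by (intro ray_lift_same) (auto simp: Sp2_cover_def)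
  qed (use T in auto)
  moreover have "\<Phi> 0 = \<Psi> 0" using \<Phi>(3) \<Psi>(3) by (metis snd_conv)
  ultimately have "\<Phi> T = \<Psi> T" by (simp add: fun_eq_iff)
  then show ?thesis using \<Phi>(4) \<Psi>(4) by simp
qed

lemma path_lift_end_zero: "A 0 = mat 1 \<Longrightarrow> path_lift_end 0 A cover_one"
  unfolding path_lift_end_def
  by (intro exI[of _ "\<lambda>_. id"]) (use cover_one_in in \<open>auto simp: cover_one_def\<close>)

text \<open>\<open>\<theta> \<mapsto> ell p q r \<theta>\<close> is the one-parameter group generated by the matrix
  ((-p, -q), (r, p)), whose square is - 1.\<close>

definition ell :: "real \<Rightarrow> real \<Rightarrow> real \<Rightarrow> real \<Rightarrow> real^2^2" where
  "ell p q r \<theta> = cos \<theta> *\<^sub>R mat 1 + sin \<theta> *\<^sub>R vector [vector [- p, - q], vector [r, p]]"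

text \<open>\<open>ell_re\<close> and \<open>ell_im\<close> are the coordinates of the image of \<open>circle_pt t\<close> with respect to the
  orthonormal basis \<open>circle_pt t\<close>, \<open>circle_pt (t + 1/4)\<close>.\<close>

definition ell_re :: "real \<Rightarrow> real \<Rightarrow> real \<Rightarrow> real \<Rightarrow> real \<Rightarrow> real" where
  "ell_re p q r \<theta> t = cos \<theta> + sin \<theta> * (- p * (cos (2*pi*t))\<^sup>2 + (r - q) * (cos (2*pi*t) * sin (2*pi*t)) + p * (sin (2*pi*t))\<^sup>2)"

definition ell_im :: "real \<Rightarrow> real \<Rightarrow> real \<Rightarrow> real \<Rightarrow> real \<Rightarrow> real" where
  "ell_im p q r \<theta> t = sin \<theta> * (r * (cos (2*pi*t))\<^sup>2 + 2 * p * (cos (2*pi*t) * sin (2*pi*t)) + q * (sin (2*pi*t))\<^sup>2)"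

text \<open>For \<open>\<theta>\<close> in \<open>[0, pi]\<close> the coordinate
  \<open>ell_im\<close> is nonnegative, so the ray turns by an angle in \<open>[0, pi]\<close>, and
  the inverse cosine yields this angle continuously with no choice of a branch.\<close>

definition ell_angle :: "real \<Rightarrow> real \<Rightarrow> real \<Rightarrow> real \<Rightarrow> real \<Rightarrow> real" where
  "ell_angle p q r \<theta> t = arccos (ell_re p q r \<theta> t / sqrt ((ell_re p q r \<theta> t)\<^sup>2 + (ell_im p q r \<theta> t)\<^sup>2))"

definition ell_lift :: "real \<Rightarrow> real \<Rightarrow> real \<Rightarrow> real \<Rightarrow> real \<Rightarrow> real" where
  "ell_lift p q r \<theta> t = t + ell_angle p q r \<theta> t / (2 * pi)"

context
  fixes p q r :: real
  assumes r: "r > 0" and det: "q * r - p\<^sup>2 = 1"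
begin

lemma ell_nth: "ell p q r \<theta> $ 1 $ 1 = cos \<theta> - p * sin \<theta>" "ell p q r \<theta> $ 1 $ 2 = - q * sin \<theta>"
  "ell p q r \<theta> $ 2 $ 1 = r * sin \<theta>" "ell p q r \<theta> $ 2 $ 2 = cos \<theta> + p * sin \<theta>"
  by (simp_all add: ell_def mat_def)

lemma ell_Sp2: "ell p q r \<theta> \<in> Sp2"
proof -
  have "(cos \<theta> - p * sin \<theta>) * (cos \<theta> + p * sin \<theta>) - (- q * sin \<theta>) * (r * sin \<theta>)
     = (cos \<theta>)\<^sup>2 + (q * r - p\<^sup>2) * (sin \<theta>)\<^sup>2" by (simp add: algebra_simps power2_eq_square)
  then show ?thesis unfolding Sp2_det ell_nth det by simp
qed

text \<open>The quadratic form with matrix ((r, p), (p, q)) has determinant 1 and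
  \<open>r > 0\<close>; completing the square shows that it is positive definite. Geometrically, the
  generator moves every ray counterclockwise.\<close>

lemma ell_im_pos:
  "r * (cos x)\<^sup>2 + 2 * p * (cos x * sin x) + q * (sin x)\<^sup>2 > 0"
proof -
  have "r * (r * (cos x)\<^sup>2 + 2 * p * (cos x * sin x) + q * (sin x)\<^sup>2)
      = (r * cos x + p * sin x)\<^sup>2 + (q * r - p\<^sup>2) * (sin x)\<^sup>2"
    by (simp add: algebra_simps power2_eq_square)
  also have "\<dots> = (r * cos x + p * sin x)\<^sup>2 + (sin x)\<^sup>2" using det by simp
  also have "\<dots> > 0"
  proof (cases "sin x = 0")
    case True
    then have "cos x \<noteq> 0" using sin_cos_squared_add[of x] by auto
    then show ?thesis using True r by simp
  qed (simp add: add_nonneg_pos)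
  finally show ?thesis using r by (simp add: zero_less_mult_iff)
qed

lemma ell_lift_denom: "(ell_re p q r \<theta> t)\<^sup>2 + (ell_im p q r \<theta> t)\<^sup>2 > 0"
proof (cases "sin \<theta> = 0")
  case True
  then have "cos \<theta> \<noteq> 0" using sin_cos_squared_add[of \<theta>] by auto
  then show ?thesis using True by (simp add: ell_re_def ell_im_def)
next
  case False
  then have "ell_im p q r \<theta> t \<noteq> 0" using ell_im_pos[of "2*pi*t"] by (simp add: ell_im_def)
  then show ?thesis by (simp add: add_nonneg_pos)
qed

lemma ell_lift_quotient:
  "- 1 \<le> ell_re p q r \<theta> t / sqrt ((ell_re p q r \<theta> t)\<^sup>2 + (ell_im p q r \<theta> t)\<^sup>2)"
  "ell_re p q r \<theta> t / sqrt ((ell_re p q r \<theta> t)\<^sup>2 + (ell_im p q r \<theta> t)\<^sup>2) \<le> 1"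
proof -
  have "\<bar>ell_re p q r \<theta> t / sqrt ((ell_re p q r \<theta> t)\<^sup>2 + (ell_im p q r \<theta> t)\<^sup>2)\<bar> \<le> 1"
    using ell_lift_denom[of \<theta> t] real_sqrt_ge_abs1[of "ell_re p q r \<theta> t" "ell_im p q r \<theta> t"]
    by (simp add: abs_divide)
  then show "- 1 \<le> ell_re p q r \<theta> t / sqrt ((ell_re p q r \<theta> t)\<^sup>2 + (ell_im p q r \<theta> t)\<^sup>2)"
    "ell_re p q r \<theta> t / sqrt ((ell_re p q r \<theta> t)\<^sup>2 + (ell_im p q r \<theta> t)\<^sup>2) \<le> 1"
    by linarith+
qed

lemma ell_lift_ray_lift:
  assumes \<theta>: "0 \<le> \<theta>" "\<theta> \<le> pi"
  shows "ray_lift (ell p q r \<theta>) (ell_lift p q r \<theta>)"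
  unfolding ray_lift_def
proof (intro conjI allI)
  have "continuous_on UNIV (ell_angle p q r \<theta>)"
    unfolding ell_angle_def
  proof (rule continuous_on_compose2[OF continuous_on_arccos'])
    show "continuous_on UNIV (\<lambda>t. ell_re p q r \<theta> t / sqrt ((ell_re p q r \<theta> t)\<^sup>2 + (ell_im p q r \<theta> t)\<^sup>2))"
      using ell_lift_denom[of \<theta>] unfolding ell_re_def ell_im_def
      by (intro continuous_intros) (auto simp: less_le)
    show "range (\<lambda>t. ell_re p q r \<theta> t / sqrt ((ell_re p q r \<theta> t)\<^sup>2 + (ell_im p q r \<theta> t)\<^sup>2)) \<subseteq> {-1..1}"
      using ell_lift_quotient[of \<theta>] by auto
  qed
  then show "continuous_on UNIV (ell_lift p q r \<theta>)"
    unfolding ell_lift_def by (intro continuous_intros) auto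
  show "ell_lift p q r \<theta> (t + 1) = ell_lift p q r \<theta> t + 1" for t
    by (simp add: ell_lift_def ell_angle_def ell_re_def ell_im_def distrib_left)
  fix t
  define C where "C = cos (2 * pi * t)"
  define Z where "Z = sin (2 * pi * t)"
  have CZ: "C\<^sup>2 + Z\<^sup>2 = 1" by (simp add: C_def Z_def)
  define a where "a = ell_re p q r \<theta> t"
  define b where "b = ell_im p q r \<theta> t"
  define \<rho> where "\<rho> = sqrt (a\<^sup>2 + b\<^sup>2)"
  have \<rho>: "\<rho> > 0" "\<rho>\<^sup>2 = a\<^sup>2 + b\<^sup>2" using ell_lift_denom[of \<theta> t] by (simp_all add: \<rho>_def a_def b_def)
  have b0: "b \<ge> 0" unfolding b_def ell_im_def
    using \<theta> ell_im_pos[of "2*pi*t"] by (intro mult_nonneg_nonneg sin_ge_zero) auto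
  define \<phi> where "\<phi> = arccos (a / \<rho>)"
  have q1: "- 1 \<le> a / \<rho>" "a / \<rho> \<le> 1"
    using ell_lift_quotient[of \<theta> t] unfolding a_def[symmetric] b_def[symmetric] \<rho>_def[symmetric] by linarith+
  have cos: "cos \<phi> = a / \<rho>" using q1 by (simp add: \<phi>_def)
  have "sin \<phi> = sqrt (1 - (a / \<rho>)\<^sup>2)" using q1 by (simp add: \<phi>_def sin_arccos)
  also have "1 - (a / \<rho>)\<^sup>2 = (b / \<rho>)\<^sup>2"
  proof -
    have "(a / \<rho>)\<^sup>2 + (b / \<rho>)\<^sup>2 = (a\<^sup>2 + b\<^sup>2) / \<rho>\<^sup>2" by (simp only: power_divide add_divide_distrib)
    then show ?thesis using \<rho>(1) by (simp add: \<rho>(2)[symmetric])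
  qed
  finally have sin: "sin \<phi> = b / \<rho>" using b0 \<rho> by simp
  have L: "2 * pi * ell_lift p q r \<theta> t = 2 * pi * t + \<phi>"
    by (simp add: ell_lift_def ell_angle_def \<phi>_def \<rho>_def a_def b_def distrib_left)
  have ab: "a = cos \<theta> + sin \<theta> * (- p * C\<^sup>2 + (r - q) * (C * Z) + p * Z\<^sup>2)"
     "b = sin \<theta> * (r * C\<^sup>2 + 2 * p * (C * Z) + q * Z\<^sup>2)"
    by (simp_all add: a_def b_def ell_re_def ell_im_def C_def Z_def)
  \<comment> \<open>The basis in which \<open>a\<close> and \<open>b\<close> are coordinates turns
    with \<open>t\<close>; changing back to the standard basis gives the entries of
    \<open>ell\<close> up to factors \<open>C\<^sup>2 + Z\<^sup>2\<close>.\<close>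
  have "a * C - b * Z = cos \<theta> * C + sin \<theta> * ((- p * C - q * Z) * (C\<^sup>2 + Z\<^sup>2))"
    "b * C + a * Z = cos \<theta> * Z + sin \<theta> * ((r * C + p * Z) * (C\<^sup>2 + Z\<^sup>2))"
    unfolding ab by algebra+
  then have abC: "a * C - b * Z = (cos \<theta> - p * sin \<theta>) * C - q * sin \<theta> * Z"
    "b * C + a * Z = r * sin \<theta> * C + (cos \<theta> + p * sin \<theta>) * Z"
    unfolding CZ by (simp_all add: algebra_simps)
  have "\<rho> * cos (2 * pi * t + \<phi>) = a * C - b * Z" "\<rho> * sin (2 * pi * t + \<phi>) = b * C + a * Z"
    unfolding cos_add sin_add cos sin C_def[symmetric] Z_def[symmetric]
    using \<rho>(1) by (simp_all add: field_simps)
  then have "ell p q r \<theta> *v circle_pt t = \<rho> *\<^sub>R circle_pt (ell_lift p q r \<theta> t)"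
    using abC by (simp add: vec_eq_iff forall_2 matrix_vector_mult_def sum_2 ell_nth L C_def[symmetric] Z_def[symmetric])
  then show "\<exists>r'>0. ell p q r \<theta> *v circle_pt t = r' *\<^sub>R circle_pt (ell_lift p q r \<theta> t)"
    using \<rho> by blast
qed

lemma ell_lift_displacement: "0 \<le> ell_lift p q r \<theta> t - t \<and> ell_lift p q r \<theta> t - t \<le> 1/2"
proof -
  have "0 \<le> ell_angle p q r \<theta> t"
    "ell_angle p q r \<theta> t \<le> pi"
    unfolding ell_angle_def using ell_lift_quotient[of \<theta> t] by (auto intro!: arccos_lbound arccos_ubound)
  then show ?thesis by (simp add: ell_lift_def field_simps)
qed

lemma small_lift_ell:
  assumes "0 \<le> \<theta>" "\<theta> \<le> pi"
  shows "small_lift (ell p q r \<theta>) = (ell p q r \<theta>, ell_lift p q r \<theta>)"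
  by (rule small_lift_eq[OF ell_Sp2 ell_lift_ray_lift[OF assms] ell_lift_displacement])

lemma ell_lift_zero: "ell_lift p q r 0 t = t"
  by (simp add: ell_lift_def ell_angle_def ell_re_def ell_im_def)

lemma continuous_ell_lift: "continuous_on UNIV (\<lambda>\<theta>. ell_lift p q r \<theta> t)"
proof -
  have "continuous_on UNIV (\<lambda>\<theta>. ell_angle p q r \<theta> t)"
    unfolding ell_angle_def
  proof (rule continuous_on_compose2[OF continuous_on_arccos'])
    show "continuous_on UNIV (\<lambda>\<theta>. ell_re p q r \<theta> t / sqrt ((ell_re p q r \<theta> t)\<^sup>2 + (ell_im p q r \<theta> t)\<^sup>2))"
      using ell_lift_denom[of _ t] unfolding ell_re_def ell_im_def
      by (intro continuous_intros) (auto simp: less_le)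
    show "range (\<lambda>\<theta>. ell_re p q r \<theta> t / sqrt ((ell_re p q r \<theta> t)\<^sup>2 + (ell_im p q r \<theta> t)\<^sup>2)) \<subseteq> {-1..1}"
      using ell_lift_quotient[of _ t] by auto
  qed
  then show ?thesis unfolding ell_lift_def by (intro continuous_intros) auto
qed

text \<open>The lifts \<open>ell_lift\<close> start at the identity, vary continuously with the
  angle and end at the small lift of the last matrix. So prolonging the path by one crossing
  multiplies its lifted endpoint by a small lift, which is what the combinatorial definition does.
  The two branches of \<open>\<Psi>\<close> agree at \<open>T\<close> because the angle is 0
  there.\<close>

lemma path_lift_end_extend:
  assumes a: "path_lift_end T A a" and T: "T \<ge> 0" and D: "D \<ge> 0"
    and A: "\<And>u. u \<in> {0..D} \<Longrightarrow> A (T + u) = ell p q r (\<theta> u) ** A T"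
    and \<theta>: "continuous_on {0..D} \<theta>" "\<theta> 0 = 0" "\<And>u. u \<in> {0..D} \<Longrightarrow> 0 \<le> \<theta> u \<and> \<theta> u \<le> pi"
  shows "path_lift_end (T + D) A (cover_mult (small_lift (ell p q r (\<theta> D))) a)"
proof -
  obtain \<Phi> where cA: "continuous_on {0..T} A"
    and \<Phi>: "\<And>s. continuous_on {0..T} (\<lambda>t. \<Phi> t s)" "\<And>t. t \<in> {0..T} \<Longrightarrow> (A t, \<Phi> t) \<in> Sp2_cover"
    "(A 0, \<Phi> 0) = cover_one" "(A T, \<Phi> T) = a" using a unfolding path_lift_end_def by blast
  define \<Psi> where "\<Psi> t = (if t \<le> T then \<Phi> t else ell_lift p q r (\<theta> (t - T)) \<circ> \<Phi> T)" for t
  have \<Psi>2: "\<Psi> t = ell_lift p q r (\<theta> (t - T)) \<circ> \<Phi> T" if "t \<ge> T" for t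
    using that \<theta>(2) by (auto simp: \<Psi>_def fun_eq_iff ell_lift_zero)
  have A2: "A t = ell p q r (\<theta> (t - T)) ** A T" if "t \<in> {T..T + D}" for t
    using A[of "t - T"] that by simp
  have un: "{0..T + D} = {0..T} \<union> {T..T + D}" using T D by auto
  have \<theta>': "continuous_on {T..T + D} (\<lambda>t. \<theta> (t - T))"
    by (rule continuous_on_compose2[OF \<theta>(1)]) (auto intro!: continuous_intros)
  have "continuous_on {T..T + D} A"
  proof -
    have "continuous_on {T..T + D} (\<lambda>t. ell p q r (\<theta> (t - T)) ** A T)"
      unfolding ell_def matrix_mult_add_left scalar_matrix_assoc[symmetric]
      by (intro continuous_intros \<theta>')
    then show ?thesis by (rule continuous_on_eq) (rule A2[symmetric])
  qed
  then have "continuous_on {0..T + D} A"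
    unfolding un by (intro continuous_on_closed_Un cA closed_atLeastAtMost)
  moreover have "continuous_on {0..T + D} (\<lambda>t. \<Psi> t s)" for s
  proof -
    have "continuous_on {T..T + D} (\<lambda>t. ell_lift p q r (\<theta> (t - T)) (\<Phi> T s))"
      by (rule continuous_on_compose2[OF continuous_ell_lift \<theta>']) auto
    then have "continuous_on {T..T + D} (\<lambda>t. \<Psi> t s)"
      by (rule continuous_on_eq) (simp add: \<Psi>2)
    moreover have "continuous_on {0..T} (\<lambda>t. \<Psi> t s)"
      by (rule continuous_on_eq[OF \<Phi>(1)[of s]]) (simp add: \<Psi>_def)
    ultimately show ?thesis unfolding un by (intro continuous_on_closed_Un closed_atLeastAtMost)
  qed
  moreover have "(A t, \<Psi> t) \<in> Sp2_cover" if t: "t \<in> {0..T + D}" for t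
  proof (cases "t \<le> T")
    case True
    then show ?thesis using \<Phi>(2)[of t] t by (simp add: \<Psi>_def)
  next
    case False
    have "(ell p q r (\<theta> (t - T)), ell_lift p q r (\<theta> (t - T))) \<in> Sp2_cover"
      using ell_Sp2 ell_lift_ray_lift \<theta>(3)[of "t - T"] t False by (simp add: Sp2_cover_def)
    from cover_mult_in[OF this \<Phi>(2)[of T]] show ?thesis
      using T t False A2[of t] \<Psi>2[of t] by (simp add: cover_mult_def)
  qed
  moreover have "(A 0, \<Psi> 0) = cover_one" using \<Phi>(3) T by (simp add: \<Psi>_def)
  moreover have "(A (T + D), \<Psi> (T + D)) = cover_mult (small_lift (ell p q r (\<theta> D))) a"
    using \<Psi>2[of "T + D"] A[of D] D \<theta>(3)[of D] \<Phi>(4) by (auto simp: small_lift_ell cover_mult_def)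
  ultimately show ?thesis unfolding path_lift_end_def by blast
qed

end

section \<open>Faces of symplectic polytopes\<close>

text \<open>Descent through facets: a point outside the relative interior lies in a facet, whose
  dimension is smaller.\<close>

lemma face_containing_point:
  fixes S :: "'a::euclidean_space set"
  assumes "polyhedron S" "p \<in> S"
  obtains G where "G face_of S" "p \<in> rel_interior G"
  using assms
proof (induction "nat (aff_dim S + 1)" arbitrary: S thesis rule: less_induct)
  case less
  show ?case
  proof (cases "p \<in> rel_interior S")
    case True
    then show ?thesis using less.prems polyhedron_imp_convex face_of_refl by blast
  next
    case False
    then have "p \<in> \<Union> {F. F facet_of S}" using less.prems rel_boundary_of_polyhedron by blast
    then obtain H where H: "H facet_of S" "p \<in> H" by blast
    then have Hf: "H face_of S" "aff_dim H = aff_dim S - 1" by (auto simp: facet_of_def)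
    have "aff_dim H \<ge> 0" using H(2) aff_dim_geq[of H] aff_dim_empty[of H] by (cases "aff_dim H = -1") auto
    then have "nat (aff_dim H + 1) < nat (aff_dim S + 1)" using Hf by linarith
    moreover have "polyhedron H" using less.prems Hf face_of_polyhedron_polyhedron by blast
    ultimately obtain G where "G face_of H" "p \<in> rel_interior G" using less.hyps H(2) by metis
    then show ?thesis using less.prems(1) face_of_trans Hf by blast
  qed
qed

lemma affine_Int_two_hyperplanes_dim:
  fixes a b :: "real^4"
  assumes "norm a = 1" "norm b = 1" "\<bar>a \<bullet> b\<bar> < 1" "a \<bullet> x = h" "b \<bullet> x = k"
  shows "aff_dim {y. a \<bullet> y = h \<and> b \<bullet> y = k} = 2"
proof -
  have a: "a \<bullet> a = 1" "b \<bullet> b = 1" using assms by (auto simp: dot_square_norm)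
  have af: "affine {y. a \<bullet> y = h}" by (rule affine_hyperplane)
  \<comment> \<open>The part of \<open>b\<close> orthogonal to \<open>a\<close>: moving along it
    stays in the first hyperplane but leaves the second, so the second one cuts the dimension
    down.\<close>
  define w where "w = b - (a \<bullet> b) *\<^sub>R a"
  have "a \<bullet> (x + w) = h" using assms a by (simp add: w_def inner_add_right inner_diff_right)
  moreover have "b \<bullet> (x + w) \<noteq> k"
  proof -
    have "(a \<bullet> b) * (a \<bullet> b) < 1" using assms(3) by (simp add: abs_square_less_1 flip: power2_eq_square)
    then show ?thesis using assms a by (simp add: w_def inner_add_right inner_diff_right inner_commute)
  qed
  ultimately have "\<not> {y. a \<bullet> y = h} \<subseteq> {y. b \<bullet> y = k}" by auto
  moreover have "{y. a \<bullet> y = h} \<inter> {y. b \<bullet> y = k} \<noteq> {}" using assms by auto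
  ultimately have "aff_dim ({y. a \<bullet> y = h} \<inter> {y. b \<bullet> y = k}) = aff_dim {y. a \<bullet> y = h} - 1"
    using aff_dim_affine_Int_hyperplane[OF af, of b k] by simp
  moreover have "aff_dim {y. a \<bullet> y = h} = 3"
    using assms by (subst aff_dim_hyperplane) auto
  moreover have "{y. a \<bullet> y = h} \<inter> {y. b \<bullet> y = k} = {y. a \<bullet> y = h \<and> b \<bullet> y = k}" by auto
  ultimately show ?thesis by simp
qed

lemma kface_rel_interior:
  assumes "convex X" "compact X" "kface X k F"
  shows "closure F face_of X" "closure F \<noteq> X" "aff_dim (closure F) = int k" "F = rel_interior (closure F)"
    "convex F" "F \<noteq> {}" "F \<subseteq> closure F" "closure F \<subseteq> X" "F \<subseteq> X"
proof -
  obtain G where G: "G face_of X" "G \<noteq> X" "aff_dim G = int k" "F = rel_interior G"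
    using assms(3) unfolding kface_def by blast
  have cG: "convex G" "compact G" using assms G face_of_imp_convex face_of_imp_compact by blast+
  have cl: "closure F = G" using convex_closure_rel_interior[OF cG(1)] G cG by (simp add: compact_imp_closed)
  show "closure F face_of X" "closure F \<noteq> X" "aff_dim (closure F) = int k" "F = rel_interior (closure F)"
    using G cl by auto
  show "convex F" using cG G convex_rel_interior by blast
  have "G \<noteq> {}" using G by (auto simp: aff_dim_empty)
  then show "F \<noteq> {}" using G cG rel_interior_eq_empty by blast
  show "F \<subseteq> closure F" by (rule closure_subset)
  show "closure F \<subseteq> X" using cl G face_of_imp_subset by blast
  then show "F \<subseteq> X" using closure_subset by blast
qed

lemma relatively_open_near:
  fixes C :: "'a::euclidean_space set"
  assumes "x \<in> rel_interior C"
  obtains \<delta> where "\<delta> > 0" "\<And>z. z \<in> affine hull C \<Longrightarrow> dist z x < \<delta> \<Longrightarrow> z \<in> rel_interior C"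
proof -
  obtain e where e: "e > 0" "ball x e \<inter> affine hull C \<subseteq> rel_interior C"
    using openin_rel_interior[of C] assms unfolding openin_contains_ball by blast
  show thesis
    by (rule that[OF e(1)]) (use e in \<open>auto simp: dist_commute\<close>)
qed

section \<open>Faces, normals and Reeb vectors of a symplectic polytope\<close>

locale sympl_polytope =
  fixes X :: "(real^4) set"
  assumes polytope: "symplectic_polytope X"
begin

lemma polyhedron_X: "polyhedron X" and compact_X': "compact X" and zero_int: "0 \<in> interior X"
  using polytope by (auto simp: symplectic_polytope_def)

sublocale convex_body X
  by unfold_locales (use polyhedron_X compact_X' zero_int polyhedron_imp_convex in auto)

lemma aff_dim_X: "aff_dim X = 4"
  using aff_dim_nonempty_interior[of X] zero_int by auto

lemma face_unique:
  assumes "is_face X F" "is_face X F'" "x \<in> F" "x \<in> F'"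
  shows "F = F'"
proof -
  obtain k where k: "kface X k F" using assms(1) unfolding is_face_def by blast
  obtain k' where k': "kface X k' F'" using assms(2) unfolding is_face_def by blast
  note r = kface_rel_interior[OF convex_X compact_X k] and r' = kface_rel_interior[OF convex_X compact_X k']
  have "x \<in> rel_interior (closure F) \<inter> rel_interior (closure F')"
    using r(4) r'(4) assms by auto
  then have "closure F = closure F'" using r(1) r'(1) face_of_eq by blast
  then show ?thesis using r(4) r'(4) by simp
qed

lemma face_at_eq:
  assumes "is_face X F" "x \<in> F" shows "face_at X x = F"
  unfolding face_at_def by (rule the_equality) (use assms face_unique in auto)

lemma kface_is_face: "kface X k F \<Longrightarrow> is_face X F"
  by (auto simp: is_face_def)

lemma kface_dim:
  assumes "kface X k F" shows "k \<le> 3"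
  using kface_rel_interior(3)[OF convex_X compact_X assms] aff_dim_X
    face_of_aff_dim_lt[OF convex_X kface_rel_interior(1,2)[OF convex_X compact_X assms]] by linarith

lemma facet_halfspace:
  assumes E: "kface X 3 E"
  obtains \<nu> h where "norm \<nu> = 1" "h > 0" "\<And>x. x \<in> X \<Longrightarrow> \<nu> \<bullet> x \<le> h" "closure E = X \<inter> {x. \<nu> \<bullet> x = h}"
    "affine hull (closure E) = {x. \<nu> \<bullet> x = h}"
proof -
  note r = kface_rel_interior[OF convex_X compact_X E]
  have "closure E exposed_face_of X" using r(1) exposed_face_of_polyhedron[OF polyhedron_X] by blast
  moreover have "closure E \<noteq> {}" using r by blast
  ultimately obtain a b where ab: "a \<noteq> 0" "X \<subseteq> {x. a \<bullet> x \<le> b}" "closure E = X \<inter> {x. a \<bullet> x = b}"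
    using r(2) unfolding exposed_face_of by blast
  define \<nu> where "\<nu> = (1 / norm a) *\<^sub>R a"
  define h where "h = b / norm a"
  have n: "norm \<nu> = 1" using ab by (simp add: \<nu>_def)
  have le: "\<nu> \<bullet> x \<le> h \<longleftrightarrow> a \<bullet> x \<le> b" and eq: "\<nu> \<bullet> x = h \<longleftrightarrow> a \<bullet> x = b" for x
    using ab(1) by (simp_all add: \<nu>_def h_def field_simps)
  obtain r0 where r0: "r0 > 0" "cball 0 r0 \<subseteq> X" using inner_ball_exists .
  have "r0 *\<^sub>R \<nu> \<in> X" using r0 n by (intro subsetD[OF r0(2)]) (simp add: dist_norm)
  then have "\<nu> \<bullet> (r0 *\<^sub>R \<nu>) \<le> h" using ab(2) le by blast
  then have h: "h > 0" using n r0(1) by (simp add: dot_square_norm)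
  have cl: "closure E = X \<inter> {x. \<nu> \<bullet> x = h}" using ab(3) eq by auto
  have "affine hull (closure E) = {x. \<nu> \<bullet> x = h}"
  proof (rule affine_dim_equal)
    show "affine hull (closure E) \<subseteq> {x. \<nu> \<bullet> x = h}" using cl by (intro hull_minimal affine_hyperplane) auto
    show "aff_dim (affine hull (closure E)) = aff_dim {x. \<nu> \<bullet> x = h}"
      using r(3) n by (subst aff_dim_hyperplane) auto
  qed (use r in \<open>auto simp: affine_hyperplane\<close>)
  then show thesis using that n h cl ab(2) le by blast
qed

lemma facet_normal_cone:
  assumes E: "kface X 3 E" and \<nu>: "norm \<nu> = 1" "h > 0" "\<And>x. x \<in> X \<Longrightarrow> \<nu> \<bullet> x \<le> h" "closure E = X \<inter> {x. \<nu> \<bullet> x = h}"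
    "affine hull (closure E) = {x. \<nu> \<bullet> x = h}"
  shows "face_normal_cone X E = {s *\<^sub>R \<nu> | s. s \<ge> 0}" "face_normal X E = \<nu>"
proof -
  note r = kface_rel_interior[OF convex_X compact_X E]
  have on: "\<nu> \<bullet> y = h" if "y \<in> E" for y using that r(7) \<nu>(4) by blast
  obtain e where e: "e \<in> E" using r(6) by blast
  obtain \<delta> where \<delta>: "\<delta> > 0" "\<And>z. z \<in> affine hull (closure E) \<Longrightarrow> dist z e < \<delta> \<Longrightarrow> z \<in> E"
    using relatively_open_near[of e "closure E"] e r(4) by metis
  obtain r0 where r0: "r0 > 0" "cball 0 r0 \<subseteq> X" using inner_ball_exists .
  show eq: "face_normal_cone X E = {s *\<^sub>R \<nu> | s. s \<ge> 0}"
  proof (intro equalityI subsetI)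
    fix v assume v: "v \<in> face_normal_cone X E"
    then have v1: "(x - y) \<bullet> v \<le> 0" if "x \<in> X" "y \<in> E" for x y
      using that by (auto simp: face_normal_cone_def normal_cone_def)
    \<comment> \<open>The part of \<open>v\<close> along the 3-face. As \<open>E\<close> is
      relatively open it contains a point in this direction from \<open>e\<close>, which forces the
      part to vanish; the sign of the rest is then read off at the origin.\<close>
    define w where "w = v - (\<nu> \<bullet> v) *\<^sub>R \<nu>"
    have wn: "\<nu> \<bullet> w = 0" using \<nu>(1) by (simp add: w_def inner_diff_right dot_square_norm)
    have "w = 0"
    proof (rule ccontr)
      assume w: "w \<noteq> 0"
      define z where "z = e + (\<delta> / (2 * norm w)) *\<^sub>R w"
      have "z \<in> E"
        by (rule \<delta>(2)) (use \<nu>(5) on[OF e] wn \<delta>(1) w in \<open>auto simp: z_def inner_add_right dist_norm\<close>)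
      then have "(z - e) \<bullet> v \<le> 0" using v1 e r(9) by blast
      moreover have "w \<bullet> v = w \<bullet> w"
        using wn by (simp add: w_def inner_diff_left inner_diff_right inner_commute)
      ultimately have "\<delta> / (2 * norm w) * (w \<bullet> w) \<le> 0" by (simp add: z_def)
      then show False using \<delta>(1) w by (simp add: divide_le_0_iff mult_le_0_iff) (metis inner_gt_zero_iff not_less)
    qed
    then have v2: "v = (\<nu> \<bullet> v) *\<^sub>R \<nu>" by (simp add: w_def)
    have "(0 - e) \<bullet> v \<le> 0" using v1 zero_in e by blast
    then have "0 \<le> (\<nu> \<bullet> v) * (\<nu> \<bullet> e)"
      by (subst (asm) v2) (simp add: inner_commute)
    then have "\<nu> \<bullet> v \<ge> 0" using on[OF e] \<nu>(2) by (simp add: zero_le_mult_iff)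
    then show "v \<in> {s *\<^sub>R \<nu> | s. s \<ge> 0}" using v2 by blast
  next
    fix v assume "v \<in> {s *\<^sub>R \<nu> | s. s \<ge> 0}"
    then obtain s where s: "v = s *\<^sub>R \<nu>" "s \<ge> 0" by blast
    have "(x - y) \<bullet> v \<le> 0" if "x \<in> X" "y \<in> E" for x y
    proof -
      have "(x - y) \<bullet> v = s * (\<nu> \<bullet> x - \<nu> \<bullet> y)"
        by (simp add: s(1) inner_diff_left inner_diff_right inner_commute)
      also have "\<dots> \<le> 0" using \<nu>(3)[OF that(1)] on[OF that(2)] s(2) by (intro mult_nonneg_nonpos) auto
      finally show ?thesis .
    qed
    then show "v \<in> face_normal_cone X E" by (auto simp: face_normal_cone_def normal_cone_def)
  qed
  show "face_normal X E = \<nu>"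
    unfolding face_normal_def eq
    by (rule the_equality) (use \<nu>(1) in \<open>auto intro!: exI[of _ 1]\<close>)
qed

text \<open>The product of the normal with a point is constant on \<open>E\<close>, so the choice
  has no influence: this is the distance of the 3-face's hyperplane from the origin.\<close>

definition height :: "(real^4) set \<Rightarrow> real" where
  "height E = face_normal X E \<bullet> (SOME y. y \<in> E)"

lemma facet:
  assumes E: "kface X 3 E"
  shows "norm (face_normal X E) = 1" "height E > 0" "\<And>x. x \<in> X \<Longrightarrow> face_normal X E \<bullet> x \<le> height E"
    "closure E = X \<inter> {x. face_normal X E \<bullet> x = height E}"
    "affine hull (closure E) = {x. face_normal X E \<bullet> x = height E}"
    "face_normal_cone X E = {s *\<^sub>R face_normal X E | s. s \<ge> 0}"
    "face_reeb X E = (2 / height E) *\<^sub>R (quat_i *v face_normal X E)"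
proof -
  note r = kface_rel_interior[OF convex_X compact_X E]
  obtain \<nu> h where \<nu>: "norm \<nu> = 1" "h > 0" "\<And>x. x \<in> X \<Longrightarrow> \<nu> \<bullet> x \<le> h" "closure E = X \<inter> {x. \<nu> \<bullet> x = h}"
    "affine hull (closure E) = {x. \<nu> \<bullet> x = h}" using facet_halfspace[OF E] by metis
  note c = facet_normal_cone[OF E \<nu>]
  have on: "\<nu> \<bullet> y = h" if "y \<in> E" for y using that r(7) \<nu>(4) by blast
  have "(SOME y. y \<in> E) \<in> E" using r(6) some_in_eq by blast
  then have h: "height E = h" using on c(2) by (simp add: height_def)
  show "norm (face_normal X E) = 1" "height E > 0" "\<And>x. x \<in> X \<Longrightarrow> face_normal X E \<bullet> x \<le> height E"
    "closure E = X \<inter> {x. face_normal X E \<bullet> x = height E}"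
    "affine hull (closure E) = {x. face_normal X E \<bullet> x = height E}"
    "face_normal_cone X E = {s *\<^sub>R face_normal X E | s. s \<ge> 0}"
    using \<nu> c h by auto
  show "face_reeb X E = (2 / height E) *\<^sub>R (quat_i *v face_normal X E)"
    unfolding face_reeb_def
    by (rule the_equality) (use r(6) on h c(2) in auto)
qed

lemma facet_open:
  assumes "kface X 3 E" "e \<in> E"
  obtains \<delta> where "\<delta> > 0" "\<And>z. face_normal X E \<bullet> z = height E \<Longrightarrow> dist z e < \<delta> \<Longrightarrow> z \<in> E"
proof -
  have "e \<in> rel_interior (closure E)" using assms kface_rel_interior(4)[OF convex_X compact_X assms(1)] by simp
  from relatively_open_near[OF this] show thesis
    using that kface_rel_interior(4)[OF convex_X compact_X assms(1)] facet(5)[OF assms(1)] by auto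
qed

lemma facet_normal_in_cone:
  assumes "kface X 3 E" "x \<in> closure E" "s \<ge> 0"
  shows "s *\<^sub>R face_normal X E \<in> normal_cone X x"
proof -
  have "face_normal X E \<bullet> x = height E" using facet(4)[OF assms(1)] assms(2) by blast
  then have "(z - x) \<bullet> face_normal X E \<le> 0" if "z \<in> X" for z
    using facet(3)[OF assms(1) that] by (simp add: inner_diff_left inner_diff_right inner_commute)
  then show ?thesis using assms(3) by (auto simp: normal_cone_def intro: mult_nonneg_nonpos)
qed

lemma facet_eqI:
  assumes E: "kface X 3 E" "kface X 3 E'" and x: "x \<in> closure E" "x \<in> closure E'"
    and n: "face_normal X E = face_normal X E'"
  shows "E = E'"
proof -
  have "height E = height E'" using facet(4)[OF E(1)] facet(4)[OF E(2)] x n by auto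
  then have "closure E = closure E'" using facet(4)[OF E(1)] facet(4)[OF E(2)] n by simp
  then show ?thesis using kface_rel_interior(4)[OF convex_X compact_X] E by metis
qed

text \<open>Otherwise equality in Cauchy-Schwarz makes the normals equal or opposite. Equal normals
  at a common point give the same 3-face; opposite ones give opposite heights, while both heights
  are positive because 0 is interior.\<close>

lemma facet_normals_independent:
  assumes E: "kface X 3 E" "kface X 3 E'" and x: "x \<in> closure E" "x \<in> closure E'" and ne: "E \<noteq> E'"
  shows "\<bar>face_normal X E \<bullet> face_normal X E'\<bar> < 1"
proof (rule ccontr)
  assume "\<not> \<bar>face_normal X E \<bullet> face_normal X E'\<bar> < 1"
  then have "\<bar>face_normal X E \<bullet> face_normal X E'\<bar> = norm (face_normal X E) * norm (face_normal X E')"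
    using Cauchy_Schwarz_ineq2[of "face_normal X E" "face_normal X E'"] facet(1)[OF E(1)] facet(1)[OF E(2)] by simp
  then have "face_normal X E = face_normal X E' \<or> face_normal X E = - face_normal X E'"
    using norm_cauchy_schwarz_abs_eq[of "face_normal X E" "face_normal X E'"] facet(1)[OF E(1)] facet(1)[OF E(2)]
    by auto
  moreover have "face_normal X E \<noteq> - face_normal X E'"
  proof
    assume "face_normal X E = - face_normal X E'"
    moreover have "face_normal X E \<bullet> x = height E" "face_normal X E' \<bullet> x = height E'"
      using x facet(4)[OF E(1)] facet(4)[OF E(2)] by blast+
    ultimately have "height E = - height E'" by simp
    then show False using facet(2)[OF E(1)] facet(2)[OF E(2)] by simp
  qed
  ultimately show False using facet_eqI[OF E x] ne by blast
qed

lemma subset_closure_facet: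
  assumes "kface X k F" "kface X j E" "x \<in> F" "x \<in> closure E"
  shows "closure F \<subseteq> closure E"
  using subset_of_face_of[OF kface_rel_interior(1)[OF convex_X compact_X assms(2)], of "closure F"]
    kface_rel_interior(4,8)[OF convex_X compact_X assms(1)] assms by blast

lemma segment_into_face:
  assumes E: "kface X k E" and "a \<in> E" "b \<in> closure E"
  shows "open_segment a b \<subseteq> E"
proof -
  note r = kface_rel_interior[OF convex_X compact_X E]
  have "convex (closure E)" using r(5) by (rule convex_closure)
  from rel_interior_closure_convex_segment[OF this, of a b] r(4) assms show ?thesis by auto
qed

text \<open>Both endpoints may lie on the boundary of the face, as they do for a Reeb segment
  between two 2-faces. Each half is a segment from a point of the face to a point of its
  closure.\<close>

lemma segment_into_face_midpoint:
  assumes E: "kface X k E" and m: "midpoint a b \<in> E" and ab: "a \<in> closure E" "b \<in> closure E"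
  shows "open_segment a b \<subseteq> E"
proof
  fix z assume "z \<in> open_segment a b"
  then obtain u where u: "0 < u" "u < 1" "z = (1 - u) *\<^sub>R a + u *\<^sub>R b" "a \<noteq> b" by (auto simp: in_segment)
  have md: "(2 * l) *\<^sub>R midpoint a b = l *\<^sub>R a + l *\<^sub>R b" for l
    by (simp add: midpoint_def scaleR_add_right)
  consider "u = 1/2" | "u < 1/2" | "u > 1/2" by linarith
  then show "z \<in> E"
  proof cases
    case 1
    have "z = midpoint a b" unfolding u(3) 1 by (simp add: midpoint_def scaleR_add_right)
    then show ?thesis using m by simp
  next
    case 2
    have "z = (1 - (1 - 2 * u)) *\<^sub>R midpoint a b + (1 - 2 * u) *\<^sub>R a"
    proof -
      have "(1 - (1 - 2 * u)) *\<^sub>R midpoint a b + (1 - 2 * u) *\<^sub>R a = (u + (1 - 2 * u)) *\<^sub>R a + u *\<^sub>R b"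
      proof -
        have "(u *\<^sub>R a + u *\<^sub>R b) + (1 - 2 * u) *\<^sub>R a = (u + (1 - 2 * u)) *\<^sub>R a + u *\<^sub>R b"
          by (simp only: scaleR_left_distrib ac_simps)
        then show ?thesis using md[of u] by simp
      qed
      then show ?thesis by (simp add: u(3))
    qed
    moreover have "midpoint a b \<noteq> a" using u by simp
    ultimately have "z \<in> open_segment (midpoint a b) a"
      using u 2 unfolding in_segment by (intro conjI exI[of _ "1 - 2 * u"]) auto
    then show ?thesis using segment_into_face[OF E m ab(1)] by blast
  next
    case 3
    have "z = (1 - (2 * u - 1)) *\<^sub>R midpoint a b + (2 * u - 1) *\<^sub>R b"
    proof -
      have "(1 - (2 * u - 1)) *\<^sub>R midpoint a b + (2 * u - 1) *\<^sub>R b = (1 - u) *\<^sub>R a + ((1 - u) + (2 * u - 1)) *\<^sub>R b"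
      proof -
        have "((1 - u) *\<^sub>R a + (1 - u) *\<^sub>R b) + (2 * u - 1) *\<^sub>R b = (1 - u) *\<^sub>R a + ((1 - u) + (2 * u - 1)) *\<^sub>R b"
          by (simp only: scaleR_left_distrib ac_simps)
        moreover have "1 - (2 * u - 1) = 2 * (1 - u)" by simp
        ultimately show ?thesis using md[of "1 - u"] by metis
      qed
      then show ?thesis by (simp add: u(3))
    qed
    moreover have "midpoint a b \<noteq> b" using u by simp
    ultimately have "z \<in> open_segment (midpoint a b) b"
      using u 3 unfolding in_segment by (intro conjI exI[of _ "2 * u - 1"]) auto
    then show ?thesis using segment_into_face[OF E m ab(2)] by blast
  qed
qed

text \<open>The last claim is where the polytope being symplectic enters. The vectors
  \<open>quat_i *v \<nu>\<close> and \<open>quat_i *v \<nu>'\<close> span the symplectic complement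
  of the tangent plane. If the two normals were orthogonal for the symplectic form, these vectors
  would be tangent themselves, the plane would be its own complement, and the form would vanish on
  it.\<close>

lemma ridge_symplectic:
  assumes F: "kface X 2 F" and n: "norm \<nu> = 1" "norm \<nu>' = 1" "\<bar>\<nu> \<bullet> \<nu>'\<bar> < 1"
    and on: "\<And>x. x \<in> F \<Longrightarrow> \<nu> \<bullet> x = h \<and> \<nu>' \<bullet> x = h'"
  shows "affine hull (closure F) = {x. \<nu> \<bullet> x = h \<and> \<nu>' \<bullet> x = h'}"
    "tangent_space F = {v. \<nu> \<bullet> v = 0 \<and> \<nu>' \<bullet> v = 0}"
    "(quat_i *v \<nu>) \<bullet> \<nu>' \<noteq> 0"
proof -
  note r = kface_rel_interior[OF convex_X compact_X F]
  obtain x0 where x0: "x0 \<in> F" using r(6) by blast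
  have cl: "closure F \<subseteq> {x. \<nu> \<bullet> x = h \<and> \<nu>' \<bullet> x = h'}"
    by (rule closure_minimal) (use on in \<open>auto simp: closed_hyperplane intro!: closed_Collect_conj\<close>)
  have aff: "affine {x. \<nu> \<bullet> x = h \<and> \<nu>' \<bullet> x = h'}"
    using affine_Int[OF affine_hyperplane affine_hyperplane, of \<nu> h \<nu>' h'] by (simp add: Int_def)
  show eq: "affine hull (closure F) = {x. \<nu> \<bullet> x = h \<and> \<nu>' \<bullet> x = h'}"
  proof (rule affine_dim_equal)
    show "affine hull (closure F) \<subseteq> {x. \<nu> \<bullet> x = h \<and> \<nu>' \<bullet> x = h'}" by (rule hull_minimal[where S=affine, OF cl aff])
    show "aff_dim (affine hull (closure F)) = aff_dim {x. \<nu> \<bullet> x = h \<and> \<nu>' \<bullet> x = h'}"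
      using r(3) affine_Int_two_hyperplanes_dim[OF n, of x0 h h'] on[OF x0] by simp
  qed (use r aff in auto)
  obtain \<delta> where \<delta>: "\<delta> > 0" "\<And>z. z \<in> affine hull (closure F) \<Longrightarrow> dist z x0 < \<delta> \<Longrightarrow> z \<in> F"
    using relatively_open_near[of x0 "closure F"] x0 r(4) by metis
  show T: "tangent_space F = {v. \<nu> \<bullet> v = 0 \<and> \<nu>' \<bullet> v = 0}"
  proof
    have "subspace {v. \<nu> \<bullet> v = 0 \<and> \<nu>' \<bullet> v = 0}"
      by (simp add: subspace_def inner_add_right)
    then show "tangent_space F \<subseteq> {v. \<nu> \<bullet> v = 0 \<and> \<nu>' \<bullet> v = 0}"
      unfolding tangent_space_def using on by (intro span_minimal) (auto simp: inner_diff_right)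
    show "{v. \<nu> \<bullet> v = 0 \<and> \<nu>' \<bullet> v = 0} \<subseteq> tangent_space F"
    proof
      fix v assume v: "v \<in> {v. \<nu> \<bullet> v = 0 \<and> \<nu>' \<bullet> v = 0}"
      show "v \<in> tangent_space F"
      proof (cases "v = 0")
        case True then show ?thesis by (simp add: tangent_space_def span_zero)
      next
        case False
        define t where "t = \<delta> / (2 * norm v)"
        have t: "t > 0" using \<delta>(1) False by (simp add: t_def)
        have "x0 + t *\<^sub>R v \<in> F"
          by (rule \<delta>(2)) (use eq v on[OF x0] \<delta>(1) False in \<open>auto simp: inner_add_right dist_norm t_def\<close>)
        then have "(x0 + t *\<^sub>R v) - x0 \<in> span {x - y |x y. x \<in> F \<and> y \<in> F}"
          using x0 by (intro span_base) blast
        then have "(1 / t) *\<^sub>R ((x0 + t *\<^sub>R v) - x0) \<in> tangent_space F"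
          unfolding tangent_space_def by (rule span_scale)
        then show ?thesis using t by simp
      qed
    qed
  qed
  show "(quat_i *v \<nu>) \<bullet> \<nu>' \<noteq> 0"
  proof
    assume 0: "(quat_i *v \<nu>) \<bullet> \<nu>' = 0"
    obtain v w where vw: "v \<in> tangent_space F" "w \<in> tangent_space F" "omega0 v w \<noteq> 0"
      using polytope F unfolding symplectic_polytope_def by blast
    define V where "V = {v. \<nu> \<bullet> v = 0 \<and> \<nu>' \<bullet> v = 0}"
    have ne: "\<nu> \<noteq> 0" "\<nu>' \<noteq> 0" using n by auto
    have nn: "\<nu> \<bullet> \<nu> = 1" "\<nu>' \<bullet> \<nu>' = 1" using n by (auto simp: dot_square_norm)
    have iV: "quat_i *v \<nu> \<in> V" "quat_i *v \<nu>' \<in> V"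
      using 0 quat_i_inner_swap[of \<nu> \<nu>'] by (auto simp: V_def inner_commute)
    define B where "B = {quat_i *v \<nu>, quat_i *v \<nu>'}"
    have subV: "subspace V" by (simp add: V_def subspace_def inner_add_right)
    have "aff_dim V = 2"
      unfolding V_def by (rule affine_Int_two_hyperplanes_dim[OF n, of 0]) auto
    then have dimV: "dim V = 2" using aff_dim_subspace[OF subV] by simp
    have ind: "independent B" and cardB: "card B = 2"
    proof -
      have "\<nu> \<noteq> k *\<^sub>R \<nu>'" for k
      proof
        assume k: "\<nu> = k *\<^sub>R \<nu>'"
        then have "\<bar>k\<bar> = 1" using n by simp
        moreover have "\<bar>\<nu> \<bullet> \<nu>'\<bar> = \<bar>k\<bar>" unfolding k using nn by simp
        ultimately show False using n(3) by simp
      qed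
      then have nk: "quat_i *v \<nu> \<noteq> k *\<^sub>R (quat_i *v \<nu>')" for k
        by (metis matrix_vector_mult_scaleR quat_i_inj)
      from nk[of 1] show "card B = 2" by (simp add: B_def)
      have "quat_i *v \<nu>' \<noteq> 0" using ne by (metis norm_eq_zero norm_quat_i)
      then show "independent B" unfolding B_def using nk
        by (subst independent_insert) (auto simp: span_singleton)
    qed
    have "V \<subseteq> span B"
      by (rule card_ge_dim_independent) (use iV ind cardB dimV in \<open>auto simp: B_def\<close>)
    then have "\<exists>a b. u = a *\<^sub>R (quat_i *v \<nu>) + b *\<^sub>R (quat_i *v \<nu>')" if "u \<in> V" for u
      using that unfolding B_def by (force simp: span_insert span_singleton algebra_simps)
    then obtain a b where "v = a *\<^sub>R (quat_i *v \<nu>) + b *\<^sub>R (quat_i *v \<nu>')"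
      using vw T V_def by blast
    moreover have "\<nu> \<bullet> w = 0" "\<nu>' \<bullet> w = 0" using vw T by auto
    ultimately have "omega0 v w = 0"
      by (simp add: omega0_eq matrix_vector_right_distrib matrix_vector_mult_scaleR inner_add_left inner_diff_left)
    then show False using vw by simp
  qed
qed

end

section \<open>The quaternionic frame and its trivialization\<close>

lemma matrix_vector_minus_left: "(- A) *v v = - (A *v v :: real^'m)"
  by (simp add: matrix_vector_mult_def vec_eq_iff sum_negf)

lemma matrix_vector_minus_right: "A *v (- v) = - (A *v v :: real^'m)"
  by (simp add: matrix_vector_mult_def vec_eq_iff sum_negf)

lemma ell_mult_nth:
  "(ell p q r \<theta> *v x) $ 1 = (cos \<theta> - p * sin \<theta>) * x$1 - q * sin \<theta> * x$2"
  "(ell p q r \<theta> *v x) $ 2 = r * sin \<theta> * x$1 + (cos \<theta> + p * sin \<theta>) * x$2"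
  by (simp_all add: ell_def matrix_vector_mult_def sum_2 mat_def)

locale frame =
  fixes J K :: "real^4^4"
  assumes frame: "quaternionic_frame J K"
begin

lemma J_J [simp]: "J *v (J *v v) = - v" and K_K [simp]: "K *v (K *v v) = - v"
  using frame by (simp_all add: quaternionic_frame_def matrix_vector_mul_assoc matrix_vector_minus_left)

lemma J_inner [simp]: "(J *v v) \<bullet> (J *v w) = v \<bullet> w" and K_inner [simp]: "(K *v v) \<bullet> (K *v w) = v \<bullet> w"
proof -
  have "orthogonal_transformation ((*v) J)" "orthogonal_transformation ((*v) K)"
    using frame by (simp_all add: quaternionic_frame_def rotation_matrix_def orthogonal_transformation_matrix)
  then show "(J *v v) \<bullet> (J *v w) = v \<bullet> w" "(K *v v) \<bullet> (K *v w) = v \<bullet> w"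
    by (simp_all add: orthogonal_transformation_def)
qed

text \<open>The product of all three matrices, applied to \<open>K *v v\<close>. Together with the
  squares, this one relation yields the whole multiplication table.\<close>

lemma I_J: "quat_i *v (J *v v) = K *v v"
proof -
  have "quat_i *v (J *v (K *v w)) = - w" for w
    using frame by (simp add: quaternionic_frame_def matrix_vector_mul_assoc matrix_mul_assoc matrix_vector_minus_left)
  from this[of "K *v v"] show ?thesis
    by (simp add: matrix_vector_minus_right)
qed

lemma I_K: "quat_i *v (K *v v) = - (J *v v)"
  using I_J[of v] by (metis quat_i_quat_i)

lemma K_skew: "(K *v v) \<bullet> w = - (v \<bullet> (K *v w))" and J_skew: "(J *v v) \<bullet> w = - (v \<bullet> (J *v w))"
  using K_inner[of v "K *v w"] J_inner[of v "J *v w"] by simp_all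

lemma J_self [simp]: "(J *v v) \<bullet> v = 0" "v \<bullet> (J *v v) = 0" and K_self [simp]: "(K *v v) \<bullet> v = 0" "v \<bullet> (K *v v) = 0"
  using J_skew[of v v] K_skew[of v v] by (simp_all add: inner_commute)

lemma J_I: "J *v (quat_i *v v) = - (K *v v)"
proof -
  have "K *v (J *v w) = quat_i *v (J *v (J *v w))" for w by (simp only: I_J)
  then have KJ: "K *v (J *v w) = - (quat_i *v w)" for w by (simp add: matrix_vector_minus_right)
  have "K *v (K *v (J *v (quat_i *v v))) = K *v (- (quat_i *v (quat_i *v v)))" by (simp only: KJ)
  then show ?thesis by (simp add: matrix_vector_minus_right) (metis minus_minus)
qed

lemma K_J: "K *v (J *v w) = - (quat_i *v w)"
proof -
  have "K *v (J *v w) = quat_i *v (J *v (J *v w))" by (simp only: I_J)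
  then show ?thesis by (simp add: matrix_vector_minus_right)
qed

lemma J_K: "J *v (K *v w) = quat_i *v w"
proof -
  have "J *v (K *v w) = J *v (quat_i *v (J *v w))" by (simp add: I_J)
  also have "\<dots> = quat_i *v w" by (simp add: J_I K_J)
  finally show ?thesis .
qed

lemma K_I: "K *v (quat_i *v w) = J *v w"
proof -
  have "K *v (quat_i *v w) = quat_i *v (J *v (quat_i *v w))" by (simp add: I_J)
  then show ?thesis by (simp add: J_I I_K matrix_vector_minus_right)
qed

lemma I_inner_J [simp]: "(quat_i *v v) \<bullet> (J *v v) = 0" "(J *v v) \<bullet> (quat_i *v v) = 0"
  and I_inner_K [simp]: "(quat_i *v v) \<bullet> (K *v v) = 0" "(K *v v) \<bullet> (quat_i *v v) = 0"
  and J_inner_K [simp]: "(J *v v) \<bullet> (K *v v) = 0" "(K *v v) \<bullet> (J *v v) = 0"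
proof -
  show "(quat_i *v v) \<bullet> (J *v v) = 0" by (simp add: quat_i_inner_swap I_J)
  then show "(J *v v) \<bullet> (quat_i *v v) = 0" by (simp add: inner_commute)
  have "K *v v = quat_i *v (J *v v)" by (simp add: I_J)
  then show "(quat_i *v v) \<bullet> (K *v v) = 0" "(J *v v) \<bullet> (K *v v) = 0" by simp_all
  then show "(K *v v) \<bullet> (quat_i *v v) = 0" "(K *v v) \<bullet> (J *v v) = 0" by (simp_all add: inner_commute)
qed

lemma quat_expand:
  assumes n: "norm \<nu> = 1"
  shows "v = (v \<bullet> \<nu>) *\<^sub>R \<nu> + (v \<bullet> (quat_i *v \<nu>)) *\<^sub>R (quat_i *v \<nu>)
    + (v \<bullet> (J *v \<nu>)) *\<^sub>R (J *v \<nu>) + (v \<bullet> (K *v \<nu>)) *\<^sub>R (K *v \<nu>)"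
proof -
  have nn: "\<nu> \<bullet> \<nu> = 1" using n by (simp add: dot_square_norm)
  define B where "B = {\<nu>, quat_i *v \<nu>, J *v \<nu>, K *v \<nu>}"
  have ne: "\<nu> \<noteq> quat_i *v \<nu>" "\<nu> \<noteq> J *v \<nu>" "\<nu> \<noteq> K *v \<nu>" "quat_i *v \<nu> \<noteq> J *v \<nu>"
    "quat_i *v \<nu> \<noteq> K *v \<nu>" "J *v \<nu> \<noteq> K *v \<nu>"
    by (metis nn quat_i_inner_self(2) zero_neq_one, metis nn J_self(2) zero_neq_one,
        metis nn K_self(2) zero_neq_one, metis nn quat_i_inner I_inner_J(1) zero_neq_one,
        metis nn quat_i_inner I_inner_K(1) zero_neq_one, metis nn J_inner J_inner_K(1) zero_neq_one)
  have nrm: "norm b = 1" if "b \<in> B" for b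
    using that nn by (auto simp: B_def norm_eq_sqrt_inner)
  have orth: "pairwise orthogonal B"
    by (auto simp: B_def pairwise_def orthogonal_def)
  have "0 \<notin> B" using nrm by fastforce
  then have ind: "independent B" using orth pairwise_orthogonal_independent by blast
  have "card B = 4" using ne by (simp add: B_def)
  then have "(UNIV :: (real^4) set) \<subseteq> span B"
    using ind by (intro card_ge_dim_independent) auto
  then have "v \<in> span B" by blast
  then have "(\<Sum>b\<in>B. (v \<bullet> b) *\<^sub>R b) = v"
    using orth nrm by (intro orthonormal_basis_expand) (auto simp: B_def)
  then show ?thesis using ne by (simp add: B_def add.assoc)
qed

lemma quat_triv_nth [simp]: "quat_triv J K n V $ 1 = V \<bullet> (J *v n)" "quat_triv J K n V $ 2 = V \<bullet> (K *v n)"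
  by (simp_all add: quat_triv_def)

lemma quat_triv_add_right: "quat_triv J K n (v + w) = quat_triv J K n v + quat_triv J K n w"
  by (simp add: vec_eq_iff forall_2 inner_add_left)

lemma quat_triv_I: "quat_triv J K n (r *\<^sub>R (quat_i *v n)) = 0"
  by (simp add: vec_eq_iff forall_2)

text \<open>On a tangent hyperplane the trivialization forgets the Reeb direction and nothing else.
  It therefore identifies every complement of that direction with the plane, be it a contact plane
  or the tangent plane of a 2-face.\<close>

lemma quat_triv_kernel:
  assumes n: "norm n = 1" and v: "v \<bullet> n = 0" "quat_triv J K n v = 0"
  shows "v = (v \<bullet> (quat_i *v n)) *\<^sub>R (quat_i *v n)"
  using quat_expand[OF n, of v] v by (simp add: vec_eq_iff[of "quat_triv J K n v"] forall_2)

text \<open>The vector \<open>l\<close> selects the complement of the Reeb direction: the second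
  normal gives the tangent plane of a 2-face, and \<open>quat_i *v y\<close> gives the contact plane
  at \<open>y\<close>.\<close>

lemma quat_triv_surj:
  fixes z :: "real^2"
  assumes n: "norm n = 1" and l: "(quat_i *v n) \<bullet> l \<noteq> 0"
  obtains v where "v \<bullet> n = 0" "v \<bullet> l = 0" "quat_triv J K n v = z"
proof -
  define w where "w = (z$1) *\<^sub>R (J *v n) + (z$2) *\<^sub>R (K *v n)"
  define v where "v = w - ((w \<bullet> l) / ((quat_i *v n) \<bullet> l)) *\<^sub>R (quat_i *v n)"
  have nn: "n \<bullet> n = 1" using n by (simp add: dot_square_norm)
  have "v \<bullet> n = 0" "v \<bullet> l = 0" "quat_triv J K n v = z"
    using l nn by (simp_all add: v_def w_def inner_add_left inner_diff_left vec_eq_iff forall_2)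
  then show thesis by (rule that)
qed

end

section \<open>Crossing a 2-face\<close>

text \<open>\<open>flux\<close> says that the Reeb flow crosses \<open>F\<close> from \<open>E\<close> to \<open>E'\<close>.\<close>

locale corner = sympl_polytope +
  fixes E E' F :: "(real^4) set"
  assumes E: "kface X 3 E" and E': "kface X 3 E'" and F: "kface X 2 F"
    and FE: "F \<subseteq> closure E" and FE': "F \<subseteq> closure E'"
    and flux: "(quat_i *v face_normal X E) \<bullet> face_normal X E' > 0"
begin

text \<open>The vectors \<open>\<nu>\<close> and \<open>f\<close> form an orthonormal basis of the
  plane orthogonal to \<open>F\<close>, and \<open>\<alpha>\<close> is the exterior angle. The form
  takes the value \<open>c\<close> on \<open>\<nu>\<close> and \<open>f\<close>, hence on every
  positively oriented orthonormal pair of this plane; so one constant governs the motion along the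
  whole arc \<open>n\<close>.\<close>

definition "\<nu> = face_normal X E"
definition "\<nu>' = face_normal X E'"
definition "h = height E"
definition "h' = height E'"
definition "\<sigma> = (quat_i *v \<nu>) \<bullet> \<nu>'"
definition "\<alpha> = arccos (\<nu> \<bullet> \<nu>')"
definition "f = (1 / sin \<alpha>) *\<^sub>R (\<nu>' - cos \<alpha> *\<^sub>R \<nu>)"
definition "c = \<sigma> / sin \<alpha>"
definition "n \<theta> = cos \<theta> *\<^sub>R \<nu> + sin \<theta> *\<^sub>R f"

lemma norm_\<nu> [simp]: "norm \<nu> = 1" "norm \<nu>' = 1" and \<nu>_\<nu> [simp]: "\<nu> \<bullet> \<nu> = 1" "\<nu>' \<bullet> \<nu>' = 1"
  using facet(1)[OF E] facet(1)[OF E'] by (simp_all add: \<nu>_def \<nu>'_def dot_square_norm)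

lemma h_pos: "h > 0" "h' > 0"
  using facet(2)[OF E] facet(2)[OF E'] by (simp_all add: h_def h'_def)

lemma \<sigma>_pos: "\<sigma> > 0" using flux by (simp add: \<sigma>_def \<nu>_def \<nu>'_def)

lemma X_le: "x \<in> X \<Longrightarrow> \<nu> \<bullet> x \<le> h" "x \<in> X \<Longrightarrow> \<nu>' \<bullet> x \<le> h'"
  using facet(3)[OF E] facet(3)[OF E'] by (simp_all add: h_def h'_def \<nu>_def \<nu>'_def)

lemma on_E: "x \<in> closure E \<Longrightarrow> \<nu> \<bullet> x = h" and on_E': "x \<in> closure E' \<Longrightarrow> \<nu>' \<bullet> x = h'"
  using facet(4)[OF E] facet(4)[OF E'] by (auto simp: h_def h'_def \<nu>_def \<nu>'_def)

lemma on_F: "x \<in> F \<Longrightarrow> \<nu> \<bullet> x = h \<and> \<nu>' \<bullet> x = h'"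
  using on_E on_E' FE FE' by blast

lemma abs_cos_less: "\<bar>\<nu> \<bullet> \<nu>'\<bar> < 1"
proof (rule ccontr)
  assume "\<not> \<bar>\<nu> \<bullet> \<nu>'\<bar> < 1"
  then have 1: "1 \<le> (\<nu> \<bullet> \<nu>')\<^sup>2" by (simp add: abs_square_less_1 not_less[symmetric])
  define w where "w = \<nu>' - (\<nu> \<bullet> \<nu>') *\<^sub>R \<nu>"
  have "w \<bullet> w = 1 - (\<nu> \<bullet> \<nu>')\<^sup>2"
    by (simp add: w_def inner_diff_left inner_diff_right inner_commute power2_eq_square)
  then have "w \<bullet> w \<le> 0" using 1 by simp
  then have "w = 0" by (metis inner_gt_zero_iff not_less)
  then have "\<nu>' = (\<nu> \<bullet> \<nu>') *\<^sub>R \<nu>" by (simp add: w_def)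
  then have "\<sigma> = (\<nu> \<bullet> \<nu>') * ((quat_i *v \<nu>) \<bullet> \<nu>)" unfolding \<sigma>_def by (metis inner_scaleR_right)
  then show False using \<sigma>_pos by simp
qed

lemma cos_\<alpha>: "cos \<alpha> = \<nu> \<bullet> \<nu>'" and sin_\<alpha>: "sin \<alpha> > 0" and \<alpha>: "0 < \<alpha>" "\<alpha> < pi"
proof -
  have b: "-1 < \<nu> \<bullet> \<nu>'" "\<nu> \<bullet> \<nu>' < 1" using abs_cos_less by auto
  then show "cos \<alpha> = \<nu> \<bullet> \<nu>'" by (simp add: \<alpha>_def)
  show "0 < \<alpha>" "\<alpha> < pi" using arccos_lt_bounded[OF b] by (auto simp: \<alpha>_def)
  then show "sin \<alpha> > 0" by (simp add: sin_gt_zero)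
qed

lemma \<nu>'_eq: "\<nu>' = cos \<alpha> *\<^sub>R \<nu> + sin \<alpha> *\<^sub>R f"
  using sin_\<alpha> by (simp add: f_def)

lemma f_props [simp]: "\<nu> \<bullet> f = 0" "f \<bullet> \<nu> = 0" "f \<bullet> f = 1"
proof -
  show 0: "\<nu> \<bullet> f = 0" by (simp add: f_def inner_diff_right cos_\<alpha>)
  then show "f \<bullet> \<nu> = 0" by (simp add: inner_commute)
  have "\<nu>' \<bullet> \<nu>' = (cos \<alpha>)\<^sup>2 + (sin \<alpha>)\<^sup>2 * (f \<bullet> f)"
    using 0 by (subst (1 2) \<nu>'_eq) (simp add: inner_add_left inner_add_right inner_commute power2_eq_square)
  then have "(sin \<alpha>)\<^sup>2 * (f \<bullet> f) = (sin \<alpha>)\<^sup>2" using sin_cos_squared_add[of \<alpha>] \<nu>_\<nu>(2) by linarith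
  then show "f \<bullet> f = 1" using sin_\<alpha> by simp
qed

lemma c_pos: "c > 0" using \<sigma>_pos sin_\<alpha> by (simp add: c_def)

lemma I_inner_f: "(quat_i *v \<nu>) \<bullet> f = c" "(quat_i *v f) \<bullet> \<nu> = - c"
proof -
  show "(quat_i *v \<nu>) \<bullet> f = c" by (simp add: f_def inner_diff_right c_def \<sigma>_def)
  then show "(quat_i *v f) \<bullet> \<nu> = - c" using quat_i_inner_swap[of f \<nu>] by (simp add: inner_commute)
qed

lemma n_0 [simp]: "n 0 = \<nu>" and n_\<alpha> [simp]: "n \<alpha> = \<nu>'"
  by (simp_all add: n_def \<nu>'_eq)

lemma n_n: "n \<theta> \<bullet> n \<theta> = 1" and norm_n [simp]: "norm (n \<theta>) = 1"
proof -
  show "n \<theta> \<bullet> n \<theta> = 1" by (simp add: n_def inner_add_left inner_add_right flip: power2_eq_square)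
  then show "norm (n \<theta>) = 1" by (simp add: norm_eq_sqrt_inner)
qed

text \<open>Spherical interpolation. Between 0 and \<open>\<alpha>\<close> both coefficients are
  nonnegative, so the arc stays in the cone spanned by the two normals and hence in the normal cone
  along \<open>F\<close>.\<close>

lemma n_cone:
  "n \<theta> = (sin (\<alpha> - \<theta>) / sin \<alpha>) *\<^sub>R \<nu> + (sin \<theta> / sin \<alpha>) *\<^sub>R \<nu>'"
proof -
  have "(sin (\<alpha> - \<theta>) / sin \<alpha>) + (sin \<theta> / sin \<alpha>) * cos \<alpha> = cos \<theta>"
    using sin_\<alpha> by (simp add: sin_diff field_simps)
  then show ?thesis using sin_\<alpha> unfolding n_def
    by (subst \<nu>'_eq) (simp add: scaleR_add_right scaleR_add_left[symmetric] add.assoc[symmetric])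
qed

lemma n_normal:
  assumes "0 \<le> \<theta>" "\<theta> \<le> \<alpha>" "x \<in> F" "s \<ge> 0"
  shows "s *\<^sub>R n \<theta> \<in> normal_cone X x"
proof -
  have c: "sin (\<alpha> - \<theta>) / sin \<alpha> \<ge> 0" "sin \<theta> / sin \<alpha> \<ge> 0"
    using assms sin_\<alpha> \<alpha> by (auto intro!: divide_nonneg_pos sin_ge_zero)
  have "(z - x) \<bullet> \<nu> \<le> 0" "(z - x) \<bullet> \<nu>' \<le> 0" if "z \<in> X" for z
    using X_le[OF that] on_F[OF assms(3)] by (simp_all add: inner_diff_left inner_diff_right inner_commute)
  then have "(z - x) \<bullet> n \<theta> \<le> 0" if "z \<in> X" for z
    unfolding n_cone inner_add_right inner_scaleR_right
    using c that by (intro add_nonpos_nonpos mult_nonneg_nonpos) auto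
  then show ?thesis using assms(4) by (auto simp: normal_cone_def intro: mult_nonneg_nonpos)
qed

lemma affine_hull_F: "affine hull (closure F) = {x. \<nu> \<bullet> x = h \<and> \<nu>' \<bullet> x = h'}"
  and tangent_F: "tangent_space F = {v. \<nu> \<bullet> v = 0 \<and> \<nu>' \<bullet> v = 0}"
  using ridge_symplectic(1,2)[OF F norm_\<nu> abs_cos_less on_F] by auto

lemma tangent_F_f: "tangent_space F = {v. \<nu> \<bullet> v = 0 \<and> f \<bullet> v = 0}"
  unfolding tangent_F using sin_\<alpha> by (subst \<nu>'_eq) (auto simp: inner_add_left)

lemma open_F:
  assumes "x \<in> F"
  obtains \<delta> where "\<delta> > 0" "\<And>z. \<nu> \<bullet> z = h \<Longrightarrow> \<nu>' \<bullet> z = h' \<Longrightarrow> dist z x < \<delta> \<Longrightarrow> z \<in> F"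
proof -
  have "x \<in> rel_interior (closure F)" using assms kface_rel_interior(4)[OF convex_X compact_X F] by simp
  then obtain d where "d > 0" "\<And>z. z \<in> affine hull (closure F) \<Longrightarrow> dist z x < d \<Longrightarrow> z \<in> rel_interior (closure F)"
    using relatively_open_near by metis
  then show thesis
    using kface_rel_interior(4)[OF convex_X compact_X F] unfolding affine_hull_F by (intro that[of d]) auto
qed

lemma height_n:
  assumes "x \<in> F"
  shows "n \<theta> \<bullet> x = (sin (\<alpha> - \<theta>) / sin \<alpha>) * h + (sin \<theta> / sin \<alpha>) * h'"
  unfolding n_cone using on_F[OF assms] by (simp add: inner_add_left)

text \<open>The Reeb field of \<open>E'\<close> points from \<open>F\<close> into \<open>E'\<close>; two 3-faces with this property would have
  normals that are orthogonal for the symplectic form.\<close>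

lemma exit_face_eq:
  assumes p: "p \<in> F" and \<delta>: "\<delta> > 0" and into: "\<And>t. 0 < t \<Longrightarrow> t < \<delta> \<Longrightarrow> p + t *\<^sub>R face_reeb X E' \<in> E'"
  shows "exit_face X F = E'"
  unfolding exit_face_def
proof (rule the_equality)
  have in_all: "\<exists>\<delta>>0. \<forall>t. 0 < t \<and> t < \<delta> \<longrightarrow> x + t *\<^sub>R face_reeb X E' \<in> E'" if x: "x \<in> F" for x
  proof -
    have "p \<in> rel_interior (closure F)" "x \<in> rel_interior (closure F)"
      using p x kface_rel_interior(4)[OF convex_X compact_X F] by auto
    then obtain d where d: "d > 0" "\<And>z. z \<in> affine hull (closure F) \<Longrightarrow> dist z x < d \<Longrightarrow> z \<in> F"
      using relatively_open_near[of x "closure F"] kface_rel_interior(4)[OF convex_X compact_X F] by metis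
    \<comment> \<open>The point \<open>z\<close> lies in \<open>F\<close> slightly beyond
      \<open>x\<close> as seen from \<open>p\<close>. Mixing the ray at \<open>p\<close>, which runs
      inside \<open>E'\<close>, with \<open>z\<close> produces the ray at \<open>x\<close>. Adding 1
      to the norm covers the case that \<open>x\<close> is \<open>p\<close>.\<close>
    define s where "s = d / (2 * (norm (x - p) + 1))"
    have npos: "norm (x - p) + 1 > 0" by (simp add: add_nonneg_pos)
    have s: "s > 0" using d npos by (simp add: s_def)
    define z where "z = x + s *\<^sub>R (x - p)"
    have "dist z x = s * norm (x - p)" using s by (simp add: z_def dist_norm)
    also have "\<dots> \<le> s * (norm (x - p) + 1)" using s by simp
    also have "\<dots> = d / 2" using npos by (simp add: s_def field_simps)
    also have "\<dots> < d" using d by simp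
    finally have "z \<in> F"
      using on_F[OF p] on_F[OF x]
      by (intro d(2)[unfolded affine_hull_F]) (auto simp: z_def inner_add_right inner_diff_right)
    then have z: "z \<in> closure E'" using FE' by blast
    define l where "l = s / (1 + s)"
    have l: "0 < l" "l < 1" using s by (auto simp: l_def)
    have xe: "x = l *\<^sub>R p + (1 - l) *\<^sub>R z"
    proof -
      have "(1 + s) *\<^sub>R (l *\<^sub>R p + (1 - l) *\<^sub>R z) = s *\<^sub>R p + z"
        using s by (simp add: l_def scaleR_add_right field_simps)
      also have "\<dots> = (1 + s) *\<^sub>R x" by (simp add: z_def algebra_simps)
      finally show ?thesis using s by simp
    qed
    have "x + t *\<^sub>R face_reeb X E' \<in> E'" if t: "0 < t" "t < l * \<delta>" for t
    proof -
      have a: "p + (t / l) *\<^sub>R face_reeb X E' \<in> E'" using into[of "t / l"] t l by (simp add: field_simps)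
      have "x + t *\<^sub>R face_reeb X E' = (1 - (1 - l)) *\<^sub>R (p + (t / l) *\<^sub>R face_reeb X E') + (1 - l) *\<^sub>R z"
        using l by (subst xe) (simp add: algebra_simps)
      then have "x + t *\<^sub>R face_reeb X E' = p + (t / l) *\<^sub>R face_reeb X E' \<or> 
         x + t *\<^sub>R face_reeb X E' \<in> open_segment (p + (t / l) *\<^sub>R face_reeb X E') z"
        using l unfolding in_segment
        by (cases "p + (t / l) *\<^sub>R face_reeb X E' = z") (auto intro!: exI[of _ "1 - l"] simp flip: scaleR_add_left)
      then show ?thesis using segment_into_face[OF E' a z] a by auto
    qed
    then show ?thesis using l \<delta> by (intro exI[of _ "l * \<delta>"]) auto
  qed
  then show "kface X 3 E' \<and> F \<subseteq> closure E' \<and>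
      (\<forall>x\<in>F. \<exists>\<delta>>0. \<forall>t. 0 < t \<and> t < \<delta> \<longrightarrow> x + t *\<^sub>R face_reeb X E' \<in> E')"
    using E' FE' by blast
  fix E2 assume E2: "kface X 3 E2 \<and> F \<subseteq> closure E2 \<and>
      (\<forall>x\<in>F. \<exists>\<delta>>0. \<forall>t. 0 < t \<and> t < \<delta> \<longrightarrow> x + t *\<^sub>R face_reeb X E2 \<in> E2)"
  then have k2: "kface X 3 E2" "p \<in> closure E2" using p by blast+
  have on2: "face_normal X E2 \<bullet> x = height E2" if "x \<in> F" for x
    using that E2 facet(4)[OF k2(1)] by blast
  \<comment> \<open>A Reeb vector that points into \<open>A\<close> cannot lead out of
    \<open>X\<close> through \<open>B\<close>. Used in both directions it annihilates the form on
    the two normals.\<close>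
  have ineq: "(quat_i *v face_normal X A) \<bullet> face_normal X B \<le> 0"
    if A: "kface X 3 A" and B: "kface X 3 B" "face_normal X B \<bullet> p = height B"
     and i: "\<exists>\<delta>>0. \<forall>t. 0 < t \<and> t < \<delta> \<longrightarrow> p + t *\<^sub>R face_reeb X A \<in> A" for A B
  proof -
    obtain d where d: "d > 0" "\<And>t. 0 < t \<Longrightarrow> t < d \<Longrightarrow> p + t *\<^sub>R face_reeb X A \<in> A" using i by blast
    have "p + (d / 2) *\<^sub>R face_reeb X A \<in> X" using d kface_rel_interior(9)[OF convex_X compact_X A] by auto
    then have "face_normal X B \<bullet> (p + (d / 2) *\<^sub>R face_reeb X A) \<le> height B" by (rule facet(3)[OF B(1)])
    then have "(d / 2) * (2 / height A) * ((quat_i *v face_normal X A) \<bullet> face_normal X B) \<le> 0"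
      using B(2) by (simp add: facet(7)[OF A] inner_add_right inner_commute)
    then show ?thesis using d facet(2)[OF A] by (simp add: mult_le_0_iff divide_le_0_iff zero_le_mult_iff)
  qed
  have p': "face_normal X E' \<bullet> p = height E'" using on_F[OF p] by (simp add: \<nu>'_def h'_def)
  have a: "(quat_i *v face_normal X E2) \<bullet> face_normal X E' \<le> 0"
    using ineq[OF k2(1) E' p'] E2 p by blast
  have b: "(quat_i *v face_normal X E') \<bullet> face_normal X E2 \<le> 0"
    using ineq[OF E' k2(1) on2[OF p] in_all[OF p]] .
  have 0: "(quat_i *v face_normal X E2) \<bullet> \<nu>' = 0"
    using a b quat_i_inner_swap[of "face_normal X E2" "face_normal X E'"] by (simp add: inner_commute \<nu>'_def)
  show "E2 = E'"
  proof (rule ccontr)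
    assume ne: "E2 \<noteq> E'"
    have n2: "norm (face_normal X E2) = 1" by (rule facet(1)[OF k2(1)])
    have "\<bar>face_normal X E2 \<bullet> \<nu>'\<bar> < 1"
      unfolding \<nu>'_def using facet_normals_independent[OF k2(1) E' k2(2)] p FE' ne by blast
    then have "(quat_i *v face_normal X E2) \<bullet> \<nu>' \<noteq> 0"
      using on2 on_F by (intro ridge_symplectic(3)[OF F n2 norm_\<nu>(2), of "height E2" h']) auto
    then show False using 0 by simp
  qed
qed

end

text \<open>The matrix ((-gp, -gq), (gr, gp)) generates the linearized Reeb flow over \<open>F\<close> in the quaternionic
  trivialization, parametrized by the angle \<open>\<theta>\<close> of the normal \<open>n \<theta>\<close>.\<close>

locale framed_corner = corner + frame
begin

definition "aJ = (J *v \<nu>) \<bullet> f"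
definition "aK = (K *v \<nu>) \<bullet> f"
definition "gp = aJ * aK / c"
definition "gq = (c\<^sup>2 + aK\<^sup>2) / c"
definition "gr = (c\<^sup>2 + aJ\<^sup>2) / c"

lemma f_expand: "f = c *\<^sub>R (quat_i *v \<nu>) + aJ *\<^sub>R (J *v \<nu>) + aK *\<^sub>R (K *v \<nu>)"
  using quat_expand[OF norm_\<nu>(1), of f] I_inner_f by (simp add: aJ_def aK_def inner_commute)

lemma coeff_norm: "c\<^sup>2 + aJ\<^sup>2 + aK\<^sup>2 = 1"
proof -
  have "f \<bullet> f = c\<^sup>2 + aJ\<^sup>2 + aK\<^sup>2"
    by (subst (1 2) f_expand) (simp add: inner_add_left inner_add_right power2_eq_square)
  then show ?thesis by simp
qed

text \<open>The determinant condition says that the generator has square - 1, and amounts to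
  \<open>f\<close> being a unit vector. The sign of \<open>gr\<close> comes from
  \<open>c > 0\<close>, that is from the direction of the crossing; it makes the rotation
  counterclockwise.\<close>

lemma gr_pos: "gr > 0" and g_det: "gq * gr - gp\<^sup>2 = 1"
proof -
  show "gr > 0" using c_pos by (simp add: gr_def add_pos_nonneg)
  have "gq * gr - gp\<^sup>2 = ((c\<^sup>2 + aK\<^sup>2) * (c\<^sup>2 + aJ\<^sup>2) - (aJ * aK)\<^sup>2) / c\<^sup>2"
    using c_pos by (simp add: gp_def gq_def gr_def power2_eq_square diff_divide_distrib)
  also have "(c\<^sup>2 + aK\<^sup>2) * (c\<^sup>2 + aJ\<^sup>2) - (aJ * aK)\<^sup>2 = c\<^sup>2 * (c\<^sup>2 + aJ\<^sup>2 + aK\<^sup>2)" by algebra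
  finally show "gq * gr - gp\<^sup>2 = 1" using coeff_norm c_pos by simp
qed

text \<open>The vector stays fixed while the frame turns with the normal. Its new coordinates
  involve its Reeb component \<open>s\<close> at \<open>\<nu>\<close>; since \<open>v\<close> is
  orthogonal to \<open>f\<close>, this component is a combination of the two coordinates, and
  eliminating it leaves a 2 by 2 matrix.\<close>

lemma transport_matrix:
  assumes v: "v \<in> tangent_space F"
  shows "quat_triv J K (n \<theta>) v = ell gp gq gr \<theta> *v quat_triv J K \<nu> v"
proof -
  have v0: "v \<bullet> \<nu> = 0" "v \<bullet> f = 0" using v by (simp_all add: tangent_F_f inner_commute)
  define s where "s = v \<bullet> (quat_i *v \<nu>)"
  define u where "u = v \<bullet> (J *v \<nu>)"
  define w where "w = v \<bullet> (K *v \<nu>)"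
  have rel: "c * s + aJ * u + aK * w = 0"
    using v0(2) by (subst (asm) f_expand) (simp add: inner_add_right s_def u_def w_def)
  have "J *v f = c *\<^sub>R (- (K *v \<nu>)) + aJ *\<^sub>R (- \<nu>) + aK *\<^sub>R (quat_i *v \<nu>)"
    "K *v f = c *\<^sub>R (J *v \<nu>) + aJ *\<^sub>R (- (quat_i *v \<nu>)) + aK *\<^sub>R (- \<nu>)"
    by (subst f_expand, simp add: matrix_vector_right_distrib matrix_vector_mult_scaleR J_I J_K K_I K_J)+
  then have f1: "v \<bullet> (J *v f) = - c * w + aK * s" and f2: "v \<bullet> (K *v f) = c * u - aJ * s"
    using v0 by (simp_all add: inner_add_right inner_diff_right s_def u_def w_def)
  have s: "s = - (aJ * u + aK * w) / c" using rel c_pos by (simp add: field_simps)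
  have g1: "- gp * u - gq * w = - c * w + aK * s" and g2: "gr * u + gp * w = c * u - aJ * s"
    unfolding s gp_def gq_def gr_def using c_pos by (simp_all add: field_simps power2_eq_square)
  have J: "v \<bullet> (J *v n \<theta>) = cos \<theta> * u + sin \<theta> * (- c * w + aK * s)"
    and K: "v \<bullet> (K *v n \<theta>) = cos \<theta> * w + sin \<theta> * (c * u - aJ * s)"
    by (simp_all add: n_def matrix_vector_right_distrib matrix_vector_mult_scaleR inner_add_right f1 f2
        flip: u_def w_def)
  show ?thesis
    unfolding vec_eq_iff forall_2 ell_mult_nth quat_triv_nth J K u_def[symmetric] w_def[symmetric]
      g1[symmetric] g2[symmetric] by (simp add: algebra_simps)
qed

end

lemma has_vector_derivative_unique_convex:
  fixes f g :: "real \<Rightarrow> 'a::real_normed_vector"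
  assumes A: "convex A" "x \<in> A" "y \<in> A" and eq: "f x = g x"
    and f: "\<And>t. t \<in> A \<Longrightarrow> (f has_vector_derivative d t) (at t within A)"
    and g: "\<And>t. t \<in> A \<Longrightarrow> (g has_vector_derivative d t) (at t within A)"
  shows "f y = g y"
proof -
  have "((\<lambda>t. f t - g t) has_vector_derivative 0) (at t within A)" if "t \<in> A" for t
    using has_vector_derivative_diff[OF f[OF that] g[OF that]] by simp
  then obtain k where "\<And>t. t \<in> A \<Longrightarrow> f t - g t = k"
    using has_vector_derivative_zero_constant[OF A(1)] by blast
  then show ?thesis using A eq by (metis eq_iff_diff_eq_0)
qed

section \<open>The turning normal and the displacement over a 2-face\<close>

context corner
begin

definition cl :: "real \<Rightarrow> real" where "cl \<theta> = max 0 (min \<alpha> \<theta>)"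

lemma cl_simps: "\<theta> \<le> 0 \<Longrightarrow> cl \<theta> = 0" "0 \<le> \<theta> \<Longrightarrow> \<theta> \<le> \<alpha> \<Longrightarrow> cl \<theta> = \<theta>" "\<alpha> \<le> \<theta> \<Longrightarrow> cl \<theta> = \<alpha>"
  and cl_bounds: "0 \<le> cl \<theta>" "cl \<theta> \<le> \<alpha>"
  using \<alpha> by (auto simp: cl_def)

lemma continuous_cl: "continuous_on A cl"
  unfolding cl_def by (intro continuous_intros)

text \<open>The antiderivative of the normal, with the angle clamped to the arc. Outside the arc it
  is linear, so that one formula describes a trajectory before, over and after the 2-face.\<close>

definition N :: "real \<Rightarrow> real^4" where
  "N \<theta> = sin (cl \<theta>) *\<^sub>R \<nu> + (1 - cos (cl \<theta>)) *\<^sub>R f + (\<theta> - cl \<theta>) *\<^sub>R n (cl \<theta>)"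

lemma N_neg: "\<theta> \<le> 0 \<Longrightarrow> N \<theta> = \<theta> *\<^sub>R \<nu>"
  and N_mid: "0 \<le> \<theta> \<Longrightarrow> \<theta> \<le> \<alpha> \<Longrightarrow> N \<theta> = sin \<theta> *\<^sub>R \<nu> + (1 - cos \<theta>) *\<^sub>R f"
  and N_big: "\<alpha> \<le> \<theta> \<Longrightarrow> N \<theta> = N \<alpha> + (\<theta> - \<alpha>) *\<^sub>R \<nu>'"
  and N_0: "N 0 = 0"
  using \<alpha> by (simp_all add: N_def cl_simps)

text \<open>The clamped normal is continuous, so it has an antiderivative differentiable everywhere,
  also at 0 and \<open>\<alpha>\<close>. This one agrees with \<open>N\<close> on each of the three
  pieces.\<close>

lemma N_derivative: "(N has_vector_derivative n (cl \<theta>)) (at \<theta>)"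
proof -
  have "continuous_on UNIV (\<lambda>\<theta>. n (cl \<theta>))"
    unfolding n_def by (intro continuous_intros continuous_cl)
  then obtain W where W: "W 0 = 0" "\<And>t. (W has_vector_derivative n (cl t)) (at t)"
    using continuous_antiderivative by metis
  have W1: "W \<theta> = \<theta> *\<^sub>R \<nu>" if "\<theta> \<le> 0" for \<theta>
    by (rule has_vector_derivative_unique_convex[of "{..0}" 0 \<theta> W _ "\<lambda>_. \<nu>"])
       (use that W has_vector_derivative_at_within[OF W(2)] in
        \<open>auto simp: cl_simps intro!: derivative_eq_intros, metis cl_simps(1) n_0\<close>)
  have W2: "W \<theta> = sin \<theta> *\<^sub>R \<nu> + (1 - cos \<theta>) *\<^sub>R f" if "0 \<le> \<theta>" "\<theta> \<le> \<alpha>" for \<theta>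
  proof (rule has_vector_derivative_unique_convex[of "{0..\<alpha>}" 0 \<theta> W _ n])
    show "(W has_vector_derivative n t) (at t within {0..\<alpha>})" if "t \<in> {0..\<alpha>}" for t
      using has_vector_derivative_at_within[OF W(2)[of t]] that by (simp add: cl_simps)
    show "((\<lambda>\<theta>. sin \<theta> *\<^sub>R \<nu> + (1 - cos \<theta>) *\<^sub>R f) has_vector_derivative n t) (at t within {0..\<alpha>})" for t
      unfolding n_def has_vector_derivative_def
      by (auto intro!: derivative_eq_intros simp: algebra_simps)
  qed (use that W in auto)
  have W3: "W \<theta> = N \<alpha> + (\<theta> - \<alpha>) *\<^sub>R \<nu>'" if "\<alpha> \<le> \<theta>" for \<theta>
  proof (rule has_vector_derivative_unique_convex[of "{\<alpha>..}" \<alpha> \<theta> W _ "\<lambda>_. \<nu>'"])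
    show "(W has_vector_derivative \<nu>') (at t within {\<alpha>..})" if "t \<in> {\<alpha>..}" for t
      using has_vector_derivative_at_within[OF W(2)[of t]] that by (simp add: cl_simps)
    show "((\<lambda>\<theta>. N \<alpha> + (\<theta> - \<alpha>) *\<^sub>R \<nu>') has_vector_derivative \<nu>') (at t within {\<alpha>..})" for t
      unfolding has_vector_derivative_def by (auto intro!: derivative_eq_intros simp: algebra_simps)
    show "W \<alpha> = N \<alpha> + (\<alpha> - \<alpha>) *\<^sub>R \<nu>'" using W2[of \<alpha>] N_mid[of \<alpha>] \<alpha> by simp
  qed (use that in auto)
  have "W \<theta> = N \<theta>" for \<theta>
    using W1[of \<theta>] W2[of \<theta>] W3[of \<theta>] N_neg[of \<theta>] N_mid[of \<theta>] N_big[of \<theta>]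
    by (metis linear)
  then have "W = N" by blast
  then show ?thesis using W(2) by blast
qed

definition hn :: "real \<Rightarrow> real" where
  "hn \<theta> = (sin (\<alpha> - \<theta>) / sin \<alpha>) * h + (sin \<theta> / sin \<alpha>) * h'"

lemma hn_eq: "x \<in> F \<Longrightarrow> n \<theta> \<bullet> x = hn \<theta>"
  by (simp add: hn_def height_n)

lemma hn_ends [simp]: "hn 0 = h" "hn \<alpha> = h'"
  using sin_\<alpha> by (simp_all add: hn_def)

lemma hn_nonneg: "0 \<le> \<theta> \<Longrightarrow> \<theta> \<le> \<alpha> \<Longrightarrow> hn \<theta> \<ge> 0"
  unfolding hn_def using sin_\<alpha> \<alpha> h_pos
  by (intro add_nonneg_nonneg mult_nonneg_nonneg divide_nonneg_pos sin_ge_zero) auto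

text \<open>In units of \<open>\<epsilon>\<close>, a trajectory moves by
  \<open>(1 / c) *\<^sub>R (quat_i *v N \<theta>)\<close> while its normal part changes by
  \<open>n (cl \<theta>) - \<nu>\<close>. The difference is the motion of the foot point.\<close>

definition dd :: "real \<Rightarrow> real^4" where
  "dd \<theta> = (1 / c) *\<^sub>R (quat_i *v N \<theta>) - (n (cl \<theta>) - \<nu>)"

lemma dd_0 [simp]: "dd 0 = 0" by (simp add: dd_def N_0 cl_simps)

text \<open>The factor \<open>1 / c\<close> is chosen so that the components along
  \<open>\<nu>\<close> and \<open>f\<close> cancel: the foot point moves within the plane of
  \<open>F\<close>. At the angle \<open>\<alpha>\<close> this is the translation caused by the
  crossing.\<close>

lemma dd_tangent:
  assumes "0 \<le> \<theta>" "\<theta> \<le> \<alpha>"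
  shows "dd \<theta> \<in> tangent_space F"
proof -
  have dd: "dd \<theta> = (sin \<theta> / c) *\<^sub>R (quat_i *v \<nu>) + ((1 - cos \<theta>) / c) *\<^sub>R (quat_i *v f)
      - (cos \<theta> *\<^sub>R \<nu> + sin \<theta> *\<^sub>R f - \<nu>)"
    using assms by (simp add: dd_def N_mid cl_simps n_def matrix_vector_right_distrib
      matrix_vector_mult_scaleR scaleR_add_right)
  have i: "\<nu> \<bullet> (quat_i *v f) = - c" "f \<bullet> (quat_i *v \<nu>) = c" using I_inner_f by (simp_all add: inner_commute)
  have "\<nu> \<bullet> dd \<theta> = 0" "f \<bullet> dd \<theta> = 0"
    unfolding dd inner_diff_right inner_add_right inner_scaleR_right i using c_pos by simp_all
  then show ?thesis by (simp add: tangent_F_f)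
qed

text \<open>The affine extension of the flow map from \<open>E\<close> to \<open>F\<close>, and its linear part.\<close>

definition land :: "real^4 \<Rightarrow> real^4" where
  "land w = w + ((h' - \<nu>' \<bullet> w) / \<sigma>) *\<^sub>R (quat_i *v \<nu>)"

definition landl :: "real^4 \<Rightarrow> real^4" where
  "landl v = v - ((\<nu>' \<bullet> v) / \<sigma>) *\<^sub>R (quat_i *v \<nu>)"

lemma land_eq: "land w = land m + landl (w - m)"
  by (simp add: land_def landl_def inner_diff_right algebra_simps diff_divide_distrib add_divide_distrib)

lemma landl_tangent: "\<nu> \<bullet> v = 0 \<Longrightarrow> landl v \<in> tangent_space F"
  using \<sigma>_pos by (simp add: tangent_F landl_def inner_diff_right inner_commute \<sigma>_def)

lemma bounded_linear_landl: "bounded_linear landl"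
proof -
  have "linear landl"
    by (rule linearI) (simp_all add: landl_def inner_add_right add_divide_distrib algebra_simps)
  then show "bounded_linear landl" by (simp add: linear_conv_bounded_linear)
qed

end

section \<open>The explicit trajectory across a 2-face\<close>

locale corner_flow = corner X E E' F + smoothing X \<epsilon> for X E E' F \<epsilon>
begin

text \<open>Time needed by the Reeb flow to turn the normal by the angle \<open>\<theta>\<close>; negative angles and angles
  above \<open>\<alpha>\<close> parametrize the motion in the adjacent flat parts.\<close>

definition tm :: "real \<Rightarrow> real" where
  "tm \<theta> = (\<epsilon> / (2 * c)) * (N \<theta> \<bullet> (SOME p. p \<in> F) + \<epsilon> * \<theta>)"

text \<open>Time per angle: the curve moves by \<open>\<epsilon> / c\<close> times the rotated
  normal per unit of angle, while the Reeb velocity is \<open>2 / (hn + \<epsilon>)\<close> times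
  the same vector.\<close>

definition speed :: "real \<Rightarrow> real" where
  "speed \<theta> = (\<epsilon> / (2 * c)) * (hn (cl \<theta>) + \<epsilon>)"

definition "\<kappa> = \<epsilon>\<^sup>2 / (2 * c)"

lemma F_point: "(SOME p. p \<in> F) \<in> F"
  using kface_rel_interior(6)[OF convex_X compact_X F] some_in_eq by blast

lemma \<kappa>_pos: "\<kappa> > 0" using eps c_pos by (simp add: \<kappa>_def)

lemma speed_ge: "speed \<theta> \<ge> \<kappa>"
proof -
  have "(\<epsilon> / (2 * c)) * \<epsilon> \<le> (\<epsilon> / (2 * c)) * (hn (cl \<theta>) + \<epsilon>)"
    using hn_nonneg[OF cl_bounds] eps c_pos by (intro mult_left_mono) auto
  then show ?thesis by (simp add: speed_def \<kappa>_def power2_eq_square)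
qed

lemma tm_derivative: "(tm has_real_derivative speed \<theta>) (at \<theta>)"
proof -
  have "((\<lambda>\<theta>. N \<theta> \<bullet> (SOME p. p \<in> F)) has_real_derivative hn (cl \<theta>)) (at \<theta>)"
    using bounded_linear.has_vector_derivative[OF bounded_linear_inner_left N_derivative, of "SOME p. p \<in> F"]
      hn_eq[OF F_point]
    by (simp add: has_real_derivative_iff_has_vector_derivative)
  then show ?thesis
    unfolding tm_def speed_def using c_pos by (auto intro!: derivative_eq_intros)
qed

lemma tm_0 [simp]: "tm 0 = 0" by (simp add: tm_def N_0)

lemma tm_diff: assumes "x \<le> y" shows "\<kappa> * (y - x) \<le> tm y - tm x"
proof -
  have "tm x - \<kappa> * x \<le> tm y - \<kappa> * y"
  proof (rule DERIV_nonneg_imp_nondecreasing[OF assms])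
    fix t
    have "((\<lambda>t. tm t - \<kappa> * t) has_real_derivative speed t - \<kappa>) (at t)"
      by (auto intro!: derivative_eq_intros tm_derivative)
    then show "\<exists>y. ((\<lambda>t. tm t - \<kappa> * t) has_real_derivative y) (at t) \<and> 0 \<le> y"
      using speed_ge[of t] by auto
  qed
  then show ?thesis by (simp add: algebra_simps)
qed

lemma tm_strict_mono: "strict_mono tm"
proof (rule strict_monoI)
  fix x y :: real assume "x < y"
  then have "0 < \<kappa> * (y - x)" using \<kappa>_pos by simp
  then show "tm x < tm y" using tm_diff[of x y] \<open>x < y\<close> by linarith
qed

lemma tm_surj: "surj tm"
proof -
  have "\<exists>\<theta>. u = tm \<theta>" for u
  proof -
    define b where "b = \<bar>u\<bar> / \<kappa>"
    have b: "b \<ge> 0" "\<kappa> * b = \<bar>u\<bar>" using \<kappa>_pos by (simp_all add: b_def)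
    have "tm (-b) \<le> u" "u \<le> tm b" using tm_diff[of "-b" 0] tm_diff[of 0 b] b by auto
    moreover have "continuous_on {-b..b} tm"
      using DERIV_isCont[OF tm_derivative] by (simp add: continuous_at_imp_continuous_on)
    ultimately show ?thesis using IVT'[of tm "-b" u b] b by auto
  qed
  then show ?thesis by (auto simp: surj_def)
qed

definition \<Theta> :: "real \<Rightarrow> real" where "\<Theta> = inv tm"

lemma tm_\<Theta> [simp]: "tm (\<Theta> u) = u" and \<Theta>_tm [simp]: "\<Theta> (tm \<theta>) = \<theta>"
  using tm_surj tm_strict_mono by (simp_all add: \<Theta>_def surj_f_inv_f strict_mono_imp_inj_on)

lemma \<Theta>_mono: "\<Theta> u \<le> \<Theta> v \<longleftrightarrow> u \<le> v"
  using tm_strict_mono by (metis strict_mono_less_eq tm_\<Theta>)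

lemma \<Theta>_0 [simp]: "\<Theta> 0 = 0" using \<Theta>_tm[of 0] by simp

lemma \<Theta>_lipschitz: "\<bar>\<Theta> u - \<Theta> v\<bar> \<le> \<bar>u - v\<bar> / \<kappa>"
proof -
  have "\<kappa> * \<bar>\<Theta> u - \<Theta> v\<bar> \<le> \<bar>u - v\<bar>"
    using tm_diff[of "\<Theta> u" "\<Theta> v"] tm_diff[of "\<Theta> v" "\<Theta> u"] by (cases "\<Theta> u \<le> \<Theta> v") auto
  then show ?thesis using \<kappa>_pos by (simp add: pos_le_divide_eq mult.commute)
qed

lemma continuous_\<Theta>: "continuous_on A \<Theta>"
  by (rule lipschitz_on_continuous_on[where L="1 / \<kappa>"])
     (use \<Theta>_lipschitz \<kappa>_pos in \<open>auto simp: lipschitz_on_def dist_real_def\<close>)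

lemma \<Theta>_derivative: "(\<Theta> has_real_derivative inverse (speed (\<Theta> u))) (at u)"
proof (rule DERIV_inverse_function[of tm _ \<Theta> u "u - 1" "u + 1"])
  show "isCont \<Theta> u" using continuous_\<Theta>[of UNIV] by (simp add: continuous_on_eq_continuous_at)
  show "speed (\<Theta> u) \<noteq> 0" using speed_ge[of "\<Theta> u"] \<kappa>_pos by simp
qed (auto intro: tm_derivative)

definition arc_time :: real where "arc_time = tm \<alpha>"

lemma arc_time_pos: "arc_time > 0"
  using tm_strict_mono \<alpha> by (metis arc_time_def strict_mono_less tm_0)

lemma \<Theta>_arc [simp]: "\<Theta> arc_time = \<alpha>" by (simp add: arc_time_def)

lemma \<Theta>_cases: "u \<le> 0 \<Longrightarrow> \<Theta> u \<le> 0" "0 \<le> u \<Longrightarrow> 0 \<le> \<Theta> u" "u \<le> arc_time \<Longrightarrow> \<Theta> u \<le> \<alpha>" "arc_time \<le> u \<Longrightarrow> \<alpha> \<le> \<Theta> u"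
  using \<Theta>_mono[of u 0] \<Theta>_mono[of 0 u] \<Theta>_mono[of u arc_time] \<Theta>_mono[of arc_time u] by auto

text \<open>Position relative to the point where the trajectory enters the part over
  \<open>F\<close>, which happens at time 0. All points of \<open>F\<close> have the same height in
  direction \<open>n \<theta>\<close>, so every trajectory crossing \<open>F\<close> is a translate
  of this one curve.\<close>

definition g :: "real \<Rightarrow> real^4" where "g u = (\<epsilon> / c) *\<^sub>R (quat_i *v N (\<Theta> u))"

definition vel :: "real \<Rightarrow> real^4" where
  "vel u = (2 / (hn (cl (\<Theta> u)) + \<epsilon>)) *\<^sub>R (quat_i *v n (cl (\<Theta> u)))"

lemma g_derivative: "(g has_vector_derivative vel u) (at u)"
proof -
  have "(\<Theta> has_vector_derivative inverse (speed (\<Theta> u))) (at u)"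
    using \<Theta>_derivative by (simp add: has_real_derivative_iff_has_vector_derivative)
  from vector_diff_chain_at[OF this N_derivative]
  have 1: "((\<lambda>u. N (\<Theta> u)) has_vector_derivative inverse (speed (\<Theta> u)) *\<^sub>R n (cl (\<Theta> u))) (at u)"
    by (simp add: o_def)
  have "bounded_linear (\<lambda>v. (\<epsilon> / c) *\<^sub>R (quat_i *v v))"
    using bounded_linear_compose[OF bounded_linear_scaleR_right matrix_vector_mul_bounded_linear] .
  from bounded_linear.has_vector_derivative[OF this 1]
  have "(g has_vector_derivative (\<epsilon> / c) *\<^sub>R (quat_i *v (inverse (speed (\<Theta> u)) *\<^sub>R n (cl (\<Theta> u))))) (at u)"
    by (simp add: g_def[abs_def])
  moreover have "hn (cl (\<Theta> u)) + \<epsilon> > 0" using hn_nonneg[OF cl_bounds] eps by (simp add: add_nonneg_pos)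
  moreover have "(\<epsilon> / c) * inverse ((\<epsilon> / (2 * c)) * x) = 2 / x" for x
    using eps c_pos by (simp add: field_simps)
  ultimately show ?thesis
    by (simp add: vel_def speed_def matrix_vector_mult_scaleR)
qed

lemma he: "h + \<epsilon> > 0" "h + \<epsilon> \<noteq> 0" "h' + \<epsilon> > 0" "h' + \<epsilon> \<noteq> 0"
  using h_pos eps by linarith+

lemma \<Theta>_neg: "u \<le> 0 \<Longrightarrow> \<Theta> u = (2 * c / (\<epsilon> * (h + \<epsilon>))) * u"
proof -
  assume u: "u \<le> 0"
  have "tm (\<Theta> u) = (\<epsilon> / (2 * c)) * (\<Theta> u * h + \<epsilon> * \<Theta> u)"
    using \<Theta>_cases(1)[OF u] on_F[OF F_point] by (simp add: tm_def N_neg)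
  then have "u = (\<epsilon> / (2 * c)) * ((h + \<epsilon>) * \<Theta> u)" by (simp add: algebra_simps)
  then have "(2 * c / (\<epsilon> * (h + \<epsilon>))) * u
      = (2 * c / (\<epsilon> * (h + \<epsilon>))) * ((\<epsilon> / (2 * c)) * ((h + \<epsilon>) * \<Theta> u))" by (rule arg_cong)
  also have "\<dots> = \<Theta> u" using eps c_pos he by simp
  finally show ?thesis by simp
qed

lemma g_neg: "u \<le> 0 \<Longrightarrow> g u = (2 * u / (h + \<epsilon>)) *\<^sub>R (quat_i *v \<nu>)"
proof -
  assume u: "u \<le> 0"
  have "g u = ((\<epsilon> / c) * \<Theta> u) *\<^sub>R (quat_i *v \<nu>)"
    unfolding g_def N_neg[OF \<Theta>_cases(1)[OF u]] by (simp add: matrix_vector_mult_scaleR)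
  moreover have "(\<epsilon> / c) * \<Theta> u = 2 * u / (h + \<epsilon>)"
    unfolding \<Theta>_neg[OF u] using eps c_pos he by simp
  ultimately show ?thesis by simp
qed

lemma \<Theta>_big: "arc_time \<le> u \<Longrightarrow> \<Theta> u = \<alpha> + (2 * c / (\<epsilon> * (h' + \<epsilon>))) * (u - arc_time)"
proof -
  assume u: "arc_time \<le> u"
  have "N (\<Theta> u) \<bullet> (SOME p. p \<in> F) = N \<alpha> \<bullet> (SOME p. p \<in> F) + (\<Theta> u - \<alpha>) * h'"
    unfolding N_big[OF \<Theta>_cases(4)[OF u]] using on_F[OF F_point] by (simp add: inner_add_left)
  then have "tm (\<Theta> u) = (\<epsilon> / (2 * c)) * ((N \<alpha> \<bullet> (SOME p. p \<in> F) + (\<Theta> u - \<alpha>) * h') + \<epsilon> * \<Theta> u)"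
    by (simp only: tm_def)
  then have "tm (\<Theta> u) = arc_time + (\<epsilon> / (2 * c)) * ((h' + \<epsilon>) * (\<Theta> u - \<alpha>))"
    by (simp add: tm_def arc_time_def algebra_simps)
  then have "u - arc_time = (\<epsilon> / (2 * c)) * ((h' + \<epsilon>) * (\<Theta> u - \<alpha>))" by simp
  then have "(2 * c / (\<epsilon> * (h' + \<epsilon>))) * (u - arc_time) = \<Theta> u - \<alpha>"
    using eps c_pos h_pos by simp
  then show ?thesis by simp
qed

lemma g_big: "arc_time \<le> u \<Longrightarrow> g u = g arc_time + (2 * (u - arc_time) / (h' + \<epsilon>)) *\<^sub>R (quat_i *v \<nu>')"
proof -
  assume u: "arc_time \<le> u"
  have "g u = (\<epsilon> / c) *\<^sub>R (quat_i *v N \<alpha>) + ((\<epsilon> / c) * (\<Theta> u - \<alpha>)) *\<^sub>R (quat_i *v \<nu>')"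
    unfolding g_def N_big[OF \<Theta>_cases(4)[OF u]]
    by (simp add: matrix_vector_right_distrib matrix_vector_mult_scaleR scaleR_add_right)
  moreover have "(\<epsilon> / c) * (\<Theta> u - \<alpha>) = 2 * (u - arc_time) / (h' + \<epsilon>)"
    unfolding \<Theta>_big[OF u] using eps c_pos he by simp
  ultimately show ?thesis by (simp add: g_def)
qed

text \<open>\<open>x + \<epsilon> dd \<theta>\<close> is the point of \<open>X\<close> closest to the point \<open>x + \<epsilon> \<nu> + g (tm \<theta>)\<close> of the trajectory.\<close>

lemma curve_eq: "x + \<epsilon> *\<^sub>R \<nu> + g u = (x + \<epsilon> *\<^sub>R dd (\<Theta> u)) + \<epsilon> *\<^sub>R n (cl (\<Theta> u))"
  by (simp add: dd_def g_def algebra_simps)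

text \<open>The three cases are the flat part before, the rounded part and the flat part after. In
  each the second summand of \<open>curve_eq\<close> is normal to \<open>X\<close> at the first, so
  the closest point, the normal and the Reeb vector can be read off.\<close>

lemma curve_point:
  assumes "u \<le> 0 \<and> x + \<epsilon> *\<^sub>R dd (\<Theta> u) \<in> closure E \<or> 0 \<le> u \<and> u \<le> arc_time \<and> x + \<epsilon> *\<^sub>R dd (\<Theta> u) \<in> F
    \<or> arc_time \<le> u \<and> x + \<epsilon> *\<^sub>R dd (\<Theta> u) \<in> closure E'"
  shows "x + \<epsilon> *\<^sub>R \<nu> + g u \<in> frontier S"
    "closest_point X (x + \<epsilon> *\<^sub>R \<nu> + g u) = x + \<epsilon> *\<^sub>R dd (\<Theta> u)"
    "outward_normal S (x + \<epsilon> *\<^sub>R \<nu> + g u) = n (cl (\<Theta> u))"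
    "reeb_field S (x + \<epsilon> *\<^sub>R \<nu> + g u) = vel u"
proof -
  define z where "z = x + \<epsilon> *\<^sub>R dd (\<Theta> u)"
  define m where "m = n (cl (\<Theta> u))"
  have Y: "x + \<epsilon> *\<^sub>R \<nu> + g u = z + \<epsilon> *\<^sub>R m" by (simp add: curve_eq z_def m_def)
  have *: "z \<in> X \<and> \<epsilon> *\<^sub>R m \<in> normal_cone X z \<and> m \<bullet> z = hn (cl (\<Theta> u))"
    using assms unfolding z_def[symmetric]
  proof (elim disjE conjE)
    assume "u \<le> 0" "z \<in> closure E"
    then show ?thesis using \<Theta>_cases(1) facet_normal_in_cone[OF E _ less_imp_le[OF eps]] on_E facet(4)[OF E]
      by (auto simp: cl_simps m_def \<nu>_def)
  next
    assume "0 \<le> u" "u \<le> arc_time" "z \<in> F"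
    then show ?thesis using \<Theta>_cases(2,3) n_normal[OF _ _ _ less_imp_le[OF eps]] hn_eq
        kface_rel_interior(9)[OF convex_X compact_X F]
      by (auto simp: cl_simps m_def)
  next
    assume "arc_time \<le> u" "z \<in> closure E'"
    then show ?thesis using \<Theta>_cases(4) facet_normal_in_cone[OF E' _ less_imp_le[OF eps]] on_E' facet(4)[OF E']
      by (auto simp: cl_simps m_def \<nu>'_def)
  qed
  have off: "offset (z + \<epsilon> *\<^sub>R m) = \<epsilon> *\<^sub>R m" using offset_normal_eq * by blast
  show fr: "x + \<epsilon> *\<^sub>R \<nu> + g u \<in> frontier S"
    using eps by (simp add: Y frontier_eq off) (simp add: m_def)
  show "closest_point X (x + \<epsilon> *\<^sub>R \<nu> + g u) = x + \<epsilon> *\<^sub>R dd (\<Theta> u)"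
    unfolding Y z_def[symmetric] using closest_point_normal * by blast
  show "outward_normal S (x + \<epsilon> *\<^sub>R \<nu> + g u) = n (cl (\<Theta> u))"
    using eps by (simp add: outward_normal_eq[OF fr]) (simp add: Y off, simp add: m_def)
  have "m \<bullet> (z + \<epsilon> *\<^sub>R m) = hn (cl (\<Theta> u)) + \<epsilon>"
    using * n_n by (simp add: inner_add_right m_def)
  then show "reeb_field S (x + \<epsilon> *\<^sub>R \<nu> + g u) = vel u"
    using eps by (simp add: reeb_field_eq[OF fr]) (simp add: Y off vel_def matrix_vector_mult_scaleR, simp add: m_def)
qed

text \<open>The time after which the trajectory starting over \<open>w\<close> leaves the flat part over \<open>E\<close>.\<close>

definition delay :: "real^4 \<Rightarrow> real" where
  "delay w = (h' - \<nu>' \<bullet> w) * (h + \<epsilon>) / (2 * \<sigma>)"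

lemma delay_nonneg: "w \<in> X \<Longrightarrow> delay w \<ge> 0"
  using X_le(2) h_pos eps \<sigma>_pos by (simp add: delay_def)

lemma land_delay: "land w + g (- delay w) = w" if "w \<in> X"
proof -
  have "2 * (- delay w) / (h + \<epsilon>) = - ((h' - \<nu>' \<bullet> w) / \<sigma>)"
    using he \<sigma>_pos by (simp add: delay_def)
  then show ?thesis using delay_nonneg[OF that] by (simp add: g_neg land_def)
qed

text \<open>The trajectory starting over \<open>w\<close> crosses the part over \<open>F\<close> and is over \<open>E'\<close> at time \<open>D\<close>.\<close>

definition passes :: "real^4 \<Rightarrow> real \<Rightarrow> bool" where
  "passes w D \<longleftrightarrow> w \<in> E \<and> (\<forall>\<theta>\<in>{0..\<alpha>}. land w + \<epsilon> *\<^sub>R dd \<theta> \<in> F) \<and> delay w + arc_time \<le> D \<and>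
     land w + \<epsilon> *\<^sub>R dd \<alpha> + (2 * (D - delay w - arc_time) / (h' + \<epsilon>)) *\<^sub>R (quat_i *v \<nu>') \<in> E'"

text \<open>Only the start, the arc and the end are prescribed by \<open>passes\<close>; convexity
  of the 3-faces supplies the two straight pieces. The second claim locates the foot point in the
  relatively open faces, as the transversality proof requires.\<close>

lemma passes_curve:
  assumes P: "passes w D" and u: "0 \<le> u" "u \<le> D"
  defines "v \<equiv> u - delay w"
  shows "v \<le> 0 \<and> land w + \<epsilon> *\<^sub>R dd (\<Theta> v) \<in> closure E \<or> 0 \<le> v \<and> v \<le> arc_time \<and> land w + \<epsilon> *\<^sub>R dd (\<Theta> v) \<in> F
    \<or> arc_time \<le> v \<and> land w + \<epsilon> *\<^sub>R dd (\<Theta> v) \<in> closure E'"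
    "land w + \<epsilon> *\<^sub>R dd (\<Theta> v) \<in> E \<union> F \<union> E'"
proof -
  have w: "w \<in> E" "w \<in> X" using P kface_rel_interior(9)[OF convex_X compact_X E] by (auto simp: passes_def)
  have d0: "delay w \<ge> 0" by (rule delay_nonneg[OF w(2)])
  have arc: "land w + \<epsilon> *\<^sub>R dd \<theta> \<in> F" if "0 \<le> \<theta>" "\<theta> \<le> \<alpha>" for \<theta> using P that by (auto simp: passes_def)
  have land_F: "land w \<in> F" using arc[of 0] \<alpha> by simp
  define e where "e = land w + \<epsilon> *\<^sub>R dd \<alpha> + (2 * (D - delay w - arc_time) / (h' + \<epsilon>)) *\<^sub>R (quat_i *v \<nu>')"
  have e: "e \<in> E'" using P by (simp add: passes_def e_def)
  have E_cl: "E \<subseteq> closure E" "E' \<subseteq> closure E'" by (rule closure_subset)+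
  have seg: "z \<in> insert b B" if z: "z = (1 - l) *\<^sub>R a + l *\<^sub>R b" "0 \<le> l" "l \<le> 1"
    and B: "kface X 3 B" "a \<in> B" "b \<in> closure B" for z l a b and B
  proof (cases "l = 0 \<or> l = 1 \<or> a = b")
    case True
    then show ?thesis using z B by (auto simp flip: scaleR_add_left)
  next
    case False
    then have "z \<in> open_segment a b" using z unfolding in_segment by (intro conjI exI[of _ l]) auto
    then show ?thesis using segment_into_face[OF B] by blast
  qed
  have convex_comb: "(1 - l) *\<^sub>R (y - x) + l *\<^sub>R y = y - (1 - l) *\<^sub>R x" for l and x y :: "real^4"
    by (simp add: algebra_simps)
  consider "v \<le> 0" | "0 \<le> v" "v \<le> arc_time" | "arc_time \<le> v" by linarith
  then have "(v \<le> 0 \<and> land w + \<epsilon> *\<^sub>R dd (\<Theta> v) \<in> closure E \<or> 0 \<le> v \<and> v \<le> arc_time \<and> land w + \<epsilon> *\<^sub>R dd (\<Theta> v) \<in> F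
    \<or> arc_time \<le> v \<and> land w + \<epsilon> *\<^sub>R dd (\<Theta> v) \<in> closure E') \<and> land w + \<epsilon> *\<^sub>R dd (\<Theta> v) \<in> E \<union> F \<union> E'"
  proof cases
    case 1
    have "\<epsilon> *\<^sub>R dd (\<Theta> v) = g v"
      using \<Theta>_cases(1)[OF 1] eps by (simp add: dd_def g_def cl_simps)
    then have z: "land w + \<epsilon> *\<^sub>R dd (\<Theta> v) = land w + (2 * v / (h + \<epsilon>)) *\<^sub>R (quat_i *v \<nu>)" by (simp add: g_neg[OF 1])
    have "land w + \<epsilon> *\<^sub>R dd (\<Theta> v) \<in> insert (land w) E"
    proof (cases "delay w = 0")
      case True
      then have "v = 0" using 1 u by (simp add: v_def)
      then show ?thesis by (simp add: z)
    next
      case False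
      have "w = land w - (2 * delay w / (h + \<epsilon>)) *\<^sub>R (quat_i *v \<nu>)"
        using land_delay[OF w(2)] d0 by (simp add: g_neg)
      then have "(1 - u / delay w) *\<^sub>R w + (u / delay w) *\<^sub>R land w
         = land w - (1 - u / delay w) *\<^sub>R ((2 * delay w / (h + \<epsilon>)) *\<^sub>R (quat_i *v \<nu>))"
        using convex_comb[of "u / delay w" "land w"] by metis
      also have "(1 - u / delay w) *\<^sub>R ((2 * delay w / (h + \<epsilon>)) *\<^sub>R (quat_i *v \<nu>)) = (- (2 * v / (h + \<epsilon>))) *\<^sub>R (quat_i *v \<nu>)"
      proof -
        have "(1 - u / delay w) * (2 * delay w / (h + \<epsilon>)) = - (2 * v / (h + \<epsilon>))"
          using False by (simp add: v_def left_diff_distrib right_diff_distrib diff_divide_distrib)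
        then show ?thesis by (simp only: scaleR_scaleR)
      qed
      finally have "land w + \<epsilon> *\<^sub>R dd (\<Theta> v) = (1 - u / delay w) *\<^sub>R w + (u / delay w) *\<^sub>R land w" by (simp add: z)
      then show ?thesis
        using 1 u d0 False land_F FE by (intro seg[of _ "u / delay w" w "land w" E] E w(1)) (auto simp: v_def divide_le_eq)
    qed
    then show ?thesis using 1 land_F FE E_cl by auto
  next
    case 2
    then show ?thesis using arc[OF \<Theta>_cases(2,3)] by auto
  next
    case 3
    have "\<epsilon> *\<^sub>R dd (\<Theta> v) = \<epsilon> *\<^sub>R dd \<alpha> + (g v - g arc_time)"
      using \<Theta>_cases(4)[OF 3] eps \<alpha> by (simp add: dd_def g_def cl_simps algebra_simps)
    then have z: "land w + \<epsilon> *\<^sub>R dd (\<Theta> v) = (land w + \<epsilon> *\<^sub>R dd \<alpha>) + (2 * (v - arc_time) / (h' + \<epsilon>)) *\<^sub>R (quat_i *v \<nu>')"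
      by (simp add: g_big[OF 3])
    have aF: "land w + \<epsilon> *\<^sub>R dd \<alpha> \<in> F" using arc \<alpha> by simp
    have "land w + \<epsilon> *\<^sub>R dd (\<Theta> v) \<in> insert (land w + \<epsilon> *\<^sub>R dd \<alpha>) E'"
    proof (cases "D - delay w - arc_time = 0")
      case True
      then have "v = arc_time" using 3 u by (simp add: v_def)
      then show ?thesis by (simp add: z)
    next
      case False
      define q where "q = D - delay w - arc_time"
      have q: "q > 0" using False P by (simp add: q_def passes_def)
      define l where "l = 1 - (v - arc_time) / q"
      have l: "0 \<le> l" "l \<le> 1" using q 3 u by (auto simp: l_def v_def q_def divide_le_eq)
      have "(1 - l) *\<^sub>R e + l *\<^sub>R (land w + \<epsilon> *\<^sub>R dd \<alpha>)
         = (land w + \<epsilon> *\<^sub>R dd \<alpha>) + (1 - l) *\<^sub>R ((2 * q / (h' + \<epsilon>)) *\<^sub>R (quat_i *v \<nu>'))"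
        unfolding e_def q_def[symmetric] by (simp add: algebra_simps)
      also have "(1 - l) *\<^sub>R ((2 * q / (h' + \<epsilon>)) *\<^sub>R (quat_i *v \<nu>')) = (2 * (v - arc_time) / (h' + \<epsilon>)) *\<^sub>R (quat_i *v \<nu>')"
        using q by (simp add: l_def)
      finally have "land w + \<epsilon> *\<^sub>R dd (\<Theta> v) = (1 - l) *\<^sub>R e + l *\<^sub>R (land w + \<epsilon> *\<^sub>R dd \<alpha>)" by (simp add: z)
      then show ?thesis using l aF FE' by (intro seg[of _ l e _ E'] E' e) auto
    qed
    then show ?thesis using 3 aF FE' E_cl by auto
  qed
  then show "v \<le> 0 \<and> land w + \<epsilon> *\<^sub>R dd (\<Theta> v) \<in> closure E \<or> 0 \<le> v \<and> v \<le> arc_time \<and> land w + \<epsilon> *\<^sub>R dd (\<Theta> v) \<in> F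
    \<or> arc_time \<le> v \<and> land w + \<epsilon> *\<^sub>R dd (\<Theta> v) \<in> closure E'"
    "land w + \<epsilon> *\<^sub>R dd (\<Theta> v) \<in> E \<union> F \<union> E'" by blast+
qed

text \<open>The curve satisfies the Reeb equation on \<open>[0, D]\<close>, so by uniqueness it is
  the flow line.\<close>

lemma passes_flow:
  assumes P: "passes w D" and u: "0 \<le> u" "u \<le> D"
  shows "reeb_flow S u (w + \<epsilon> *\<^sub>R \<nu>) = land w + \<epsilon> *\<^sub>R \<nu> + g (u - delay w)"
    "closest_point X (reeb_flow S u (w + \<epsilon> *\<^sub>R \<nu>)) \<in> E \<union> F \<union> E'"
    "outward_normal S (reeb_flow S u (w + \<epsilon> *\<^sub>R \<nu>)) = n (cl (\<Theta> (u - delay w)))"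
    "w + \<epsilon> *\<^sub>R \<nu> \<in> frontier S"
proof -
  have w: "w \<in> X" using P kface_rel_interior(9)[OF convex_X compact_X E] by (auto simp: passes_def)
  define Y where "Y t = land w + \<epsilon> *\<^sub>R \<nu> + g (t - delay w)" for t
  have Y0: "Y 0 = w + \<epsilon> *\<^sub>R \<nu>" using land_delay[OF w] by (simp add: Y_def add.assoc add.commute add.left_commute)
  have d: "(Y has_vector_derivative vel (t - delay w)) (at t)" for t
  proof -
    have "((\<lambda>t. t - delay w) has_vector_derivative 1) (at t)"
      by (auto intro!: derivative_eq_intros simp: has_vector_derivative_def)
    from vector_diff_chain_at[OF this g_derivative]
    have "((\<lambda>t. g (t - delay w)) has_vector_derivative vel (t - delay w)) (at t)" by (simp add: o_def)
    then show ?thesis unfolding Y_def by (auto intro!: derivative_eq_intros)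
  qed
  have on: "Y t \<in> frontier S \<and> (Y has_vector_derivative reeb_field S (Y t)) (at t within {0..D})"
    if "t \<in> {0..D}" for t
    using curve_point(1,4)[OF passes_curve(1)[OF P, of t]] that d[of t]
    by (simp add: Y_def[symmetric] has_vector_derivative_at_within)
  have eq: "reeb_flow S u (w + \<epsilon> *\<^sub>R \<nu>) = Y u"
    using flow_local[of D Y u, OF on] u by (simp add: Y0)
  then show "reeb_flow S u (w + \<epsilon> *\<^sub>R \<nu>) = land w + \<epsilon> *\<^sub>R \<nu> + g (u - delay w)" by (simp add: Y_def)
  show "closest_point X (reeb_flow S u (w + \<epsilon> *\<^sub>R \<nu>)) \<in> E \<union> F \<union> E'"
    "outward_normal S (reeb_flow S u (w + \<epsilon> *\<^sub>R \<nu>)) = n (cl (\<Theta> (u - delay w)))"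
    using curve_point(2,3)[OF passes_curve(1)[OF P u]] passes_curve(2)[OF P u]
    by (simp_all add: eq Y_def)
  show "w + \<epsilon> *\<^sub>R \<nu> \<in> frontier S" using on[of 0] u Y0 by auto
qed

text \<open>Over a 3-face the hypersurface is locally a hyperplane. A derivative within the frontier
  at such a point concerns a map on a piece of a hyperplane, where \<open>passes\<close> describes
  all nearby trajectories.\<close>

lemma frontier_near_flat:
  assumes m: "m \<in> E"
  obtains \<delta> where "\<delta> > 0" "\<And>y. y \<in> frontier S \<Longrightarrow> dist y (m + \<epsilon> *\<^sub>R \<nu>) < \<delta> \<Longrightarrow> \<nu> \<bullet> (y - \<epsilon> *\<^sub>R \<nu>) = h"
proof -
  obtain d where d: "d > 0" "\<And>z. \<nu> \<bullet> z = h \<Longrightarrow> dist z m < d \<Longrightarrow> z \<in> E"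
    using facet_open[OF E m] unfolding \<nu>_def h_def by metis
  have mh: "\<nu> \<bullet> m = h" using on_E m closure_subset by blast
  show thesis
  proof (rule that[of "min (d / 2) \<epsilon>"])
    fix y assume y: "y \<in> frontier S" "dist y (m + \<epsilon> *\<^sub>R \<nu>) < min (d / 2) \<epsilon>"
    \<comment> \<open>\<open>w\<close> is the projection of \<open>y\<close> to the hyperplane of
      \<open>E\<close>. Once it is known to lie in \<open>E\<close> it is the closest point of
      \<open>X\<close>, and then \<open>s\<close> has to be the distance
      \<open>\<epsilon>\<close>.\<close>
    define s where "s = \<nu> \<bullet> y - h"
    define w where "w = y - s *\<^sub>R \<nu>"
    have "s - \<epsilon> = \<nu> \<bullet> (y - (m + \<epsilon> *\<^sub>R \<nu>))" by (simp add: s_def mh inner_diff_right inner_add_right)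
    also have "\<bar>\<dots>\<bar> \<le> dist y (m + \<epsilon> *\<^sub>R \<nu>)"
      using Cauchy_Schwarz_ineq2[of \<nu> "y - (m + \<epsilon> *\<^sub>R \<nu>)"] by (simp add: dist_norm)
    finally have se: "\<bar>s - \<epsilon>\<bar> \<le> dist y (m + \<epsilon> *\<^sub>R \<nu>)" .
    then have s0: "s > 0" using y by auto
    have wm: "w - m = (y - (m + \<epsilon> *\<^sub>R \<nu>)) - (s - \<epsilon>) *\<^sub>R \<nu>" by (simp add: w_def algebra_simps)
    have "norm (w - m) \<le> dist y (m + \<epsilon> *\<^sub>R \<nu>) + \<bar>s - \<epsilon>\<bar>"
      unfolding wm using norm_triangle_ineq4[of "y - (m + \<epsilon> *\<^sub>R \<nu>)" "(s - \<epsilon>) *\<^sub>R \<nu>"] by (simp add: dist_norm)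
    then have "dist w m < d" using se y by (simp add: dist_norm)
    then have "w \<in> E" by (intro d(2)) (simp add: w_def s_def inner_diff_right)
    then have "offset (w + s *\<^sub>R \<nu>) = s *\<^sub>R \<nu>"
      using facet_normal_in_cone[OF E, of w s] closure_subset[of E] s0 kface_rel_interior(9)[OF convex_X compact_X E]
      by (intro offset_normal_eq) (auto simp: \<nu>_def)
    then have "s = \<epsilon>" using y(1) s0 by (simp add: w_def frontier_eq)
    then show "\<nu> \<bullet> (y - \<epsilon> *\<^sub>R \<nu>) = h" by (simp add: s_def inner_diff_right)
  qed (use d eps in auto)
qed

definition delayl :: "real^4 \<Rightarrow> real" where
  "delayl v = - (\<nu>' \<bullet> v) * (h + \<epsilon>) / (2 * \<sigma>)"

lemma delay_eq: "delay w = delay m + delayl (w - m)"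
  by (simp add: delay_def delayl_def inner_diff_right algebra_simps diff_divide_distrib add_divide_distrib)

lemma bounded_linear_delayl: "bounded_linear delayl"
proof -
  have "linear delayl"
    by (rule linearI) (simp_all add: delayl_def inner_add_right add_divide_distrib algebra_simps diff_divide_distrib)
  then show "bounded_linear delayl" by (simp add: linear_conv_bounded_linear)
qed

text \<open>Near the base point the flow is the affine landing map plus the fixed curve
  \<open>g\<close>, evaluated at a time reduced by an affine delay. The landing map contributes
  \<open>landl\<close>, the delay a multiple of the velocity.\<close>

lemma flow_derivative:
  assumes m: "m \<in> E" and \<delta>: "\<delta> > 0" "\<And>w. \<nu> \<bullet> w = h \<Longrightarrow> dist w m < \<delta> \<Longrightarrow> passes w D"
    and u: "0 \<le> u" "u \<le> D"
  shows "(reeb_flow S u has_derivative (\<lambda>v. landl v - delayl v *\<^sub>R vel (u - delay m)))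
           (at (m + \<epsilon> *\<^sub>R \<nu>) within frontier S)"
proof -
  define y0 where "y0 = m + \<epsilon> *\<^sub>R \<nu>"
  define f where "f y = land m + landl (y - y0) + \<epsilon> *\<^sub>R \<nu> + g (u - (delay m + delayl (y - y0)))" for y
  have mh: "\<nu> \<bullet> m = h" using on_E m closure_subset by blast
  have "((\<lambda>y. u - (delay m + delayl (y - y0))) has_derivative (\<lambda>v. - delayl v)) (at y0)"
    by (auto intro!: derivative_eq_intros bounded_linear.has_derivative[OF bounded_linear_delayl])
  moreover have "(g has_derivative (\<lambda>h. h *\<^sub>R vel (u - delay m))) (at (u - (delay m + delayl (y0 - y0))))"
    using g_derivative[of "u - delay m"] linear_0[OF bounded_linear.linear[OF bounded_linear_delayl]]
    by (simp add: has_vector_derivative_def)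
  ultimately have "((\<lambda>y. g (u - (delay m + delayl (y - y0)))) has_derivative (\<lambda>v. (- delayl v) *\<^sub>R vel (u - delay m))) (at y0)"
    by (rule has_derivative_compose)
  moreover have "((\<lambda>y. land m + landl (y - y0) + \<epsilon> *\<^sub>R \<nu>) has_derivative landl) (at y0)"
    by (auto intro!: derivative_eq_intros bounded_linear.has_derivative[OF bounded_linear_landl])
  ultimately have "(f has_derivative (\<lambda>v. landl v + (- delayl v) *\<^sub>R vel (u - delay m))) (at y0)"
    unfolding f_def by (intro has_derivative_add)
  then have f: "(f has_derivative (\<lambda>v. landl v - delayl v *\<^sub>R vel (u - delay m))) (at y0 within frontier S)"
    by (auto intro: has_derivative_at_withinI)
  obtain d where d: "d > 0" "\<And>y. y \<in> frontier S \<Longrightarrow> dist y y0 < d \<Longrightarrow> \<nu> \<bullet> (y - \<epsilon> *\<^sub>R \<nu>) = h"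
    using frontier_near_flat[OF m] unfolding y0_def by metis
  have eq: "f y = reeb_flow S u y" if y: "y \<in> frontier S" "dist y y0 < min d \<delta>" for y
  proof -
    define w where "w = y - \<epsilon> *\<^sub>R \<nu>"
    have "dist w m = dist y y0" by (simp add: w_def y0_def dist_norm algebra_simps)
    then have "passes w D" using d(2)[OF y(1)] y(2) by (intro \<delta>(2)) (auto simp: w_def)
    from passes_flow(1)[OF this u] have "reeb_flow S u y = land w + \<epsilon> *\<^sub>R \<nu> + g (u - delay w)" by (simp add: w_def)
    moreover have "w - m = y - y0" by (simp add: w_def y0_def)
    ultimately show ?thesis by (simp add: f_def land_eq[of w m] delay_eq[of w m])
  qed
  have "y0 \<in> frontier S"
    using passes_flow(4)[OF \<delta>(2)[of m], of u] mh \<delta>(1) u by (simp add: y0_def)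
  from has_derivative_transform_within[OF f _ this eq, where d="min d \<delta>"] show ?thesis
    using d \<delta> by (simp add: y0_def)
qed

lemma vel_normal: "n (cl (\<Theta> v)) \<bullet> vel v = 0"
  by (simp add: vel_def)

lemma dd_end_curve: "arc_time \<le> u \<Longrightarrow> x + \<epsilon> *\<^sub>R \<nu> + g u
    = x + \<epsilon> *\<^sub>R dd \<alpha> + (2 * (u - arc_time) / (h' + \<epsilon>)) *\<^sub>R (quat_i *v \<nu>') + \<epsilon> *\<^sub>R \<nu>'"
  using curve_eq[of 0 arc_time] \<alpha> by (simp add: g_big[of u] cl_simps algebra_simps)

lemma passes_first_part:
  assumes "passes m D" "0 \<le> u" "u \<le> delay m"
  shows "reeb_flow S u (m + \<epsilon> *\<^sub>R \<nu>) = m + \<epsilon> *\<^sub>R \<nu> + (2 * u / (h + \<epsilon>)) *\<^sub>R (quat_i *v \<nu>)"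
proof -
  have w: "m \<in> X" using assms kface_rel_interior(9)[OF convex_X compact_X E] by (auto simp: passes_def)
  have "delay m \<le> D" using assms(1) arc_time_pos by (auto simp: passes_def)
  then have "reeb_flow S u (m + \<epsilon> *\<^sub>R \<nu>) = (land m + g (- delay m)) + \<epsilon> *\<^sub>R \<nu> + (g (u - delay m) - g (- delay m))"
    using passes_flow(1)[OF assms(1,2)] assms(3) by simp
  also have "g (u - delay m) - g (- delay m) = (2 * u / (h + \<epsilon>)) *\<^sub>R (quat_i *v \<nu>)"
    using assms by (simp add: g_neg diff_divide_distrib algebra_simps)
  finally show ?thesis by (simp add: land_delay[OF w])
qed

lemma passes_last_part:
  assumes P: "passes m D" and u: "delay m + arc_time \<le> u" "u \<le> D"
  shows "reeb_flow S u (m + \<epsilon> *\<^sub>R \<nu>)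
    = land m + \<epsilon> *\<^sub>R dd \<alpha> + (2 * (u - delay m - arc_time) / (h' + \<epsilon>)) *\<^sub>R (quat_i *v \<nu>') + \<epsilon> *\<^sub>R \<nu>'"
proof -
  have w: "m \<in> X" using P kface_rel_interior(9)[OF convex_X compact_X E] by (auto simp: passes_def)
  have "0 \<le> u" using delay_nonneg[OF w] arc_time_pos u by linarith
  then show ?thesis using passes_flow(1)[OF P _ u(2)] dd_end_curve[of "u - delay m"] u(1) by simp
qed

end

locale framed_corner_flow = framed_corner X E E' F J K + corner_flow X E E' F \<epsilon>
  for X E E' F J K \<epsilon>
begin

text \<open>Landing changes \<open>v\<close> by a multiple of the Reeb direction at the start, and
  the delay adds one of the Reeb direction at the end. The trivializations see neither, so what
  remains is a fixed vector tangent to \<open>F\<close> under a turning frame.\<close>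

lemma flow_linearization:
  assumes m: "m \<in> E" and \<delta>: "\<delta> > 0" "\<And>w. \<nu> \<bullet> w = h \<Longrightarrow> dist w m < \<delta> \<Longrightarrow> passes w D"
    and u: "0 \<le> u" "u \<le> D"
  obtains L where "(reeb_flow S u has_derivative L) (at (m + \<epsilon> *\<^sub>R \<nu>) within frontier S)"
    "\<And>v. \<nu> \<bullet> v = 0 \<Longrightarrow> n (cl (\<Theta> (u - delay m))) \<bullet> L v = 0"
    "\<And>v. \<nu> \<bullet> v = 0 \<Longrightarrow> quat_triv J K (n (cl (\<Theta> (u - delay m)))) (L v)
       = ell gp gq gr (cl (\<Theta> (u - delay m))) *v quat_triv J K \<nu> v"
proof -
  define L where "L v = landl v - delayl v *\<^sub>R vel (u - delay m)" for v
  define \<theta> where "\<theta> = cl (\<Theta> (u - delay m))"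
  have 1: "n \<theta> \<bullet> L v = 0" if v: "\<nu> \<bullet> v = 0" for v
  proof -
    have "\<nu> \<bullet> landl v = 0" "f \<bullet> landl v = 0" using landl_tangent[OF v] by (auto simp: tangent_F_f)
    then show ?thesis using vel_normal[of "u - delay m"]
      by (simp add: L_def \<theta>_def[symmetric] inner_diff_right) (simp add: n_def inner_add_left)
  qed
  have 2: "quat_triv J K (n \<theta>) (L v) = ell gp gq gr \<theta> *v quat_triv J K \<nu> v" if v: "\<nu> \<bullet> v = 0" for v
  proof -
    have "L v = landl v + (- delayl v * (2 / (hn \<theta> + \<epsilon>))) *\<^sub>R (quat_i *v n \<theta>)"
      by (simp add: L_def vel_def \<theta>_def)
    then have "quat_triv J K (n \<theta>) (L v) = quat_triv J K (n \<theta>) (landl v)"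
      by (simp only: quat_triv_add_right quat_triv_I add_0_right)
    also have "\<dots> = ell gp gq gr \<theta> *v quat_triv J K \<nu> (landl v)"
      by (rule transport_matrix[OF landl_tangent[OF v]])
    also have "quat_triv J K \<nu> (landl v) = quat_triv J K \<nu> v"
    proof -
      have "landl v = v + (- ((\<nu>' \<bullet> v) / \<sigma>)) *\<^sub>R (quat_i *v \<nu>)" by (simp add: landl_def)
      then show ?thesis by (simp only: quat_triv_add_right quat_triv_I add_0_right)
    qed
    finally show ?thesis .
  qed
  show thesis
    using that[of L] flow_derivative[OF m \<delta> u] 1 2 by (simp add: L_def[abs_def] \<theta>_def)
qed

end

text \<open>A derivative within a set is determined in those directions in which the set contains a
  segment around the point. All uniqueness statements about linearizations rest on this.\<close>

lemma has_derivative_within_unique_direction: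
  fixes f :: "'a::real_normed_vector \<Rightarrow> 'b::real_normed_vector"
  assumes "(f has_derivative L) (at x within S)" "(f has_derivative L') (at x within S)"
    and \<delta>: "\<delta> > 0" "\<And>t. \<bar>t\<bar> < \<delta> \<Longrightarrow> x + t *\<^sub>R v \<in> S"
  shows "L v = L' v"
proof -
  have *: "((\<lambda>t. f (x + t *\<^sub>R v)) has_vector_derivative M v) (at 0)" if M: "(f has_derivative M) (at x within S)" for M
  proof -
    have c: "((\<lambda>t. x + t *\<^sub>R v) has_derivative (\<lambda>t. t *\<^sub>R v)) (at 0 within {-\<delta><..<\<delta>})"
      by (auto intro!: derivative_eq_intros)
    have "(\<lambda>t. x + t *\<^sub>R v) ` {-\<delta><..<\<delta>} \<subseteq> S" by (auto intro!: \<delta>(2))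
    then have "(f has_derivative M) (at (x + 0 *\<^sub>R v) within (\<lambda>t. x + t *\<^sub>R v) ` {-\<delta><..<\<delta>})"
      using has_derivative_subset[OF M, of "(\<lambda>t. x + t *\<^sub>R v) ` {-\<delta><..<\<delta>}"] by simp
    from has_derivative_in_compose[OF c this]
    have "((\<lambda>t. f (x + t *\<^sub>R v)) has_derivative (\<lambda>t. t *\<^sub>R M v)) (at 0 within {-\<delta><..<\<delta>})"
      using linear_scale[OF has_derivative_linear[OF M]] by simp
    then show ?thesis
      using \<delta>(1) at_within_open[of 0 "{-\<delta><..<\<delta>}"] by (simp add: has_vector_derivative_def)
  qed
  from vector_derivative_unique_at[OF *[OF assms(1)] *[OF assms(2)]] show ?thesis .
qed

lemma isCont_near:
  assumes "isCont f x" "e > 0"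
  shows "\<forall>\<^sub>F y in nhds x. dist (f y) (f x) < e"
proof -
  have "(f \<longlongrightarrow> f x) (nhds x)" using assms(1) unfolding isCont_def tendsto_at_iff_tendsto_nhds .
  then show ?thesis using assms(2) by (rule tendstoD)
qed

section \<open>The combinatorial flow map near the orbit\<close>

context corner
begin

text \<open>Since \<open>x\<close> and \<open>land x\<close> may both lie on the boundary of
  \<open>E\<close>, that the open segment lies in \<open>E\<close> is not visibly an open condition
  on \<open>x\<close>. Tested at the midpoint of the segment it is one.\<close>

lemma flow_map_eq_land:
  assumes G: "G \<subseteq> closure E" "p \<in> G" and land: "land p \<in> F" and mid: "midpoint p (land p) \<in> E"
    and pos: "\<nu>' \<bullet> p < h'"
  obtains \<delta> where "\<delta> > 0" "\<And>x. x \<in> G \<Longrightarrow> dist x p < \<delta> \<Longrightarrow> flow_map X E F x = land x \<and> land x \<in> F"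
proof -
  obtain d1 where d1: "d1 > 0" "\<And>z. \<nu> \<bullet> z = h \<Longrightarrow> \<nu>' \<bullet> z = h' \<Longrightarrow> dist z (land p) < d1 \<Longrightarrow> z \<in> F"
    using open_F[OF land] by metis
  obtain d2 where d2: "d2 > 0" "\<And>z. \<nu> \<bullet> z = h \<Longrightarrow> dist z (midpoint p (land p)) < d2 \<Longrightarrow> z \<in> E"
    using facet_open[OF E mid] unfolding \<nu>_def h_def by metis
  have c: "continuous (at p) land" unfolding land_def using \<sigma>_pos by (intro continuous_intros) auto
  have c2: "continuous (at p) (\<lambda>x. midpoint x (land x))"
    unfolding midpoint_def by (intro continuous_intros c)
  have "open {x. \<nu>' \<bullet> x < h'}" by (rule open_halfspace_lt)
  then have "\<forall>\<^sub>F x in nhds p. \<nu>' \<bullet> x < h'" using pos by (auto simp: eventually_nhds)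
  moreover note isCont_near[OF c d1(1)] isCont_near[OF c2 d2(1)]
  ultimately have "\<forall>\<^sub>F x in nhds p. dist (land x) (land p) < d1 \<and>
     dist (midpoint x (land x)) (midpoint p (land p)) < d2 \<and> \<nu>' \<bullet> x < h'"
    by eventually_elim auto
  then obtain \<delta> where \<delta>: "\<delta> > 0" "\<And>x. dist x p < \<delta> \<Longrightarrow> dist (land x) (land p) < d1 \<and>
     dist (midpoint x (land x)) (midpoint p (land p)) < d2 \<and> \<nu>' \<bullet> x < h'"
    unfolding eventually_nhds_metric by blast
  show thesis
  proof (rule that[OF \<delta>(1)])
    fix x assume x: "x \<in> G" "dist x p < \<delta>"
    have xE: "x \<in> closure E" using x G by blast
    have xh: "\<nu> \<bullet> x = h" using on_E xE by blast
    have lh: "\<nu> \<bullet> land x = h" "\<nu>' \<bullet> land x = h'"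
      using xh \<sigma>_pos by (simp_all add: land_def inner_add_right inner_commute[of \<nu>'] \<sigma>_def)
    have lF: "land x \<in> F" using lh \<delta>(2)[OF x(2)] by (intro d1(2)) auto
    have mE: "midpoint x (land x) \<in> E"
      using xh lh \<delta>(2)[OF x(2)] by (intro d2(2)) (auto simp: midpoint_def inner_add_right)
    have seg: "open_segment x (land x) \<subseteq> E"
      using segment_into_face_midpoint[OF E mE xE] lF FE by blast
    have R: "face_reeb X E = (2 / h) *\<^sub>R (quat_i *v \<nu>)" using facet(7)[OF E] by (simp add: h_def \<nu>_def)
    define t where "t = ((h' - \<nu>' \<bullet> x) / \<sigma>) * (h / 2)"
    have t: "t > 0" "land x = x + t *\<^sub>R face_reeb X E"
      using h_pos \<sigma>_pos \<delta>(2)[OF x(2)] by (auto simp: t_def land_def R)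
    have "flow_map X E F x = land x"
      unfolding flow_map_def
    proof (rule the_equality)
      show "land x \<in> F \<and> open_segment x (land x) \<subseteq> E \<and> (\<exists>t>0. land x = x + t *\<^sub>R face_reeb X E)"
        using lF seg t by blast
      fix y assume "y \<in> F \<and> open_segment x y \<subseteq> E \<and> (\<exists>t>0. y = x + t *\<^sub>R face_reeb X E)"
      then obtain s where s: "y \<in> F" "y = x + s *\<^sub>R face_reeb X E" by blast
      have "\<nu>' \<bullet> (x + s *\<^sub>R face_reeb X E) = \<nu>' \<bullet> (x + t *\<^sub>R face_reeb X E)"
        using s on_F lh(2) t(2) by metis
      then have "s * (2 / h) * \<sigma> = t * (2 / h) * \<sigma>"
        by (simp add: R inner_add_right inner_commute[of \<nu>'] \<sigma>_def)
      then have "s = t" using h_pos \<sigma>_pos by simp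
      then show "y = land x" using s t by simp
    qed
    then show "flow_map X E F x = land x \<and> land x \<in> F" using lF by blast
  qed
qed

end

context sympl_polytope
begin

text \<open>A boundary point lies in a proper face, of dimension at most \<open>k - 1\<close>; off
  the 1-skeleton that dimension is at least 2. With \<open>k\<close> at most 3 there is no room
  left.\<close>

lemma boundary_point_dim2:
  assumes k: "kface X k G" "k \<le> 3" and p: "p \<in> rel_frontier (closure G)" "p \<notin> one_skeleton X"
  shows "k = 3 \<and> kface X 2 (face_at X p) \<and> p \<in> face_at X p"
proof -
  note r = kface_rel_interior[OF convex_X compact_X k(1)]
  have poly: "polyhedron (closure G)" using r(1) polyhedron_X face_of_polyhedron_polyhedron by blast
  then obtain H where H: "H facet_of closure G" "p \<in> H" using p(1) rel_frontier_of_polyhedron by blast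
  then have Hf: "H face_of closure G" "aff_dim H = int k - 1" using r(3) by (auto simp: facet_of_def)
  have "polyhedron H" using poly Hf face_of_polyhedron_polyhedron by blast
  then obtain G' where G': "G' face_of H" "p \<in> rel_interior G'" using face_containing_point H(2) by metis
  have fX: "G' face_of X" using G' Hf r(1) face_of_trans by blast
  have le: "aff_dim G' \<le> int k - 1" using aff_dim_subset[OF face_of_imp_subset[OF G'(1)]] Hf by simp
  then have "G' \<noteq> X" using aff_dim_X k by auto
  have "G' \<noteq> {}" using G'(2) rel_interior_subset by blast
  then have "aff_dim G' \<ge> 0" using aff_dim_geq[of G'] aff_dim_empty[of G'] by (cases "aff_dim G' = -1") auto
  then obtain j where j: "aff_dim G' = int j" by (metis nonneg_int_cases)
  have kj: "kface X j (rel_interior G')" using fX \<open>G' \<noteq> X\<close> j by (auto simp: kface_def)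
  have "\<not> (kface X 0 (rel_interior G') \<or> kface X 1 (rel_interior G'))"
    using G'(2) p(2) unfolding one_skeleton_def by blast
  then have "j \<noteq> 0" "j \<noteq> 1" using kj by metis+
  then have "k = 3" "j = 2" using le j k by auto
  then show ?thesis using face_at_eq[OF kface_is_face[OF kj] G'(2)] kj G'(2) by simp
qed

end

section \<open>Type 1 orbits and the orbits of the smoothing\<close>

lemma in_open_segment_ray:
  fixes a :: "'a::real_vector"
  assumes "b = a + l *\<^sub>R v" "0 < t" "t < l" "v \<noteq> 0"
  shows "a + t *\<^sub>R v \<in> open_segment a b"
  unfolding in_segment
  using assms by (intro conjI exI[of _ "t / l"]) (auto simp: algebra_simps)

locale comb_orbit = sympl_polytope +
  fixes \<gamma> :: "seg list"
  assumes orbit: "comb_reeb_orbit X \<gamma>" and type1: "type1 X \<gamma>"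
begin

text \<open>The endpoints are boundary points off the 1-skeleton, so the face of a segment in a Type
  1 orbit is a 3-face and the endpoints lie in 2-faces.\<close>

lemma segment_props:
  assumes s: "(a, b) \<in> set \<gamma>"
  defines "G \<equiv> seg_face X (a, b)" and "l \<equiv> seg_time X (a, b)"
  shows "kface X 3 G" "open_segment a b \<subseteq> G" "a \<in> closure G" "b \<in> closure G" "l > 0"
    "b = a + l *\<^sub>R face_reeb X G" "kface X 2 (face_at X a)" "a \<in> face_at X a"
    "kface X 2 (face_at X b)" "b \<in> face_at X b" "a \<noteq> b"
proof -
  have "a \<noteq> b \<and> closed_segment a b \<subseteq> frontier X \<and> (\<exists>F. is_face X F \<and> open_segment a b \<subseteq> F \<and>
             a \<in> rel_frontier (closure F) \<and> b \<in> rel_frontier (closure F) \<and> b - a \<in> face_reeb_cone X F)"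
    using orbit s unfolding comb_reeb_orbit_def by fast
  then obtain F where ab: "a \<noteq> b" and F: "is_face X F" "open_segment a b \<subseteq> F"
     "a \<in> rel_frontier (closure F)" "b \<in> rel_frontier (closure F)" "b - a \<in> face_reeb_cone X F" by blast
  obtain k where k: "kface X k F" using F(1) unfolding is_face_def by blast
  have "closed_segment a b \<inter> one_skeleton X = {}" using type1 s unfolding type1_def by fast
  then have sk: "a \<notin> one_skeleton X" "b \<notin> one_skeleton X" by auto
  note A = boundary_point_dim2[OF k kface_dim[OF k] F(3) sk(1)]
  note B = boundary_point_dim2[OF k kface_dim[OF k] F(4) sk(2)]
  have k3: "kface X 3 F" using A k by simp
  have mid: "midpoint a b \<in> open_segment a b" using ab by simp
  have G: "G = F"
    unfolding G_def seg_face_def fst_conv snd_conv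
    by (rule the_equality) (use F mid face_unique in blast)+
  show "kface X 3 G" "open_segment a b \<subseteq> G" "a \<noteq> b" using k3 F ab G by auto
  have "closure F face_of X" "closed (closure F)" using kface_rel_interior[OF convex_X compact_X k] by auto
  then show "a \<in> closure G" "b \<in> closure G" using F(3,4) G by (auto simp: rel_frontier_def)
  show "kface X 2 (face_at X a)" "a \<in> face_at X a" "kface X 2 (face_at X b)" "b \<in> face_at X b"
    using A B by auto
  obtain y0 where y0: "y0 \<in> F" using kface_rel_interior(6)[OF convex_X compact_X k] by blast
  \<comment> \<open>The normal cone of a 3-face is a ray, so \<open>b - a\<close> is a positive
    multiple of the Reeb vector; the factor is the time of traversal.\<close>
  then obtain v where v: "b - a = quat_i *v v" using F(5) by (auto simp: face_reeb_cone_def reeb_cone_def)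
  have "v \<in> normal_cone X y" if "y \<in> F" for y
    using F(5) that by (auto simp: face_reeb_cone_def reeb_cone_def v)
  then have "v \<in> face_normal_cone X F" by (auto simp: face_normal_cone_def)
  then obtain s where s: "v = s *\<^sub>R face_normal X F" "s \<ge> 0" using facet(6)[OF k3] by blast
  have "s \<noteq> 0" using v s ab by auto
  then have s0: "s > 0" using s by simp
  have n: "norm (face_normal X F) = 1" "height F > 0" using facet[OF k3] by auto
  have R: "face_reeb X F = (2 / height F) *\<^sub>R (quat_i *v face_normal X F)" by (rule facet(7)[OF k3])
  have l: "l = s * height F / 2"
    using n s0 by (simp add: l_def seg_time_def G_def[symmetric] G v s R matrix_vector_mult_scaleR)
  show "l > 0" unfolding l using n s0 by simp
  have "b - a = l *\<^sub>R face_reeb X G"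
    using n by (simp add: G R l v s matrix_vector_mult_scaleR)
  then show "b = a + l *\<^sub>R face_reeb X G" by (simp add: algebra_simps)
qed

lemma consecutive_corner:
  assumes s: "(a, b) \<in> set \<gamma>" "(b, c) \<in> set \<gamma>"
  shows "corner X (seg_face X (a, b)) (seg_face X (b, c)) (face_at X b)"
    "exit_face X (face_at X b) = seg_face X (b, c)"
proof -
  define E where "E = seg_face X (a, b)"
  define E' where "E' = seg_face X (b, c)"
  note A = segment_props[OF s(1), folded E_def] and B = segment_props[OF s(2), folded E'_def]
  note rE = kface_rel_interior[OF convex_X compact_X A(1)]
  have FE: "face_at X b \<subseteq> closure E"
    using subset_closure_facet[OF A(9) A(1) A(10) A(4)] closure_subset by blast
  have FE': "face_at X b \<subseteq> closure E'"
    using subset_closure_facet[OF B(7) B(1) B(8) B(3)] closure_subset by blast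
  have R: "face_reeb X E = (2 / height E) *\<^sub>R (quat_i *v face_normal X E)" by (rule facet(7)[OF A(1)])
  have h: "height E > 0" "height E' > 0" using facet(2) A(1) B(1) by auto
  have R0: "face_reeb X E \<noteq> 0"
    using A(6,11) by auto
  have ne: "E \<noteq> E'"
  proof
    assume eq: "E = E'"
    \<comment> \<open>If the two 3-faces agreed, \<open>b\<close> would be the midpoint of two
      points of \<open>E\<close> and so belong to \<open>E\<close>, although it lies in a
      2-face.\<close>
    define u where "u = min (seg_time X (a, b)) (seg_time X (b, c)) / 2"
    have u: "0 < u" "u < seg_time X (a, b)" "u < seg_time X (b, c)" using A(5) B(5) by (auto simp: u_def)
    have "b + u *\<^sub>R face_reeb X E \<in> E"
      using in_open_segment_ray[OF B(6) u(1,3)] B(2) R0 eq by auto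
    moreover have "a + (seg_time X (a, b) - u) *\<^sub>R face_reeb X E \<in> E"
      using in_open_segment_ray[OF A(6), of "seg_time X (a, b) - u"] A(2) R0 u by auto
    then have "b - u *\<^sub>R face_reeb X E \<in> E" by (subst A(6)) (simp add: algebra_simps)
    ultimately have "(1/2) *\<^sub>R (b - u *\<^sub>R face_reeb X E) + (1/2) *\<^sub>R (b + u *\<^sub>R face_reeb X E) \<in> E"
      using rE(5) by (intro convexD) auto
    then have "b \<in> E" by (simp add: scaleR_add_right scaleR_diff_right flip: scaleR_add_left)
    then have "face_at X b = E" by (intro face_at_eq kface_is_face[OF A(1)])
    then show False using kface_rel_interior(3)[OF convex_X compact_X A(9)] rE(3) by simp
  qed
  have ind: "\<bar>face_normal X E \<bullet> face_normal X E'\<bar> < 1"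
    by (rule facet_normals_independent[OF A(1) B(1) A(4) B(3) ne])
  have on: "face_normal X E \<bullet> x = height E \<and> face_normal X E' \<bullet> x = height E'" if "x \<in> face_at X b" for x
    using that FE FE' facet(4)[OF A(1)] facet(4)[OF B(1)] by blast
  have nz: "(quat_i *v face_normal X E) \<bullet> face_normal X E' \<noteq> 0"
    using on by (intro ridge_symplectic(3)[OF A(9) facet(1)[OF A(1)] facet(1)[OF B(1)] ind, of "height E" "height E'"]) auto
  \<comment> \<open>Sign of the flux: \<open>a\<close> is on the inner side of the hyperplane of
    \<open>E'\<close>, and the Reeb segment starting at \<open>a\<close> ends on that
    hyperplane.\<close>
  have "a \<in> X" using A(3) kface_rel_interior(8)[OF convex_X compact_X A(1)] by blast
  then have "face_normal X E' \<bullet> a \<le> height E'" by (rule facet(3)[OF B(1)])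
  also have "height E' = face_normal X E' \<bullet> b" using on A(10) by simp
  also have "\<dots> = face_normal X E' \<bullet> a + seg_time X (a, b) * (2 / height E) * ((quat_i *v face_normal X E) \<bullet> face_normal X E')"
    by (subst A(6)) (simp add: R inner_add_right inner_commute)
  finally have "0 \<le> seg_time X (a, b) * (2 / height E) * ((quat_i *v face_normal X E) \<bullet> face_normal X E')" by simp
  then have "0 < (quat_i *v face_normal X E) \<bullet> face_normal X E'"
    using nz A(5) h by (simp add: zero_le_mult_iff zero_le_divide_iff)
  then interpret c: corner X E E' "face_at X b"
    using A(1,9) B(1) FE FE' by unfold_locales auto
  show "corner X (seg_face X (a, b)) (seg_face X (b, c)) (face_at X b)"
    using c.corner_axioms by (simp add: E_def E'_def)
  have R0': "face_reeb X E' \<noteq> 0" using B(6,11) by auto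
  show "exit_face X (face_at X b) = seg_face X (b, c)"
    unfolding E'_def[symmetric]
    by (rule c.exit_face_eq[OF A(10) B(5)]) (use in_open_segment_ray[OF B(6)] B(2) R0' in blast)
qed

definition "k = length \<gamma>"
text \<open>Indices run through all natural numbers with period \<open>k\<close>, so the cyclic
  successor is \<open>Suc\<close>.\<close>

definition "sg i = \<gamma> ! (i mod k)"
definition "p i = fst (sg i)"
definition "En i = seg_face X (sg i)"
definition "Fn i = face_at X (p i)"
definition "len i = seg_time X (sg i)"

lemma k_pos: "k > 0" using orbit by (simp add: comb_reeb_orbit_def k_def)

lemma sg_in: "sg i \<in> set \<gamma>" using k_pos by (simp add: sg_def k_def)

lemma snd_sg: "snd (sg i) = p (Suc i)"
proof -
  have "snd (\<gamma> ! (i mod k)) = fst (\<gamma> ! (Suc (i mod k) mod k))"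
    using orbit k_pos by (simp add: comb_reeb_orbit_def k_def)
  then show ?thesis by (simp add: sg_def p_def mod_Suc_eq)
qed

lemma sg_eq: "sg i = (p i, p (Suc i))"
  using snd_sg by (simp add: p_def prod_eq_iff)

lemma periodic: "sg (i + k) = sg i" "p (i + k) = p i" "En (i + k) = En i" "Fn (i + k) = Fn i" "len (i + k) = len i"
  by (simp_all add: sg_def p_def En_def Fn_def len_def)

lemma sg_props: "kface X 3 (En i)" "open_segment (p i) (p (Suc i)) \<subseteq> En i" "p i \<in> closure (En i)"
    "p (Suc i) \<in> closure (En i)" "len i > 0" "p (Suc i) = p i + len i *\<^sub>R face_reeb X (En i)"
    "kface X 2 (Fn i)" "p i \<in> Fn i" "p i \<noteq> p (Suc i)"
  using segment_props[of "p i" "p (Suc i)"] sg_in[of i] by (simp_all add: sg_eq En_def len_def Fn_def)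

lemma corner_at: "corner X (En i) (En (Suc i)) (Fn (Suc i))"
  and exit_face_Suc: "exit_face X (Fn (Suc i)) = En (Suc i)"
  using consecutive_corner[of "p i" "p (Suc i)" "p (Suc (Suc i))"] sg_in[of i] sg_in[of "Suc i"]
  by (simp_all add: sg_eq En_def Fn_def)

text \<open>Shifting by the period makes every index a successor, including 0. The same device
  provides the preceding corner below.\<close>

lemma exit_face_at: "exit_face X (Fn i) = En i"
  using exit_face_Suc[of "i + k - 1"] k_pos by (simp add: periodic)

sublocale crn: corner X "En i" "En (Suc i)" "Fn (Suc i)" for i
  by (rule corner_at)

lemma \<nu>'_eq: "crn.\<nu>' i = crn.\<nu> (Suc i)" and h'_eq: "crn.h' i = crn.h (Suc i)"
  by (simp_all add: crn.\<nu>'_def crn.\<nu>_def crn.h'_def crn.h_def)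

lemma periodic_corner: "crn.\<nu> (i + k) = crn.\<nu> i" "crn.h (i + k) = crn.h i" "crn.land (i + k) = crn.land i"
  "crn.landl (i + k) = crn.landl i" "crn.dd (i + k) = crn.dd i" "crn.\<alpha> (i + k) = crn.\<alpha> i" "crn.\<sigma> (i + k) = crn.\<sigma> i"
  "crn.c (i + k) = crn.c i" "crn.N (i + k) = crn.N i"
  using periodic(3,4)[of i] periodic(3,4)[of "Suc i"] by simp_all

lemma reeb_face: "face_reeb X (En i) = (2 / crn.h i) *\<^sub>R (quat_i *v crn.\<nu> i)"
  using facet(7)[OF sg_props(1)] by (simp add: crn.h_def crn.\<nu>_def)

lemma Fn_on: "x \<in> Fn i \<Longrightarrow> crn.\<nu> i \<bullet> x = crn.h i"
proof -
  assume "x \<in> Fn i"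
  then have "x \<in> closure (En i)"
    using subset_closure_facet[OF sg_props(7) sg_props(1) sg_props(8) sg_props(3)] closure_subset by blast
  then show ?thesis by (rule crn.on_E)
qed

lemma gap: "(crn.h (Suc i) - crn.\<nu> (Suc i) \<bullet> p i) / crn.\<sigma> i = len i * (2 / crn.h i)"
proof -
  have "crn.h (Suc i) = crn.\<nu> (Suc i) \<bullet> p (Suc i)" using Fn_on[OF sg_props(8)] by simp
  also have "\<dots> = crn.\<nu> (Suc i) \<bullet> p i + len i * (2 / crn.h i) * crn.\<sigma> i"
    by (subst sg_props(6)) (simp add: reeb_face inner_add_right crn.\<sigma>_def \<nu>'_eq inner_commute)
  finally show ?thesis using crn.\<sigma>_pos[of i] by simp
qed

lemma land_p: "crn.land i (p i) = p (Suc i)"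
  using gap[of i] sg_props(6)[of i] by (simp add: crn.land_def \<nu>'_eq h'_eq reeb_face)

lemma seg_flow_land:
  obtains \<delta> where "\<delta> > 0"
    "\<And>x. x \<in> Fn i \<Longrightarrow> dist x (p i) < \<delta> \<Longrightarrow> seg_flow X (sg i) x = crn.land i x \<and> crn.land i x \<in> Fn (Suc i)"
proof -
  have G: "Fn i \<subseteq> closure (En i)"
    using subset_closure_facet[OF sg_props(7) sg_props(1) sg_props(8) sg_props(3)] closure_subset by blast
  have mid: "midpoint (p i) (crn.land i (p i)) \<in> En i"
    using sg_props(2,9)[of i] by (auto simp: land_p)
  have "0 < (crn.h (Suc i) - crn.\<nu> (Suc i) \<bullet> p i) / crn.\<sigma> i"
    unfolding gap using sg_props(5)[of i] crn.h_pos(1)[of i] by simp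
  then have pos: "crn.\<nu>' i \<bullet> p i < crn.h' i"
    using crn.\<sigma>_pos[of i] by (simp add: \<nu>'_eq h'_eq zero_less_divide_iff)
  have "seg_flow X (sg i) = flow_map X (En i) (Fn (Suc i))"
    by (simp add: seg_flow_def En_def Fn_def snd_sg)
  then show thesis
    using crn.flow_map_eq_land[OF G sg_props(8) _ mid pos] land_p sg_props(8) that by metis
qed

fun Land :: "nat \<Rightarrow> real^4 \<Rightarrow> real^4" where
  "Land 0 v = v"
| "Land (Suc j) v = crn.landl j (Land j v)"

lemma bounded_linear_Land: "bounded_linear (Land j)"
proof (induction j)
  case 0
  have "Land 0 = (\<lambda>v. v)" by (rule ext) simp
  then show ?case using bounded_linear_ident by simp
next
  case (Suc j)
  have "Land (Suc j) = (\<lambda>v. crn.landl j (Land j v))" by (rule ext) simp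
  then show ?case using bounded_linear_compose[OF crn.bounded_linear_landl Suc] by simp
qed

lemma tangent_Fn: "tangent_space (Fn (Suc i)) = {v. crn.\<nu> i \<bullet> v = 0 \<and> crn.\<nu> (Suc i) \<bullet> v = 0}"
  using crn.tangent_F[of i] by (simp add: \<nu>'_eq)

lemma tangent_Fn_normal: "v \<in> tangent_space (Fn i) \<Longrightarrow> crn.\<nu> i \<bullet> v = 0"
  using tangent_Fn[of "i + k - 1"] k_pos by (simp add: periodic periodic_corner)

lemma Land_tangent: "v \<in> tangent_space (Fn 0) \<Longrightarrow> Land j v \<in> tangent_space (Fn j)"
  by (induction j) (auto intro: crn.landl_tangent tangent_Fn_normal)

lemma open_Fn:
  assumes "v \<in> tangent_space (Fn i)"
  obtains \<delta> where "\<delta> > 0" "\<And>t. \<bar>t\<bar> < \<delta> \<Longrightarrow> p i + t *\<^sub>R v \<in> Fn i"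
proof -
  define j where "j = i + k - 1"
  have j: "Fn (Suc j) = Fn i" "p (Suc j) = p i" using k_pos by (simp_all add: j_def periodic)
  obtain d where d: "d > 0" "\<And>z. crn.\<nu> j \<bullet> z = crn.h j \<Longrightarrow> crn.\<nu>' j \<bullet> z = crn.h' j \<Longrightarrow> dist z (p i) < d \<Longrightarrow> z \<in> Fn i"
    using crn.open_F[of "p i" j] sg_props(8)[of i] j by metis
  show thesis
  proof (rule that[of "d / (norm v + 1)"])
    fix t assume t: "\<bar>t\<bar> < d / (norm v + 1)"
    have pos: "norm v + 1 > 0" by (simp add: add_nonneg_pos)
    have "\<bar>t\<bar> * norm v \<le> \<bar>t\<bar> * (norm v + 1)" by (intro mult_left_mono) auto
    also have "\<dots> < d" using t pos by (simp add: pos_less_divide_eq)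
    finally have "dist (p i + t *\<^sub>R v) (p i) < d" by (simp add: dist_norm)
    moreover have "crn.\<nu> j \<bullet> v = 0" "crn.\<nu>' j \<bullet> v = 0" using assms crn.tangent_F[of j] j by auto
    ultimately show "p i + t *\<^sub>R v \<in> Fn i"
      using crn.on_F[of "p i" j] sg_props(8)[of i] j by (intro d(2)) (auto simp: inner_add_right)
  qed (use d in \<open>simp add: add_nonneg_pos\<close>)
qed

text \<open>Each flow map is known to be affine only near the orbit. The neighbourhood shrinks at
  every step by the operator bound of the linear part accumulated so far.\<close>

lemma fold_seg_flow_near:
  assumes "j \<le> k"
  shows "\<exists>\<delta>>0. \<forall>x\<in>Fn 0. dist x (p 0) < \<delta> \<longrightarrow>
    fold (seg_flow X) (take j \<gamma>) x = p j + Land j (x - p 0) \<and> fold (seg_flow X) (take j \<gamma>) x \<in> Fn j"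
  using assms
proof (induction j)
  case 0
  then show ?case by (auto intro!: exI[of _ 1])
next
  case (Suc j)
  then obtain d where d: "d > 0" "\<And>x. x \<in> Fn 0 \<Longrightarrow> dist x (p 0) < d \<Longrightarrow>
    fold (seg_flow X) (take j \<gamma>) x = p j + Land j (x - p 0) \<and> fold (seg_flow X) (take j \<gamma>) x \<in> Fn j" by auto
  obtain e where e: "e > 0" "\<And>x. x \<in> Fn j \<Longrightarrow> dist x (p j) < e \<Longrightarrow> seg_flow X (sg j) x = crn.land j x \<and> crn.land j x \<in> Fn (Suc j)"
    using seg_flow_land[of j] by metis
  obtain B where B: "B > 0" "\<And>v. norm (Land j v) \<le> norm v * B"
    using bounded_linear.pos_bounded[OF bounded_linear_Land] by blast
  have tk: "take (Suc j) \<gamma> = take j \<gamma> @ [sg j]"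
    using Suc.prems by (simp add: take_Suc_conv_app_nth k_def sg_def)
  show ?case
  proof (intro exI[of _ "min d (e / B)"] conjI ballI impI)
    fix x assume x: "x \<in> Fn 0" "dist x (p 0) < min d (e / B)"
    define y where "y = fold (seg_flow X) (take j \<gamma>) x"
    have y: "y = p j + Land j (x - p 0)" "y \<in> Fn j" using d(2)[of x] x by (auto simp: y_def)
    have "dist y (p j) \<le> norm (x - p 0) * B" using B(2)[of "x - p 0"] by (simp add: y(1) dist_norm)
    also have "\<dots> < e" using x B(1) by (simp add: dist_norm field_simps)
    finally have "seg_flow X (sg j) y = crn.land j y \<and> crn.land j y \<in> Fn (Suc j)" using e(2) y(2) by blast
    moreover have "crn.land j y = p (Suc j) + Land (Suc j) (x - p 0)"
      using crn.land_eq[of j y "p j"] land_p[of j] y(1) by simp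
    ultimately show "fold (seg_flow X) (take (Suc j) \<gamma>) x = p (Suc j) + Land (Suc j) (x - p 0)"
      "fold (seg_flow X) (take (Suc j) \<gamma>) x \<in> Fn (Suc j)"
      by (simp_all add: tk y_def)
  qed (use d e B in auto)
qed

lemma fold_seg_flow_derivative:
  "(fold (seg_flow X) \<gamma> has_derivative Land k) (at (p 0) within Fn 0)"
proof -
  obtain d where d: "d > 0" "\<And>x. x \<in> Fn 0 \<Longrightarrow> dist x (p 0) < d \<Longrightarrow>
    fold (seg_flow X) \<gamma> x = p k + Land k (x - p 0)"
    using fold_seg_flow_near[of k] by (auto simp: k_def)
  have "((\<lambda>x. p k + Land k (x - p 0)) has_derivative Land k) (at (p 0) within Fn 0)"
    by (auto intro!: derivative_eq_intros bounded_linear.has_derivative[OF bounded_linear_Land])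
  then show ?thesis
    by (rule has_derivative_transform_within[OF _ d(1) sg_props(8)]) (use d(2) in simp)
qed

text \<open>\<open>comb_nondegenerate\<close> speaks of some derivative within the 2-face; on
  vectors tangent to the 2-face it agrees with \<open>Land k\<close>.\<close>

lemma Land_no_fixed_vector:
  assumes nd: "comb_nondegenerate X \<gamma>" and v: "v \<in> tangent_space (Fn 0)" "Land k v = v"
  shows "v = 0"
proof -
  have p0: "p 0 = fst (hd \<gamma>)" using k_pos by (simp add: p_def sg_def k_def hd_conv_nth)
  obtain L where L: "(fold (seg_flow X) \<gamma> has_derivative L) (at (p 0) within Fn 0)"
    "\<not> (\<exists>v \<in> tangent_space (Fn 0). v \<noteq> 0 \<and> L v = v)"
    using nd unfolding comb_nondegenerate_def Let_def p0[symmetric] Fn_def[symmetric] by blast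
  obtain \<delta> where \<delta>: "\<delta> > 0" "\<And>t. \<bar>t\<bar> < \<delta> \<Longrightarrow> p 0 + t *\<^sub>R v \<in> Fn 0" using open_Fn[OF v(1)] by metis
  have "L v = Land k v" by (rule has_derivative_within_unique_direction[OF L(1) fold_seg_flow_derivative \<delta>])
  then show ?thesis using L(2) v by auto
qed

text \<open>\<open>off y j\<close> is the displacement, relative to \<open>p j\<close> and in units of \<open>\<epsilon>\<close>, with which the orbit of
  the smoothing leaves the face \<open>Fn j\<close>; the fixed point equation makes it periodic.\<close>

fun off :: "real^4 \<Rightarrow> nat \<Rightarrow> real^4" where
  "off y 0 = y"
| "off y (Suc j) = crn.landl j (off y j) + crn.dd j (crn.\<alpha> j)"

lemma off_affine: "off y j = Land j y + off 0 j"
proof (induction j)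
  case 0 then show ?case by simp
next
  case (Suc j)
  then show ?case using linear_add[OF bounded_linear.linear[OF crn.bounded_linear_landl[of j]]] by (simp add: add.assoc)
qed

lemma subspace_tangent: "subspace (tangent_space F)"
  by (simp add: tangent_space_def)

lemma off_tangent: "y \<in> tangent_space (Fn 0) \<Longrightarrow> off y j \<in> tangent_space (Fn j)"
proof (induction j)
  case (Suc j)
  then have "crn.landl j (off y j) \<in> tangent_space (Fn (Suc j))"
    by (intro crn.landl_tangent tangent_Fn_normal)
  moreover have "crn.dd j (crn.\<alpha> j) \<in> tangent_space (Fn (Suc j))"
    by (rule crn.dd_tangent) (use crn.\<alpha>(1)[of j] in auto)
  ultimately show ?case using subspace_add[OF subspace_tangent] by simp
qed auto

text \<open>By nondegeneracy \<open>U\<close>, the identity minus the linear return map, is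
  injective on the tangent plane, hence onto. This solves the affine equation, which is free of
  \<open>\<epsilon>\<close> because displacements are measured in units of
  \<open>\<epsilon>\<close>.\<close>

lemma fixed_offset:
  assumes nd: "comb_nondegenerate X \<gamma>"
  obtains y where "y \<in> tangent_space (Fn 0)" "off y k = y"
proof -
  define T where "T = tangent_space (Fn 0)"
  define U where "U v = v - Land k v" for v
  have sT: "subspace T" by (simp add: T_def subspace_tangent)
  have Fk: "Fn k = Fn 0" using periodic(4)[of 0] by simp
  have lin: "linear U"
    using bounded_linear_sub[OF bounded_linear_ident bounded_linear_Land[of k]]
    by (simp add: U_def[abs_def] bounded_linear.linear)
  have UT: "U ` T \<subseteq> T"
    using Land_tangent[of _ k] subspace_diff[OF sT] by (auto simp: U_def T_def Fk)
  have inj: "inj_on U (span T)"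
  proof (rule inj_onI)
    fix v w assume "v \<in> span T" "w \<in> span T" "U v = U w"
    then have vw: "v - w \<in> T" "U (v - w) = 0"
      using sT subspace_diff linear_diff[OF lin] by (auto simp: span_eq_iff[THEN iffD2, OF sT])
    then have "Land k (v - w) = v - w" by (simp add: U_def)
    then have "v - w = 0" using Land_no_fixed_vector[OF nd, of "v - w"] vw unfolding T_def by blast
    then show "v = w" by simp
  qed
  have "U ` T = T"
    by (rule subspace_dim_equal) (use linear_subspace_image[OF lin sT] sT UT dim_image_eq[OF lin inj] in auto)
  moreover have "off 0 k \<in> T"
    using off_tangent[of 0 k] subspace_0[OF sT] by (simp add: T_def Fk)
  ultimately obtain y where y: "y \<in> T" "U y = off 0 k" by (metis imageE)
  then have "off y k = y" using off_affine[of y k] by (simp add: U_def algebra_simps)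
  then show thesis using that y by (simp add: T_def)
qed

lemma off_periodic:
  assumes "off y k = y"
  shows "off y (j + k) = off y j"
  using assms periodic_corner by (induction j) simp_all

end

lemma periodic_all:
  fixes k :: nat
  assumes k: "k > 0" and step: "\<And>i. P (i + k) \<longleftrightarrow> P i" and all: "\<And>i. i < k \<Longrightarrow> P i"
  shows "P i"
proof (induction i rule: less_induct)
  case (less i)
  show ?case
  proof (cases "i < k")
    case False
    then show ?thesis using less[of "i - k"] step[of "i - k"] k by simp
  qed (rule all)
qed

context corner
begin

lemma continuous_dd: "continuous_on {0..\<alpha>} dd"
proof -
  have "continuous_on {0..\<alpha>} N"
    using has_vector_derivative_continuous[OF N_derivative] by (simp add: continuous_at_imp_continuous_on)
  then have "continuous_on {0..\<alpha>} (\<lambda>\<theta>. quat_i *v N \<theta>)"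
    by (rule bounded_linear.continuous_on[OF matrix_vector_mul_bounded_linear])
  then show ?thesis unfolding dd_def[abs_def] n_def
    by (intro continuous_intros continuous_cl)
qed

lemma dd_bound: obtains B where "B > 0" "\<And>\<theta>. \<theta> \<in> {0..\<alpha>} \<Longrightarrow> norm (dd \<theta>) \<le> B"
proof -
  have "bounded (dd ` {0..\<alpha>})"
    using compact_continuous_image[OF continuous_dd compact_Icc] by (rule compact_imp_bounded)
  then show thesis using that unfolding bounded_pos by blast
qed

lemma land_ray: "land (w + s *\<^sub>R (quat_i *v \<nu>)) = land w"
proof -
  have *: "(h' - \<nu>' \<bullet> (w + s *\<^sub>R (quat_i *v \<nu>))) / \<sigma> = (h' - \<nu>' \<bullet> w) / \<sigma> - s"
    using \<sigma>_pos by (simp add: inner_add_right inner_commute[of \<nu>'] \<sigma>_def diff_divide_distrib add_divide_distrib)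
  show ?thesis unfolding land_def * by (simp add: algebra_simps)
qed

end

section \<open>Data of the perturbed orbit, and their limits\<close>

locale nondegenerate_orbit = comb_orbit +
  assumes nd: "comb_nondegenerate X \<gamma>"
begin

text \<open>Nondegeneracy leaves exactly one such \<open>y\<close>, so this choice singles out a
  distinguished orbit.\<close>

definition "Y i = off (SOME y. y \<in> tangent_space (Fn 0) \<and> off y k = y) i"

lemma Y_tangent: "Y i \<in> tangent_space (Fn i)" and Y_Suc: "Y (Suc i) = crn.landl i (Y i) + crn.dd i (crn.\<alpha> i)"
  and Y_periodic: "Y (i + k) = Y i"
proof -
  define y where "y = (SOME y. y \<in> tangent_space (Fn 0) \<and> off y k = y)"
  have "y \<in> tangent_space (Fn 0) \<and> off y k = y"
    unfolding y_def by (rule someI_ex) (use fixed_offset[OF nd] in blast)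
  then show "Y i \<in> tangent_space (Fn i)" "Y (Suc i) = crn.landl i (Y i) + crn.dd i (crn.\<alpha> i)" "Y (i + k) = Y i"
    using off_tangent off_periodic by (auto simp: Y_def y_def[symmetric])
qed

text \<open>The orbit of the smoothing crosses the flat part over \<open>En i\<close> in time \<open>2 * hflat i \<epsilon>\<close>, halfway passing over
  \<open>mm i \<epsilon>\<close>, and then the part over \<open>Fn (Suc i)\<close> in time \<open>arcd i \<epsilon>\<close>. It is cut at the points over \<open>mm i \<epsilon>\<close>,
  where the Reeb field is locally constant, so the time \<open>tt i \<epsilon>\<close> is counted from the one over \<open>mm 0 \<epsilon>\<close>.\<close>

definition "\<tau> i \<epsilon> = (crn.h (Suc i) - crn.\<nu> (Suc i) \<bullet> (p i + \<epsilon> *\<^sub>R Y i)) / crn.\<sigma> i"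
definition "mm i \<epsilon> = p i + \<epsilon> *\<^sub>R Y i + (\<tau> i \<epsilon> / 2) *\<^sub>R (quat_i *v crn.\<nu> i)"
definition "hflat i \<epsilon> = \<tau> i \<epsilon> * (crn.h i + \<epsilon>) / 4"
definition "arcd i \<epsilon> = (\<epsilon> / (2 * crn.c i)) * (crn.N i (crn.\<alpha> i) \<bullet> p (Suc i) + \<epsilon> * crn.\<alpha> i)"
definition "D i \<epsilon> = hflat i \<epsilon> + arcd i \<epsilon> + hflat (Suc i) \<epsilon>"
definition "tt i \<epsilon> = (\<Sum>j<i. D j \<epsilon>)"

lemma periodic_Suc: "p (Suc (i + k)) = p (Suc i)" "En (Suc (i + k)) = En (Suc i)" "Fn (Suc (i + k)) = Fn (Suc i)"
  using periodic[of "Suc i"] by simp_all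

lemma periodic_flat: "\<tau> (i + k) = \<tau> i" "mm (i + k) = mm i" "hflat (i + k) = hflat i" "arcd (i + k) = arcd i" "D (i + k) = D i"
proof -
  show 1: "\<tau> (i + k) = \<tau> i" for i
    using periodic_corner(1,2)[of "Suc i"] by (simp add: \<tau>_def[abs_def] periodic periodic_Suc Y_periodic)
  show "mm (i + k) = mm i" by (simp add: mm_def[abs_def] 1 periodic periodic_Suc Y_periodic)
  show 3: "hflat (i + k) = hflat i" for i by (simp add: hflat_def[abs_def] 1 periodic_corner)
  show 4: "arcd (i + k) = arcd i"
    by (simp add: arcd_def[abs_def] periodic periodic_Suc)
  show "D (i + k) = D i" using 3[of i] 3[of "Suc i"] 4 by (simp add: D_def[abs_def])
qed

lemma land_mm: "crn.land i (mm i \<epsilon>) = p (Suc i) + \<epsilon> *\<^sub>R crn.landl i (Y i)"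
proof -
  have "crn.land i (mm i \<epsilon>) = crn.land i (p i + \<epsilon> *\<^sub>R Y i)" by (simp add: mm_def crn.land_ray)
  also have "\<dots> = p (Suc i) + crn.landl i (\<epsilon> *\<^sub>R Y i)"
    using crn.land_eq[of i "p i + \<epsilon> *\<^sub>R Y i" "p i"] by (simp add: land_p)
  finally show ?thesis using linear_scale[OF bounded_linear.linear[OF crn.bounded_linear_landl]] by simp
qed

lemma mm_Suc: "mm (Suc i) \<epsilon> = crn.land i (mm i \<epsilon>) + \<epsilon> *\<^sub>R crn.dd i (crn.\<alpha> i)
    + (\<tau> (Suc i) \<epsilon> / 2) *\<^sub>R (quat_i *v crn.\<nu> (Suc i))"
  by (simp add: land_mm) (simp add: mm_def Y_Suc scaleR_add_right add.assoc)

lemma p_on: "crn.\<nu> i \<bullet> p i = crn.h i"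
  by (rule Fn_on[OF sg_props(8)])

lemma mm_on: "crn.\<nu> i \<bullet> mm i \<epsilon> = crn.h i"
  using p_on[of i] tangent_Fn_normal[OF Y_tangent[of i]] by (simp add: mm_def inner_add_right)

lemma \<tau>_0: "\<tau> i 0 = len i * (2 / crn.h i)"
  using gap[of i] by (simp add: \<tau>_def)

lemma mm_0: "mm i 0 = midpoint (p i) (p (Suc i))"
proof -
  have "midpoint (p i) (p (Suc i)) = p i + (1/2) *\<^sub>R (len i *\<^sub>R face_reeb X (En i))"
    by (subst sg_props(6)) (simp add: midpoint_def scaleR_add_right flip: scaleR_add_left add.assoc)
  then show ?thesis by (simp add: mm_def \<tau>_0 reeb_face)
qed

lemma tendsto_\<tau>: "((\<lambda>\<epsilon>. \<tau> i \<epsilon>) \<longlongrightarrow> \<tau> i 0) (at_right 0)"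
proof -
  have "isCont (\<lambda>\<epsilon>. \<tau> i \<epsilon>) 0" unfolding \<tau>_def using crn.\<sigma>_pos[of i] by (intro continuous_intros) auto
  then show ?thesis unfolding isCont_def by (rule filterlim_at_split[THEN iffD1, THEN conjunct2])
qed

lemma tendsto_mm: "((\<lambda>\<epsilon>. mm i \<epsilon>) \<longlongrightarrow> mm i 0) (at_right 0)"
  unfolding mm_def by (intro tendsto_intros tendsto_\<tau>) simp

lemma tendsto_hflat: "((\<lambda>\<epsilon>. hflat i \<epsilon>) \<longlongrightarrow> len i / 2) (at_right 0)"
proof -
  have "((\<lambda>\<epsilon>. hflat i \<epsilon>) \<longlongrightarrow> \<tau> i 0 * (crn.h i + 0) / 4) (at_right 0)"
    unfolding hflat_def by (intro tendsto_intros tendsto_\<tau>) simp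
  moreover have "\<tau> i 0 * (crn.h i + 0) / 4 = len i / 2"
    using crn.h_pos(1)[of i] by (simp add: \<tau>_0)
  ultimately show ?thesis by simp
qed

lemma tendsto_arcd: "((\<lambda>\<epsilon>. arcd i \<epsilon>) \<longlongrightarrow> 0) (at_right 0)"
proof -
  have "((\<lambda>\<epsilon>. arcd i \<epsilon>) \<longlongrightarrow> (0 / (2 * crn.c i)) * (crn.N i (crn.\<alpha> i) \<bullet> p (Suc i) + 0 * crn.\<alpha> i)) (at_right 0)"
    unfolding arcd_def using crn.c_pos[of i] by (intro tendsto_intros) auto
  then show ?thesis by simp
qed

lemma tendsto_tt: "((\<lambda>\<epsilon>. tt i \<epsilon>) \<longlongrightarrow> (\<Sum>j<i. len j / 2 + len (Suc j) / 2)) (at_right 0)"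
proof -
  have "((\<lambda>\<epsilon>. tt i \<epsilon>) \<longlongrightarrow> (\<Sum>j<i. len j / 2 + 0 + len (Suc j) / 2)) (at_right 0)"
    unfolding tt_def D_def by (intro tendsto_intros tendsto_hflat tendsto_arcd)
  then show ?thesis by simp
qed

text \<open>Conditions under which the explicit curve runs over the intended faces. The margin
  \<open>\<delta>\<close>, uniform over the arc, extends this to neighbouring trajectories, as
  differentiating the flow requires.\<close>

definition good_at :: "nat \<Rightarrow> real \<Rightarrow> bool" where
  "good_at i \<epsilon> \<longleftrightarrow> \<tau> i \<epsilon> > 0 \<and> mm i \<epsilon> \<in> En i \<and>
    (\<exists>\<delta>>0. \<forall>\<theta>\<in>{0..crn.\<alpha> i}. \<forall>v\<in>tangent_space (Fn (Suc i)). norm v < \<delta> \<longrightarrow>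
        crn.land i (mm i \<epsilon>) + v + \<epsilon> *\<^sub>R crn.dd i \<theta> \<in> Fn (Suc i))"

lemma good_at_eventually: "\<forall>\<^sub>F \<epsilon> in at_right 0. good_at i \<epsilon>"
proof -
  have "\<tau> i 0 > 0" using sg_props(5)[of i] crn.h_pos(1)[of i] by (simp add: \<tau>_0)
  then have 1: "\<forall>\<^sub>F \<epsilon> in at_right 0. \<tau> i \<epsilon> > 0" using tendsto_\<tau> order_tendstoD(1) by blast
  have "mm i 0 \<in> En i" using sg_props(2,9)[of i] by (auto simp: mm_0)
  then obtain d where d: "d > 0" "\<And>z. crn.\<nu> i \<bullet> z = crn.h i \<Longrightarrow> dist z (mm i 0) < d \<Longrightarrow> z \<in> En i"
    using facet_open[OF sg_props(1)[of i]] unfolding crn.\<nu>_def crn.h_def by metis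
  have "\<forall>\<^sub>F \<epsilon> in at_right 0. dist (mm i \<epsilon>) (mm i 0) < d" using tendsto_mm d(1) by (rule tendstoD)
  then have 2: "\<forall>\<^sub>F \<epsilon> in at_right 0. mm i \<epsilon> \<in> En i"
    by eventually_elim (use d(2) mm_on in blast)
  obtain e where e: "e > 0" "\<And>z. crn.\<nu> i \<bullet> z = crn.h i \<Longrightarrow> crn.\<nu>' i \<bullet> z = crn.h' i \<Longrightarrow> dist z (p (Suc i)) < e \<Longrightarrow> z \<in> Fn (Suc i)"
    using crn.open_F[OF sg_props(8)[of "Suc i"]] by metis
  obtain B where B: "B > 0" "\<And>\<theta>. \<theta> \<in> {0..crn.\<alpha> i} \<Longrightarrow> norm (crn.dd i \<theta>) \<le> B" using crn.dd_bound[of i] by metis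
  \<comment> \<open>\<open>\<epsilon> * C\<close> bounds the displacement from
    \<open>p (Suc i)\<close> during the whole crossing. Keeping it below \<open>e / 2\<close> leaves
    the other half for \<open>v\<close>.\<close>
  define C where "C = norm (crn.landl i (Y i)) + B"
  have C: "C > 0" using B by (simp add: C_def add_nonneg_pos)
  have "((\<lambda>\<epsilon>. \<epsilon> * C) \<longlongrightarrow> 0 * C) (at_right (0::real))" by (intro tendsto_intros)
  then have "\<forall>\<^sub>F \<epsilon> in at_right 0. \<epsilon> * C < e / 2" using e(1) by (intro order_tendstoD(2)) auto
  moreover have "\<forall>\<^sub>F \<epsilon> in at_right (0::real). \<epsilon> > 0" by (rule eventually_at_right_less)
  ultimately have 3: "\<forall>\<^sub>F \<epsilon> in at_right 0. \<exists>\<delta>>0. \<forall>\<theta>\<in>{0..crn.\<alpha> i}. \<forall>v\<in>tangent_space (Fn (Suc i)). norm v < \<delta> \<longrightarrow>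
        crn.land i (mm i \<epsilon>) + v + \<epsilon> *\<^sub>R crn.dd i \<theta> \<in> Fn (Suc i)"
  proof eventually_elim
    case (elim \<epsilon>)
    show ?case
    proof (intro exI[of _ "e / 2"] conjI ballI impI)
      fix \<theta> v assume \<theta>: "\<theta> \<in> {0..crn.\<alpha> i}" and v: "v \<in> tangent_space (Fn (Suc i))" "norm v < e / 2"
      define w where "w = \<epsilon> *\<^sub>R crn.landl i (Y i) + v + \<epsilon> *\<^sub>R crn.dd i \<theta>"
      have l: "crn.landl i (Y i) \<in> tangent_space (Fn (Suc i))"
        by (rule crn.landl_tangent[OF tangent_Fn_normal[OF Y_tangent]])
      have dd: "crn.dd i \<theta> \<in> tangent_space (Fn (Suc i))" using \<theta> by (intro crn.dd_tangent) auto
      have w: "w \<in> tangent_space (Fn (Suc i))" unfolding w_def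
        by (intro subspace_add subspace_scale subspace_tangent l dd v)
      have "norm w \<le> \<epsilon> * norm (crn.landl i (Y i)) + norm v + \<epsilon> * norm (crn.dd i \<theta>)"
        unfolding w_def using elim by (intro order_trans[OF norm_triangle_ineq] add_mono) (auto intro: order_trans[OF norm_triangle_ineq])
      also have "\<dots> \<le> \<epsilon> * C + norm v"
        using B(2)[OF \<theta>] elim by (simp add: C_def algebra_simps mult_left_mono)
      also have "\<dots> < e" using elim v by simp
      finally have "dist (p (Suc i) + w) (p (Suc i)) < e" by (simp add: dist_norm)
      then have "p (Suc i) + w \<in> Fn (Suc i)"
        using w crn.on_F[OF sg_props(8)[of "Suc i"]] crn.tangent_F[of i]
        by (intro e(2)) (auto simp: inner_add_right)
      then show "crn.land i (mm i \<epsilon>) + v + \<epsilon> *\<^sub>R crn.dd i \<theta> \<in> Fn (Suc i)"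
        by (simp add: land_mm w_def add.assoc)
    qed (use e in auto)
  qed
  show ?thesis unfolding good_at_def using 1 2 3 by eventually_elim auto
qed

lemma good_eventually: "\<forall>\<^sub>F \<epsilon> in at_right 0. \<forall>i. good_at i \<epsilon>"
proof -
  have "\<forall>\<^sub>F \<epsilon> in at_right 0. \<forall>i\<in>{..<k}. good_at i \<epsilon>"
    by (intro eventually_ball_finite ballI good_at_eventually) auto
  then show ?thesis
  proof eventually_elim
    case (elim \<epsilon>)
    have "good_at (i + k) \<epsilon> \<longleftrightarrow> good_at i \<epsilon>" for i
      by (simp add: good_at_def periodic periodic_Suc periodic_flat)
    then show ?case using periodic_all[OF k_pos, of "\<lambda>i. good_at i \<epsilon>"] elim by blast
  qed
qed

end

section \<open>Matrices of the combinatorial flow maps\<close>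

locale framed_orbit = comb_orbit + frame
begin

sublocale frc: framed_corner X "En i" "En (Suc i)" "Fn (Suc i)" J K for i ..

text \<open>The combinatorial flow map changes a vector by a Reeb component only, which the first
  trivialization ignores. Passing to the trivialization of the next 3-face is the transport through
  the full angle.\<close>

lemma quat_triv_landl:
  assumes v: "crn.\<nu> i \<bullet> v = 0"
  shows "quat_triv J K (crn.\<nu> (Suc i)) (crn.landl i v)
    = ell (frc.gp i) (frc.gq i) (frc.gr i) (crn.\<alpha> i) *v quat_triv J K (crn.\<nu> i) v"
proof -
  have "crn.landl i v = v + (- ((crn.\<nu>' i \<bullet> v) / crn.\<sigma> i)) *\<^sub>R (quat_i *v crn.\<nu> i)"
    by (simp add: crn.landl_def)
  then have "quat_triv J K (crn.\<nu> i) (crn.landl i v) = quat_triv J K (crn.\<nu> i) v"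
    by (simp only: quat_triv_add_right quat_triv_I add_0_right)
  then show ?thesis
    using frc.transport_matrix[OF crn.landl_tangent[OF v], of "crn.\<alpha> i"] by (simp add: \<nu>'_eq)
qed

text \<open>The flux at the preceding corner is nonzero, so the Reeb direction of
  \<open>En i\<close> is transverse to the 2-face where the segment starts.\<close>

lemma tangent_Fn_surj:
  fixes z :: "real^2"
  obtains v where "v \<in> tangent_space (Fn i)" "quat_triv J K (crn.\<nu> i) v = z"
proof -
  define j where "j = i + k - 1"
  have j: "Fn (Suc j) = Fn i" "crn.\<nu> (Suc j) = crn.\<nu> i" using k_pos by (simp_all add: j_def periodic periodic_corner)
  have "(quat_i *v crn.\<nu> i) \<bullet> crn.\<nu> j = - crn.\<sigma> j"
    using quat_i_inner_swap[of "crn.\<nu> i" "crn.\<nu> j"] by (simp add: crn.\<sigma>_def \<nu>'_eq j inner_commute)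
  then have "(quat_i *v crn.\<nu> i) \<bullet> crn.\<nu> j \<noteq> 0" using crn.\<sigma>_pos[of j] by simp
  then obtain v where v: "v \<bullet> crn.\<nu> i = 0" "v \<bullet> crn.\<nu> j = 0" "quat_triv J K (crn.\<nu> i) v = z"
    using quat_triv_surj[OF crn.norm_\<nu>(1)] by metis
  have "v \<in> tangent_space (Fn i)" using tangent_Fn[of j] v j by (simp add: inner_commute)
  then show thesis using that v by blast
qed

lemma tangent_Fn_kernel:
  assumes v: "v \<in> tangent_space (Fn i)" and 0: "quat_triv J K (crn.\<nu> i) v = 0"
  shows "v = 0"
proof -
  define j where "j = i + k - 1"
  have j: "Fn (Suc j) = Fn i" "crn.\<nu> (Suc j) = crn.\<nu> i" using k_pos by (simp_all add: j_def periodic periodic_corner)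
  have vv: "v \<bullet> crn.\<nu> i = 0" "v \<bullet> crn.\<nu> j = 0" using tangent_Fn[of j] v j by (auto simp: inner_commute)
  define s where "s = v \<bullet> (quat_i *v crn.\<nu> i)"
  have vs: "v = s *\<^sub>R (quat_i *v crn.\<nu> i)"
    using quat_triv_kernel[OF crn.norm_\<nu>(1) vv(1) 0] by (simp add: s_def)
  have "(quat_i *v crn.\<nu> i) \<bullet> crn.\<nu> j = - crn.\<sigma> j"
    using quat_i_inner_swap[of "crn.\<nu> i" "crn.\<nu> j"] by (simp add: crn.\<sigma>_def \<nu>'_eq j inner_commute)
  then have "s * crn.\<sigma> j = 0" using vv(2) by (subst (asm) vs) simp
  then have "s = 0" using crn.\<sigma>_pos[of j] by simp
  then show ?thesis using vs by simp
qed

lemma face_triv_eq: "face_triv J K X (Fn i) = quat_triv J K (crn.\<nu> i)"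
  by (simp add: face_triv_def exit_face_at crn.\<nu>_def)

lemma seg_matrix_eq: "seg_matrix J K X (sg i) = ell (frc.gp i) (frc.gq i) (frc.gr i) (crn.\<alpha> i)"
proof -
  have F: "face_at X (p i) = Fn i" "face_at X (snd (sg i)) = Fn (Suc i)" "fst (sg i) = p i"
    by (simp_all add: Fn_def p_def snd_sg)
  obtain d where d: "d > 0" "\<And>x. x \<in> Fn i \<Longrightarrow> dist x (p i) < d \<Longrightarrow> seg_flow X (sg i) x = crn.land i x"
    using seg_flow_land[of i] by metis
  have "((\<lambda>x. crn.land i (p i) + crn.landl i (x - p i)) has_derivative crn.landl i) (at (p i) within Fn i)"
    by (auto intro!: derivative_eq_intros bounded_linear.has_derivative[OF crn.bounded_linear_landl])
  then have der: "(seg_flow X (sg i) has_derivative crn.landl i) (at (p i) within Fn i)"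
    by (rule has_derivative_transform_within[OF _ d(1) sg_props(8)]) (metis d(2) crn.land_eq)
  show ?thesis
    unfolding seg_matrix_def Let_def F face_triv_eq
  proof (rule the_equality)
    show "derivative_matrix (seg_flow X (sg i)) (Fn i) (p i) (tangent_space (Fn i)) (quat_triv J K (crn.\<nu> i))
        (quat_triv J K (crn.\<nu> (Suc i))) (ell (frc.gp i) (frc.gq i) (frc.gr i) (crn.\<alpha> i))"
      unfolding derivative_matrix_def using der quat_triv_landl tangent_Fn_normal by blast
    fix A assume "derivative_matrix (seg_flow X (sg i)) (Fn i) (p i) (tangent_space (Fn i)) (quat_triv J K (crn.\<nu> i))
        (quat_triv J K (crn.\<nu> (Suc i))) A"
    then obtain L where L: "(seg_flow X (sg i) has_derivative L) (at (p i) within Fn i)"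
      "\<And>v. v \<in> tangent_space (Fn i) \<Longrightarrow> quat_triv J K (crn.\<nu> (Suc i)) (L v) = A *v quat_triv J K (crn.\<nu> i) v"
      unfolding derivative_matrix_def by blast
    have "A *v z = ell (frc.gp i) (frc.gq i) (frc.gr i) (crn.\<alpha> i) *v z" for z
    proof -
      obtain v where v: "v \<in> tangent_space (Fn i)" "quat_triv J K (crn.\<nu> i) v = z" using tangent_Fn_surj .
      obtain \<delta> where \<delta>: "\<delta> > 0" "\<And>t. \<bar>t\<bar> < \<delta> \<Longrightarrow> p i + t *\<^sub>R v \<in> Fn i" using open_Fn[OF v(1)] by metis
      have "L v = crn.landl i v" by (rule has_derivative_within_unique_direction[OF L(1) der \<delta>])
      then show ?thesis using L(2)[OF v(1)] quat_triv_landl[OF tangent_Fn_normal[OF v(1)]] v(2) by simp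
    qed
    then show "A = ell (frc.gp i) (frc.gq i) (frc.gr i) (crn.\<alpha> i)" by (simp add: matrix_eq)
  qed
qed

end

section \<open>The Reeb orbit for a fixed small parameter\<close>

locale orbit_smoothing = nondegenerate_orbit X \<gamma> + framed_orbit X \<gamma> J K + smoothing X \<epsilon> for X \<gamma> J K \<epsilon> +
  assumes good: "\<And>i. good_at i \<epsilon>"
begin

sublocale fc: framed_corner_flow X "En i" "En (Suc i)" "Fn (Suc i)" J K \<epsilon> for i ..

lemma \<tau>_pos: "\<tau> i \<epsilon> > 0" and mm_in: "mm i \<epsilon> \<in> En i"
  using good by (simp_all add: good_at_def)

lemma hflat_pos: "hflat i \<epsilon> > 0"
  using \<tau>_pos crn.h_pos(1)[of i] eps by (simp add: hflat_def)

text \<open>\<open>tm\<close> uses an arbitrary point of the 2-face. As \<open>N\<close> at the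
  final angle lies in the plane of the two normals, its product with all these points is the same,
  and the corner of the orbit may be inserted.\<close>

lemma arc_time_eq: "fc.arc_time i = arcd i \<epsilon>"
proof -
  have "crn.N i (crn.\<alpha> i) \<bullet> x = crn.N i (crn.\<alpha> i) \<bullet> p (Suc i)" if "x \<in> Fn (Suc i)" for x
  proof -
    have "crn.\<nu> i \<bullet> x = crn.\<nu> i \<bullet> p (Suc i)" "crn.f i \<bullet> x = crn.f i \<bullet> p (Suc i)"
      using crn.on_F[OF that] crn.on_F[OF sg_props(8)[of "Suc i"]]
      by (simp_all add: crn.f_def inner_diff_left)
    then show ?thesis using crn.\<alpha>(1)[of i] by (simp add: crn.N_mid inner_add_left)
  qed
  from this[OF fc.F_point] show ?thesis by (simp add: fc.arc_time_def fc.tm_def arcd_def)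
qed

lemma arcd_pos: "arcd i \<epsilon> > 0"
  using fc.arc_time_pos[of i] by (simp add: arc_time_eq)

lemma delay_mm: "fc.delay i (mm i \<epsilon>) = hflat i \<epsilon>"
proof -
  have "crn.\<nu>' i \<bullet> mm i \<epsilon> = crn.\<nu>' i \<bullet> (p i + \<epsilon> *\<^sub>R Y i) + (\<tau> i \<epsilon> / 2) * crn.\<sigma> i"
    by (simp add: mm_def inner_add_right crn.\<sigma>_def inner_commute)
  moreover have "crn.\<nu>' i \<bullet> (p i + \<epsilon> *\<^sub>R Y i) = crn.h' i - \<tau> i \<epsilon> * crn.\<sigma> i"
    using crn.\<sigma>_pos[of i] by (simp add: \<tau>_def \<nu>'_eq h'_eq)
  ultimately have *: "crn.h' i - crn.\<nu>' i \<bullet> mm i \<epsilon> = (\<tau> i \<epsilon> / 2) * crn.\<sigma> i" by simp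
  show ?thesis unfolding fc.delay_def * using crn.\<sigma>_pos[of i] by (simp add: hflat_def)
qed

lemma D_bound: "fc.delay i (mm i \<epsilon>) + fc.arc_time i < D i \<epsilon>" "D i \<epsilon> > 0"
  using hflat_pos[of i] hflat_pos[of "Suc i"] arcd_pos[of i] by (simp_all add: delay_mm arc_time_eq D_def)

lemma end_point: "crn.land i (mm i \<epsilon>) + \<epsilon> *\<^sub>R crn.dd i (crn.\<alpha> i)
    + (2 * (D i \<epsilon> - fc.delay i (mm i \<epsilon>) - fc.arc_time i) / (crn.h' i + \<epsilon>)) *\<^sub>R (quat_i *v crn.\<nu>' i) = mm (Suc i) \<epsilon>"
proof -
  have "2 * (D i \<epsilon> - fc.delay i (mm i \<epsilon>) - fc.arc_time i) / (crn.h' i + \<epsilon>) = \<tau> (Suc i) \<epsilon> / 2"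
  proof -
    have "2 * (t * x / 4) / x = t / 2" if "x \<noteq> 0" for t x :: real using that by simp
    from this[OF fc.he(4)[of i]] show ?thesis by (simp only: delay_mm arc_time_eq D_def hflat_def h'_eq) simp
  qed
  then show ?thesis by (simp add: mm_Suc \<nu>'_eq)
qed

lemma passes_near:
  obtains \<delta> where "\<delta> > 0" "\<And>w. crn.\<nu> i \<bullet> w = crn.h i \<Longrightarrow> dist w (mm i \<epsilon>) < \<delta> \<Longrightarrow> fc.passes i w (D i \<epsilon>)"
proof -
  define m where "m = mm i \<epsilon>"
  have 0: "crn.landl i 0 = 0" "fc.delayl i 0 = 0"
    using linear_0[OF bounded_linear.linear[OF crn.bounded_linear_landl]]
      linear_0[OF bounded_linear.linear[OF fc.bounded_linear_delayl]] by auto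
  have c1: "isCont (\<lambda>w. crn.landl i (w - m)) m"
    by (intro bounded_linear.isCont[OF crn.bounded_linear_landl] continuous_intros)
  have c2: "isCont (\<lambda>w. fc.delayl i (w - m)) m"
    by (intro bounded_linear.isCont[OF fc.bounded_linear_delayl] continuous_intros)
  \<comment> \<open>The foot point at time \<open>D i \<epsilon>\<close> of the trajectory starting
    over \<open>w\<close>: a later landing shortens the last flat piece. It depends continuously on
    \<open>w\<close>, so it stays in the next 3-face.\<close>
  define e where "e w = mm (Suc i) \<epsilon> + crn.landl i (w - m)
     - (2 * fc.delayl i (w - m) / (crn.h' i + \<epsilon>)) *\<^sub>R (quat_i *v crn.\<nu>' i)" for w
  have c3: "isCont e m" unfolding e_def using fc.he(4)[of i] by (intro continuous_intros c1 c2) auto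
  have em: "e m = mm (Suc i) \<epsilon>" by (simp add: e_def 0)
  obtain d1 where d1: "d1 > 0" "\<And>z. crn.\<nu> i \<bullet> z = crn.h i \<Longrightarrow> dist z m < d1 \<Longrightarrow> z \<in> En i"
    using facet_open[OF sg_props(1) mm_in[of i]] unfolding crn.\<nu>_def crn.h_def m_def by metis
  obtain d2 where d2: "d2 > 0" "\<And>\<theta> v. \<theta> \<in> {0..crn.\<alpha> i} \<Longrightarrow> v \<in> tangent_space (Fn (Suc i)) \<Longrightarrow> norm v < d2 \<Longrightarrow>
        crn.land i m + v + \<epsilon> *\<^sub>R crn.dd i \<theta> \<in> Fn (Suc i)"
    using good[of i] unfolding good_at_def m_def by blast
  obtain d3 where d3: "d3 > 0" "\<And>z. crn.\<nu> (Suc i) \<bullet> z = crn.h (Suc i) \<Longrightarrow> dist z (mm (Suc i) \<epsilon>) < d3 \<Longrightarrow> z \<in> En (Suc i)"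
    using facet_open[OF sg_props(1) mm_in[of "Suc i"]] unfolding crn.\<nu>_def crn.h_def by metis
  define q where "q = D i \<epsilon> - fc.delay i m - fc.arc_time i"
  have q: "q > 0" using D_bound(1)[of i] by (simp add: q_def m_def)
  have "\<forall>\<^sub>F w in nhds m. dist (crn.landl i (w - m)) (crn.landl i (m - m)) < d2 \<and>
     dist (fc.delayl i (w - m)) (fc.delayl i (m - m)) < q \<and> dist (e w) (e m) < d3"
    using isCont_near[OF c1 d2(1)] isCont_near[OF c2 q] isCont_near[OF c3 d3(1)] by eventually_elim auto
  then obtain d4 where d4: "d4 > 0" "\<And>w. dist w m < d4 \<Longrightarrow> norm (crn.landl i (w - m)) < d2 \<and>
     \<bar>fc.delayl i (w - m)\<bar> < q \<and> dist (e w) (mm (Suc i) \<epsilon>) < d3"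
    unfolding eventually_nhds_metric by (auto simp: 0 em dist_norm)
  show thesis
  proof (rule that[of "min d1 d4"])
    fix w assume w: "crn.\<nu> i \<bullet> w = crn.h i" "dist w (mm i \<epsilon>) < min d1 d4"
    have v: "crn.\<nu> i \<bullet> (w - m) = 0" using w(1) mm_on[of i \<epsilon>] by (simp add: m_def inner_diff_right)
    have near: "norm (crn.landl i (w - m)) < d2" "\<bar>fc.delayl i (w - m)\<bar> < q" "dist (e w) (mm (Suc i) \<epsilon>) < d3"
      using d4(2)[of w] w(2) by (auto simp: m_def)
    have tan: "crn.landl i (w - m) \<in> tangent_space (Fn (Suc i))" by (rule crn.landl_tangent[OF v])
    have land: "crn.land i w = crn.land i m + crn.landl i (w - m)" by (rule crn.land_eq)
    have delay: "fc.delay i w = fc.delay i m + fc.delayl i (w - m)" by (rule fc.delay_eq)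
    have "crn.\<nu> (Suc i) \<bullet> crn.landl i (w - m) = 0" using tan crn.tangent_F[of i] by (auto simp: \<nu>'_eq)
    then have "crn.\<nu> (Suc i) \<bullet> e w = crn.h (Suc i)"
      using mm_on[of "Suc i" \<epsilon>] by (simp add: e_def inner_add_right inner_diff_right \<nu>'_eq)
    then have eE: "e w \<in> En (Suc i)" using near(3) by (intro d3(2))
    have "2 * (D i \<epsilon> - fc.delay i w - fc.arc_time i) / (crn.h' i + \<epsilon>)
       = 2 * q / (crn.h' i + \<epsilon>) - 2 * fc.delayl i (w - m) / (crn.h' i + \<epsilon>)"
      by (simp add: q_def delay diff_divide_distrib[symmetric] algebra_simps)
    then have A: "(2 * (D i \<epsilon> - fc.delay i w - fc.arc_time i) / (crn.h' i + \<epsilon>)) *\<^sub>R (quat_i *v crn.\<nu>' i)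
       = (2 * q / (crn.h' i + \<epsilon>)) *\<^sub>R (quat_i *v crn.\<nu>' i)
         - (2 * fc.delayl i (w - m) / (crn.h' i + \<epsilon>)) *\<^sub>R (quat_i *v crn.\<nu>' i)"
      by (simp only: scaleR_diff_left)
    have ep: "mm (Suc i) \<epsilon> = crn.land i m + \<epsilon> *\<^sub>R crn.dd i (crn.\<alpha> i)
        + (2 * q / (crn.h' i + \<epsilon>)) *\<^sub>R (quat_i *v crn.\<nu>' i)"
      unfolding q_def m_def by (rule end_point[symmetric])
    have "crn.land i w + \<epsilon> *\<^sub>R crn.dd i (crn.\<alpha> i)
        + (2 * (D i \<epsilon> - fc.delay i w - fc.arc_time i) / (crn.h' i + \<epsilon>)) *\<^sub>R (quat_i *v crn.\<nu>' i) = e w"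
      unfolding e_def ep A land by simp
    then show "fc.passes i w (D i \<epsilon>)"
      unfolding fc.passes_def
      using d1(2)[OF w(1)] w(2) d2(2)[OF _ tan near(1)] near(2) eE
      by (auto simp: m_def[symmetric] land delay q_def)
  qed (use d1 d4 in auto)
qed

lemma passes_mm: "fc.passes i (mm i \<epsilon>) (D i \<epsilon>)"
  using passes_near[of i] mm_on[of i \<epsilon>] by (metis dist_self)

definition y0 :: "nat \<Rightarrow> real^4" where "y0 i = mm i \<epsilon> + \<epsilon> *\<^sub>R crn.\<nu> i"

lemma y0_frontier: "y0 i \<in> frontier S"
  using fc.passes_flow(4)[OF passes_mm, of 0 i] D_bound(2)[of i] by (simp add: y0_def)

lemma y0_periodic: "y0 (i + k) = y0 i"
  by (simp add: y0_def periodic_flat periodic)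

lemma offset_y0: "offset (y0 i) = \<epsilon> *\<^sub>R crn.\<nu> i"
proof -
  have m: "mm i \<epsilon> \<in> X" using mm_in kface_rel_interior(9)[OF convex_X compact_X sg_props(1)] by blast
  have "\<epsilon> *\<^sub>R crn.\<nu> i \<in> normal_cone X (mm i \<epsilon>)"
    using facet_normal_in_cone[OF sg_props(1)] mm_in closure_subset eps unfolding crn.\<nu>_def by (metis less_imp_le subsetD)
  then show "offset (y0 i) = \<epsilon> *\<^sub>R crn.\<nu> i"
    using offset_normal_eq[OF m] by (simp add: y0_def)
qed

lemma normal_y0: "outward_normal S (y0 i) = crn.\<nu> i"
  using eps by (simp add: outward_normal_eq[OF y0_frontier] offset_y0)

lemma flow_D: "reeb_flow S (D i \<epsilon>) (y0 i) = y0 (Suc i)"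
  using fc.passes_last_part[OF passes_mm, of i "D i \<epsilon>"] D_bound(1)[of i] end_point[of i]
  by (simp add: y0_def \<nu>'_eq)

definition orb :: "real \<Rightarrow> real^4" where "orb t = reeb_flow S t (y0 0)"
definition per :: real where "per = tt k \<epsilon>"

lemma orb_trajectory: "reeb_trajectory S orb"
  using flow_trajectory(1)[OF y0_frontier[of 0]] by (simp add: orb_def[abs_def])

lemma orb_tt: "orb (tt i \<epsilon>) = y0 i"
proof (induction i)
  case 0
  then show ?case using flow_trajectory(2)[OF y0_frontier[of 0]] by (simp add: orb_def tt_def)
next
  case (Suc i)
  have "orb (tt (Suc i) \<epsilon>) = reeb_flow S (D i \<epsilon> + tt i \<epsilon>) (y0 0)" by (simp add: orb_def tt_def add.commute)
  also have "\<dots> = reeb_flow S (D i \<epsilon>) (orb (tt i \<epsilon>))" by (simp add: flow_add[OF y0_frontier] orb_def)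
  finally show ?case using Suc flow_D by simp
qed

lemma orb_add: "orb (tt i \<epsilon> + u) = reeb_flow S u (y0 i)"
  using flow_add[OF y0_frontier[of 0], of u "tt i \<epsilon>"] orb_tt[of i] by (simp add: orb_def add.commute)

lemma tt_mono: "tt i \<epsilon> < tt (Suc i) \<epsilon>" and tt_0: "tt 0 \<epsilon> = 0"
  using D_bound(2)[of i] by (simp_all add: tt_def)

lemma tt_nonneg: "0 \<le> tt i \<epsilon>"
  unfolding tt_def using D_bound(2) by (intro sum_nonneg) (simp add: less_imp_le)

lemma per_pos: "per > 0"
proof -
  obtain j where "k = Suc j" using k_pos gr0_implies_Suc by blast
  then show ?thesis using tt_mono[of j] tt_nonneg[of j] by (simp add: per_def)
qed

lemma orb_periodic: "orb (t + per) = orb t"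
proof -
  have "orb (t + per) = reeb_flow S t (y0 k)" using orb_add[of k t] by (simp add: per_def add.commute)
  also have "y0 k = y0 0" using y0_periodic[of 0] by simp
  finally show ?thesis by (simp add: orb_def)
qed

lemma orb_periodic_int: "orb (t + of_int n * per) = orb t"
proof -
  have nat: "orb (t + real m * per) = orb t" for m t
  proof (induction m)
    case (Suc m)
    have "orb (t + real (Suc m) * per) = orb ((t + real m * per) + per)" by (simp add: algebra_simps)
    then show ?case using Suc orb_periodic by simp
  qed auto
  show ?thesis
  proof (cases "n \<ge> 0")
    case True then show ?thesis using nat[of t "nat n"] by simp
  next
    case False
    then show ?thesis using nat[of "t + of_int n * per" "nat (- n)"] by (simp add: algebra_simps)
  qed
qed

lemma reeb_orbit_orb: "reeb_orbit S per orb"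
  using orb_trajectory per_pos orb_periodic by (simp add: reeb_orbit_def)

lemma tt_locate:
  assumes "0 \<le> t" "t < tt j \<epsilon>"
  obtains i where "i < j" "tt i \<epsilon> \<le> t" "t < tt (Suc i) \<epsilon>"
  using assms
proof (induction j arbitrary: thesis)
  case 0
  then show ?case by (simp add: tt_0)
next
  case (Suc j)
  show ?case
  proof (cases "t < tt j \<epsilon>")
    case True
    then show ?thesis using Suc by (metis less_Suc_eq)
  next
    case False
    then show ?thesis using Suc.prems(1)[of j] Suc.prems(2,3) by simp
  qed
qed

lemma closest_orb:
  obtains i where "closest_point X (orb t) \<in> En i \<union> Fn (Suc i) \<union> En (Suc i)"
proof -
  define n where "n = \<lfloor>t / per\<rfloor>"
  define s where "s = t - of_int n * per"
  have "of_int n \<le> t / per" "t / per < of_int n + 1" by (simp_all add: n_def)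
  then have s: "0 \<le> s" "s < tt k \<epsilon>" using per_pos by (simp_all add: s_def per_def[symmetric] field_simps)
  then obtain i where i: "tt i \<epsilon> \<le> s" "s < tt (Suc i) \<epsilon>" using tt_locate by metis
  have "orb t = orb s" using orb_periodic_int[of s n] by (simp add: s_def)
  also have "\<dots> = reeb_flow S (s - tt i \<epsilon>) (y0 i)" using orb_add[of i "s - tt i \<epsilon>"] by simp
  finally have "orb t = reeb_flow S (s - tt i \<epsilon>) (mm i \<epsilon> + \<epsilon> *\<^sub>R crn.\<nu> i)" by (simp add: y0_def)
  moreover have "0 \<le> s - tt i \<epsilon>" "s - tt i \<epsilon> \<le> D i \<epsilon>" using i by (simp_all add: tt_def)
  ultimately show thesis using fc.passes_flow(2)[OF passes_mm, of "s - tt i \<epsilon>" i] that by simp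
qed

lemma orb_flat:
  assumes "\<bar>u\<bar> \<le> hflat i \<epsilon>"
  shows "orb (tt i \<epsilon> + u) = y0 i + (2 * u / (crn.h i + \<epsilon>)) *\<^sub>R (quat_i *v crn.\<nu> i)"
proof (cases "u \<ge> 0")
  case True
  then show ?thesis
    using fc.passes_first_part[OF passes_mm, of u i] assms by (simp add: orb_add delay_mm y0_def)
next
  case False
  \<comment> \<open>At negative \<open>u\<close> the point belongs to the end of the preceding
    block. Adding a period provides such a block also for \<open>i = 0\<close>.\<close>
  define j where "j = i + k - 1"
  have j: "Suc j = i + k" using k_pos by (simp add: j_def)
  have per: "tt (i + k) \<epsilon> = tt i \<epsilon> + per"
  proof (induction i)
    case 0 then show ?case by (simp add: per_def tt_def)
  next
    case (Suc i)
    have "tt (Suc i + k) \<epsilon> = tt (i + k) \<epsilon> + D (i + k) \<epsilon>" by (simp add: tt_def)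
    then show ?case using Suc by (simp add: periodic_flat) (simp add: tt_def)
  qed
  have "orb (tt i \<epsilon> + u) = orb (tt (Suc j) \<epsilon> + u)"
    using orb_periodic[of "tt i \<epsilon> + u"] by (simp add: j per algebra_simps)
  also have "tt (Suc j) \<epsilon> + u = tt j \<epsilon> + (D j \<epsilon> + u)" by (simp add: tt_def)
  also have "orb \<dots> = reeb_flow S (D j \<epsilon> + u) (mm j \<epsilon> + \<epsilon> *\<^sub>R crn.\<nu> j)" by (simp add: orb_add y0_def)
  also have "\<dots> = (crn.land j (mm j \<epsilon>) + \<epsilon> *\<^sub>R crn.dd j (crn.\<alpha> j)
      + (2 * ((D j \<epsilon> + u) - fc.delay j (mm j \<epsilon>) - fc.arc_time j) / (crn.h' j + \<epsilon>)) *\<^sub>R (quat_i *v crn.\<nu>' j)) + \<epsilon> *\<^sub>R crn.\<nu>' j"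
  proof (rule fc.passes_last_part[OF passes_mm])
    have "hflat (Suc j) \<epsilon> = hflat i \<epsilon>" by (simp add: j periodic_flat)
    then show "fc.delay j (mm j \<epsilon>) + fc.arc_time j \<le> D j \<epsilon> + u" "D j \<epsilon> + u \<le> D j \<epsilon>"
      using assms False by (simp_all add: D_def delay_mm arc_time_eq)
  qed
  also have "2 * ((D j \<epsilon> + u) - fc.delay j (mm j \<epsilon>) - fc.arc_time j) / (crn.h' j + \<epsilon>)
     = 2 * (D j \<epsilon> - fc.delay j (mm j \<epsilon>) - fc.arc_time j) / (crn.h' j + \<epsilon>) + 2 * u / (crn.h' j + \<epsilon>)"
    by (simp add: add_divide_distrib[symmetric])
  also have "(crn.land j (mm j \<epsilon>) + \<epsilon> *\<^sub>R crn.dd j (crn.\<alpha> j) + (2 * (D j \<epsilon> - fc.delay j (mm j \<epsilon>) - fc.arc_time j) / (crn.h' j + \<epsilon>)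
      + 2 * u / (crn.h' j + \<epsilon>)) *\<^sub>R (quat_i *v crn.\<nu>' j)) + \<epsilon> *\<^sub>R crn.\<nu>' j
     = mm (Suc j) \<epsilon> + (2 * u / (crn.h' j + \<epsilon>)) *\<^sub>R (quat_i *v crn.\<nu>' j) + \<epsilon> *\<^sub>R crn.\<nu>' j"
    by (simp add: end_point[of j, symmetric] scaleR_add_left add.assoc)
  finally have "orb (tt i \<epsilon> + u) = mm (Suc j) \<epsilon> + (2 * u / (crn.h' j + \<epsilon>)) *\<^sub>R (quat_i *v crn.\<nu>' j) + \<epsilon> *\<^sub>R crn.\<nu>' j" .
  moreover have "crn.\<nu> (Suc j) = crn.\<nu> i" "crn.h (Suc j) = crn.h i" unfolding j by (rule periodic_corner)+
  then have "crn.\<nu>' j = crn.\<nu> i" "crn.h' j = crn.h i" by (simp_all only: \<nu>'_eq h'_eq)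
  moreover have "mm (Suc j) = mm i" unfolding j by (rule periodic_flat)
  ultimately show ?thesis by (simp only: y0_def add_ac)
qed

section \<open>The linearized flow along the orbit and its lift\<close>

definition LF :: "real \<Rightarrow> real^2^2" where "LF = linearized_flow J K S orb"

lemma orb_0: "orb 0 = y0 0"
  using orb_tt[of 0] by (simp add: tt_0)

text \<open>The hypersurface is flat near the starting point, so it contains segments in all tangent
  directions there.\<close>

lemma frontier_direction:
  assumes v: "crn.\<nu> 0 \<bullet> v = 0"
  obtains \<delta> where "\<delta> > 0" "\<And>t. \<bar>t\<bar> < \<delta> \<Longrightarrow> y0 0 + t *\<^sub>R v \<in> frontier S"
proof -
  obtain d where d: "d > 0" "\<And>w. crn.\<nu> 0 \<bullet> w = crn.h 0 \<Longrightarrow> dist w (mm 0 \<epsilon>) < d \<Longrightarrow> fc.passes 0 w (D 0 \<epsilon>)"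
    using passes_near[of 0] by metis
  show thesis
  proof (rule that[of "d / (norm v + 1)"])
    fix t assume t: "\<bar>t\<bar> < d / (norm v + 1)"
    have pos: "norm v + 1 > 0" by (simp add: add_nonneg_pos)
    have "\<bar>t\<bar> * norm v \<le> \<bar>t\<bar> * (norm v + 1)" by (intro mult_left_mono) auto
    also have "\<dots> < d" using t pos by (simp add: pos_less_divide_eq)
    finally have "fc.passes 0 (mm 0 \<epsilon> + t *\<^sub>R v) (D 0 \<epsilon>)"
      using mm_on[of 0 \<epsilon>] v by (intro d(2)) (auto simp: inner_add_right dist_norm)
    from fc.passes_flow(4)[OF this, of 0] D_bound(2)[of 0] show "y0 0 + t *\<^sub>R v \<in> frontier S"
      by (simp add: y0_def add_ac)
  qed (use d in \<open>simp add: add_nonneg_pos\<close>)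
qed

lemma contact_y0: "v \<in> contact_plane S (y0 0) \<longleftrightarrow> crn.\<nu> 0 \<bullet> v = 0 \<and> v \<bullet> (quat_i *v y0 0) = 0"
  by (auto simp: contact_plane_def tangent_hyperplane_def normal_y0 lambda0_eq inner_commute)

lemma y0_height: "(quat_i *v crn.\<nu> 0) \<bullet> (quat_i *v y0 0) > 0"
  using mm_on[of 0 \<epsilon>] crn.h_pos(1)[of 0] eps by (simp add: y0_def inner_add_right)

text \<open>The trivialization maps the contact plane onto the plane, and on contact vectors the
  derivative within the flat frontier is determined. So the matrix in the definite description is
  unique.\<close>

lemma LF_eqI:
  assumes L: "(reeb_flow S t has_derivative L) (at (y0 0) within frontier S)"
    and A: "\<And>v. crn.\<nu> 0 \<bullet> v = 0 \<Longrightarrow> quat_triv J K (outward_normal S (orb t)) (L v) = A *v quat_triv J K (crn.\<nu> 0) v"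
  shows "LF t = A"
  unfolding LF_def linearized_flow_def orb_0 contact_triv_def normal_y0
proof (rule the_equality)
  show "derivative_matrix (reeb_flow S t) (frontier S) (y0 0) (contact_plane S (y0 0)) (quat_triv J K (crn.\<nu> 0))
     (quat_triv J K (outward_normal S (orb t))) A"
    unfolding derivative_matrix_def using L A contact_y0 by blast
  fix A' assume "derivative_matrix (reeb_flow S t) (frontier S) (y0 0) (contact_plane S (y0 0)) (quat_triv J K (crn.\<nu> 0))
     (quat_triv J K (outward_normal S (orb t))) A'"
  then obtain L' where L': "(reeb_flow S t has_derivative L') (at (y0 0) within frontier S)"
    "\<And>v. v \<in> contact_plane S (y0 0) \<Longrightarrow> quat_triv J K (outward_normal S (orb t)) (L' v) = A' *v quat_triv J K (crn.\<nu> 0) v"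
    unfolding derivative_matrix_def by blast
  have "A' *v z = A *v z" for z
  proof -
    obtain v where v: "v \<bullet> crn.\<nu> 0 = 0" "v \<bullet> (quat_i *v y0 0) = 0" "quat_triv J K (crn.\<nu> 0) v = z"
      using quat_triv_surj[OF crn.norm_\<nu>(1), of 0 "quat_i *v y0 0" z] y0_height by (metis less_irrefl)
    have n: "crn.\<nu> 0 \<bullet> v = 0" using v(1) by (simp add: inner_commute)
    obtain \<delta> where \<delta>: "\<delta> > 0" "\<And>t. \<bar>t\<bar> < \<delta> \<Longrightarrow> y0 0 + t *\<^sub>R v \<in> frontier S" using frontier_direction[OF n] by metis
    have "L v = L' v" by (rule has_derivative_within_unique_direction[OF L L'(1) \<delta>])
    then show ?thesis using A[OF n] L'(2)[of v] contact_y0 n v by simp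
  qed
  then show "A' = A" by (simp add: matrix_eq)
qed

definition ang :: "nat \<Rightarrow> real \<Rightarrow> real" where "ang i u = crn.cl i (fc.\<Theta> i (u - hflat i \<epsilon>))"

lemma ang_0: "ang i 0 = 0"
  using fc.\<Theta>_cases(1)[of "- hflat i \<epsilon>" i] hflat_pos[of i] by (simp add: ang_def crn.cl_simps)

lemma ang_D: "ang i (D i \<epsilon>) = crn.\<alpha> i"
  using fc.\<Theta>_cases(4)[of i "D i \<epsilon> - hflat i \<epsilon>"] D_bound(1)[of i]
  by (simp add: ang_def crn.cl_simps delay_mm)

lemma continuous_ang: "continuous_on A (ang i)"
  unfolding ang_def
  by (intro continuous_on_compose2[OF crn.continuous_cl[of UNIV]] continuous_on_compose2[OF fc.continuous_\<Theta>[of UNIV]]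
     continuous_intros) auto

lemma ang_bounds: "0 \<le> ang i u" "ang i u \<le> pi"
  using crn.cl_bounds[of i "fc.\<Theta> i (u - hflat i \<epsilon>)"] crn.\<alpha>(2)[of i] by (simp_all add: ang_def)

abbreviation "trans_mat i \<equiv> ell (frc.gp i) (frc.gq i) (frc.gr i)"

text \<open>The statement ranges over the whole tangent hyperplane, which the linearized flow of a
  block carries into the tangent hyperplane at its end; therefore blocks compose directly. The
  contact condition is imposed in \<open>LF_eqI\<close>.\<close>

lemma linearization_step:
  assumes L: "(reeb_flow S (tt i \<epsilon>) has_derivative L) (at (y0 0) within frontier S)"
    and n: "\<And>v. crn.\<nu> 0 \<bullet> v = 0 \<Longrightarrow> crn.\<nu> i \<bullet> L v = 0"
    and q: "\<And>v. crn.\<nu> 0 \<bullet> v = 0 \<Longrightarrow> quat_triv J K (crn.\<nu> i) (L v) = A *v quat_triv J K (crn.\<nu> 0) v"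
    and u: "0 \<le> u" "u \<le> D i \<epsilon>"
  obtains L' where "(reeb_flow S (tt i \<epsilon> + u) has_derivative L') (at (y0 0) within frontier S)"
    "\<And>v. crn.\<nu> 0 \<bullet> v = 0 \<Longrightarrow> crn.n i (ang i u) \<bullet> L' v = 0"
    "\<And>v. crn.\<nu> 0 \<bullet> v = 0 \<Longrightarrow> quat_triv J K (crn.n i (ang i u)) (L' v)
        = (trans_mat i (ang i u) ** A) *v quat_triv J K (crn.\<nu> 0) v"
proof -
  obtain \<delta> where \<delta>: "\<delta> > 0" "\<And>w. crn.\<nu> i \<bullet> w = crn.h i \<Longrightarrow> dist w (mm i \<epsilon>) < \<delta> \<Longrightarrow> fc.passes i w (D i \<epsilon>)"
    using passes_near[of i] by metis
  obtain M where M: "(reeb_flow S u has_derivative M) (at (y0 i) within frontier S)"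
    "\<And>v. crn.\<nu> i \<bullet> v = 0 \<Longrightarrow> crn.n i (ang i u) \<bullet> M v = 0"
    "\<And>v. crn.\<nu> i \<bullet> v = 0 \<Longrightarrow> quat_triv J K (crn.n i (ang i u)) (M v) = trans_mat i (ang i u) *v quat_triv J K (crn.\<nu> i) v"
    using fc.flow_linearization[OF mm_in \<delta> u] unfolding delay_mm ang_def[symmetric] y0_def[symmetric] by metis
  have y: "reeb_flow S (tt i \<epsilon>) (y0 0) = y0 i" using orb_tt[of i] by (simp add: orb_def)
  have "(reeb_flow S u has_derivative M) (at (reeb_flow S (tt i \<epsilon>) (y0 0)) within reeb_flow S (tt i \<epsilon>) ` frontier S)"
    unfolding y by (rule has_derivative_subset[OF M(1)]) (use flow_in_frontier in auto)
  from has_derivative_in_compose[OF L this]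
  have "((\<lambda>y. reeb_flow S u (reeb_flow S (tt i \<epsilon>) y)) has_derivative (\<lambda>v. M (L v))) (at (y0 0) within frontier S)" .
  then have "(reeb_flow S (tt i \<epsilon> + u) has_derivative (\<lambda>v. M (L v))) (at (y0 0) within frontier S)"
    by (rule has_derivative_transform[OF y0_frontier, rotated]) (simp add: flow_add add.commute[of _ u])
  then show thesis
    by (rule that) (use M n q in \<open>auto simp: matrix_vector_mul_assoc\<close>)
qed

lemma normal_orb: "0 \<le> u \<Longrightarrow> u \<le> D i \<epsilon> \<Longrightarrow> outward_normal S (orb (tt i \<epsilon> + u)) = crn.n i (ang i u)"
  using fc.passes_flow(3)[OF passes_mm, of u i] by (simp add: orb_add y0_def delay_mm ang_def)

lemma linearization:
  "\<exists>L. (reeb_flow S (tt i \<epsilon>) has_derivative L) (at (y0 0) within frontier S) \<and>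
    (\<forall>v. crn.\<nu> 0 \<bullet> v = 0 \<longrightarrow> crn.\<nu> i \<bullet> L v = 0 \<and>
       quat_triv J K (crn.\<nu> i) (L v) = LF (tt i \<epsilon>) *v quat_triv J K (crn.\<nu> 0) v)"
proof (induction i)
  case 0
  have "((\<lambda>y. y) has_derivative (\<lambda>v. v)) (at (y0 0) within frontier S)" by (rule has_derivative_ident)
  then have d: "(reeb_flow S (tt 0 \<epsilon>) has_derivative (\<lambda>v. v)) (at (y0 0) within frontier S)"
    by (rule has_derivative_transform[OF y0_frontier, rotated]) (simp add: tt_0 flow_trajectory(2))
  have "LF (tt 0 \<epsilon>) = mat 1"
    by (rule LF_eqI[OF d]) (simp add: tt_0 orb_0 normal_y0)
  then show ?case using d by auto
next
  case (Suc i)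
  then obtain L where L: "(reeb_flow S (tt i \<epsilon>) has_derivative L) (at (y0 0) within frontier S)"
    "\<And>v. crn.\<nu> 0 \<bullet> v = 0 \<Longrightarrow> crn.\<nu> i \<bullet> L v = 0"
    "\<And>v. crn.\<nu> 0 \<bullet> v = 0 \<Longrightarrow> quat_triv J K (crn.\<nu> i) (L v) = LF (tt i \<epsilon>) *v quat_triv J K (crn.\<nu> 0) v" by blast
  have D: "0 \<le> D i \<epsilon>" "D i \<epsilon> \<le> D i \<epsilon>" using D_bound(2)[of i] by auto
  have tt: "tt (Suc i) \<epsilon> = tt i \<epsilon> + D i \<epsilon>" by (simp add: tt_def)
  obtain L' where L': "(reeb_flow S (tt (Suc i) \<epsilon>) has_derivative L') (at (y0 0) within frontier S)"
    "\<And>v. crn.\<nu> 0 \<bullet> v = 0 \<Longrightarrow> crn.n i (ang i (D i \<epsilon>)) \<bullet> L' v = 0"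
    "\<And>v. crn.\<nu> 0 \<bullet> v = 0 \<Longrightarrow> quat_triv J K (crn.n i (ang i (D i \<epsilon>))) (L' v)
        = (trans_mat i (ang i (D i \<epsilon>)) ** LF (tt i \<epsilon>)) *v quat_triv J K (crn.\<nu> 0) v"
    using linearization_step[OF L D] unfolding tt by metis
  have "LF (tt (Suc i) \<epsilon>) = trans_mat i (ang i (D i \<epsilon>)) ** LF (tt i \<epsilon>)"
    by (rule LF_eqI[OF L'(1)]) (use L'(3) normal_orb[OF D] in \<open>simp add: tt\<close>)
  then show ?case using L' by (auto simp: ang_D \<nu>'_eq)
qed

lemma LF_block:
  assumes u: "0 \<le> u" "u \<le> D i \<epsilon>"
  shows "LF (tt i \<epsilon> + u) = trans_mat i (ang i u) ** LF (tt i \<epsilon>)"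
proof -
  obtain L where L: "(reeb_flow S (tt i \<epsilon>) has_derivative L) (at (y0 0) within frontier S)"
    "\<And>v. crn.\<nu> 0 \<bullet> v = 0 \<Longrightarrow> crn.\<nu> i \<bullet> L v = 0"
    "\<And>v. crn.\<nu> 0 \<bullet> v = 0 \<Longrightarrow> quat_triv J K (crn.\<nu> i) (L v) = LF (tt i \<epsilon>) *v quat_triv J K (crn.\<nu> 0) v"
    using linearization[of i] by blast
  obtain L' where L': "(reeb_flow S (tt i \<epsilon> + u) has_derivative L') (at (y0 0) within frontier S)"
    "\<And>v. crn.\<nu> 0 \<bullet> v = 0 \<Longrightarrow> quat_triv J K (crn.n i (ang i u)) (L' v)
        = (trans_mat i (ang i u) ** LF (tt i \<epsilon>)) *v quat_triv J K (crn.\<nu> 0) v"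
    using linearization_step[OF L u] by metis
  show ?thesis
    by (rule LF_eqI[OF L'(1)]) (use L'(2) normal_orb[OF u] in simp)
qed

lemma LF_0: "LF 0 = mat 1"
proof -
  have "LF (tt 0 \<epsilon>) = mat 1"
  proof (rule LF_eqI)
    show "(reeb_flow S (tt 0 \<epsilon>) has_derivative (\<lambda>v. v)) (at (y0 0) within frontier S)"
      by (rule has_derivative_transform[OF y0_frontier _ has_derivative_ident]) (simp add: tt_0 flow_trajectory(2))
  qed (simp add: tt_0 orb_0 normal_y0)
  then show ?thesis by (simp add: tt_0)
qed

definition acc :: "nat \<Rightarrow> sp2c" where
  "acc i = fold (\<lambda>s a. cover_mult (small_lift (seg_matrix J K X s)) a) (take i \<gamma>) cover_one"

text \<open>Within a block the normal turns from 0 to the exterior angle, below \<open>pi\<close>,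
  so the lift of the block ends at the small lift of the segment matrix. This is the factor by which
  the combinatorial product grows.\<close>

lemma path_lift: "i \<le> k \<Longrightarrow> path_lift_end (tt i \<epsilon>) LF (acc i)"
proof (induction i)
  case 0
  then show ?case by (simp add: tt_0 acc_def path_lift_end_zero LF_0)
next
  case (Suc i)
  have tk: "take (Suc i) \<gamma> = take i \<gamma> @ [sg i]"
    using Suc.prems by (simp add: take_Suc_conv_app_nth k_def sg_def)
  have "acc (Suc i) = cover_mult (small_lift (trans_mat i (ang i (D i \<epsilon>)))) (acc i)"
    by (simp add: acc_def tk seg_matrix_eq ang_D)
  moreover have "path_lift_end (tt i \<epsilon> + D i \<epsilon>) LF (cover_mult (small_lift (trans_mat i (ang i (D i \<epsilon>)))) (acc i))"
    by (rule path_lift_end_extend[OF frc.gr_pos frc.g_det])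
       (use Suc tt_nonneg D_bound(2)[of i] LF_block continuous_ang ang_0 ang_bounds in auto)
  ultimately show ?case by (simp add: tt_def)
qed

lemma rho_eq: "orbit_rho J K S per orb = rho_comb J K X \<gamma>"
proof -
  have "path_lift_end per LF (acc k)" using path_lift[of k] by (simp add: per_def)
  then have "(THE a. path_lift_end per LF a) = acc k"
    using path_lift_end_unique per_pos by (intro the_equality) (auto simp: less_imp_le)
  then show ?thesis by (simp add: orbit_rho_def LF_def[symmetric] rho_comb_def acc_def k_def)
qed

text \<open>The combinatorial return map acts on a 2-face and the smooth one on a contact plane; in
  the trivializations both have the same matrix.\<close>

lemma LF_Land:
  assumes v: "v \<in> tangent_space (Fn 0)"
  shows "quat_triv J K (crn.\<nu> i) (Land i v) = LF (tt i \<epsilon>) *v quat_triv J K (crn.\<nu> 0) v"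
proof (induction i)
  case 0
  then show ?case by (simp add: tt_0 LF_0)
next
  case (Suc i)
  have "LF (tt (Suc i) \<epsilon>) = trans_mat i (crn.\<alpha> i) ** LF (tt i \<epsilon>)"
    using LF_block[of "D i \<epsilon>" i] D_bound(2)[of i] by (simp add: ang_D tt_def)
  then show ?case
    using quat_triv_landl[OF tangent_Fn_normal[OF Land_tangent[OF v, of i]]] Suc
    by (simp add: matrix_vector_mul_assoc)
qed

text \<open>A fixed contact vector has coordinates fixed by the common matrix. The vector tangent to
  the 2-face with these coordinates is fixed by \<open>Land k\<close>, hence 0. So the contact
  vector is a multiple of the Reeb vector, on which \<open>lambda0\<close> does not vanish.\<close>

lemma nondegenerate: "orbit_nondegenerate S per orb"
proof -
  obtain L where L: "(reeb_flow S (tt k \<epsilon>) has_derivative L) (at (y0 0) within frontier S)"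
    "\<And>v. crn.\<nu> 0 \<bullet> v = 0 \<Longrightarrow> quat_triv J K (crn.\<nu> k) (L v) = LF (tt k \<epsilon>) *v quat_triv J K (crn.\<nu> 0) v"
    using linearization[of k] by blast
  have \<nu>k: "crn.\<nu> k = crn.\<nu> 0" using periodic_corner(1)[of 0] by simp
  have "v = 0" if v: "v \<in> contact_plane S (y0 0)" "L v = v" for v
  proof -
    define z where "z = quat_triv J K (crn.\<nu> 0) v"
    have vv: "crn.\<nu> 0 \<bullet> v = 0" "v \<bullet> (quat_i *v y0 0) = 0" using v contact_y0 by auto
    have z: "LF (tt k \<epsilon>) *v z = z" using L(2)[OF vv(1)] v(2) by (simp add: \<nu>k z_def)
    obtain w where w: "w \<in> tangent_space (Fn 0)" "quat_triv J K (crn.\<nu> 0) w = z" using tangent_Fn_surj .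
    have Fk: "Fn k = Fn 0" using periodic(4)[of 0] by simp
    have "quat_triv J K (crn.\<nu> 0) (Land k w) = z"
      using LF_Land[OF w(1), of k] w(2) z by (simp add: \<nu>k)
    then have "quat_triv J K (crn.\<nu> 0) (Land k w - w) = 0"
      using w(2) quat_triv_add_right[of "crn.\<nu> 0" "Land k w - w" w] by simp
    moreover have "Land k w - w \<in> tangent_space (Fn 0)"
      using subspace_diff[OF subspace_tangent] Land_tangent[OF w(1), of k] w(1) by (simp add: Fk)
    ultimately have "Land k w - w = 0" by (intro tangent_Fn_kernel[of _ 0])
    then have "w = 0" using Land_no_fixed_vector[OF nd w(1)] by simp
    then have "quat_triv J K (crn.\<nu> 0) v = 0"
      using w(2) by (simp add: z_def[symmetric]) (simp add: quat_triv_def vec_eq_iff forall_2 flip: w(2))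
    then have vs: "v = (v \<bullet> (quat_i *v crn.\<nu> 0)) *\<^sub>R (quat_i *v crn.\<nu> 0)"
      using vv(1) by (intro quat_triv_kernel[OF crn.norm_\<nu>(1)]) (auto simp: inner_commute)
    define s where "s = v \<bullet> (quat_i *v crn.\<nu> 0)"
    have "s * ((quat_i *v crn.\<nu> 0) \<bullet> (quat_i *v y0 0)) = 0"
      using vv(2) by (subst (asm) vs) (simp only: inner_scaleR_left s_def)
    then have "s = 0" using y0_height by simp
    then show ?thesis using vs by (simp add: s_def)
  qed
  then show ?thesis
    unfolding orbit_nondegenerate_def orb_0 using L(1) by (auto simp: per_def)
qed

end

section \<open>Linearizability\<close>

context sympl_polytope
begin

lemma face_in_rel_frontier_dim:
  assumes G: "kface X a G" and F: "kface X b F" and sub: "G \<subseteq> rel_frontier F"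
  shows "a < b"
proof -
  note g = kface_rel_interior[OF convex_X compact_X G] and f = kface_rel_interior[OF convex_X compact_X F]
  have "rel_interior F = F" using f(4,5) rel_interior_rel_interior convex_closure by metis
  then have sub': "G \<subseteq> closure F - F" using sub by (simp add: rel_frontier_def)
  then have "closure G \<subseteq> closure F" by (intro closure_minimal) auto
  then have face: "closure G face_of closure F" using face_of_subset[OF g(1) _ f(8)] by blast
  have "closure G \<noteq> closure F"
  proof
    assume "closure G = closure F"
    then have "G = F" using g(4) f(4) by simp
    then show False using sub' g(6) by blast
  qed
  then have "aff_dim (closure G) < aff_dim (closure F)"
    using face f(5) by (intro face_of_aff_dim_lt convex_closure)
  then show ?thesis using g(3) f(3) by simp
qed

end

context orbit_smoothing
begin

lemma stratum_point:
  assumes y: "y \<in> stratum X \<epsilon> G F" and F: "kface X b F" and G: "kface X a G" "G \<subseteq> rel_frontier F"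
  shows "closest_point X y \<in> G" "offset y \<in> rel_interior (face_normal_cone X F)" "norm (offset y) = \<epsilon>"
proof -
  obtain x v where xv: "y = x + v" "x \<in> G" "v \<in> rel_interior (face_normal_cone X F)" "norm v = \<epsilon>"
    using y by (auto simp: stratum_def)
  have v: "v \<in> face_normal_cone X F" using xv(3) rel_interior_subset by blast
  have x: "x \<in> closure F" using xv(2) G(2) by (auto simp: rel_frontier_def)
  have "(z - x) \<bullet> v \<le> 0" if "z \<in> X" for z
  proof -
    have "closure F \<subseteq> {x. (z - x) \<bullet> v \<le> 0}"
    proof (rule closure_minimal)
      show "F \<subseteq> {x. (z - x) \<bullet> v \<le> 0}" using v that by (auto simp: face_normal_cone_def normal_cone_def)
      show "closed {x. (z - x) \<bullet> v \<le> 0}" by (intro closed_Collect_le continuous_intros)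
    qed
    then show ?thesis using x by blast
  qed
  then have n: "v \<in> normal_cone X x" by (simp add: normal_cone_def)
  have xX: "x \<in> X" using xv(2) kface_rel_interior(9)[OF convex_X compact_X G(1)] by blast
  show "closest_point X y \<in> G" "offset y \<in> rel_interior (face_normal_cone X F)" "norm (offset y) = \<epsilon>"
    using closest_point_normal[OF xX n] offset_normal_eq[OF xX n] xv by simp_all
qed

lemma facet_stratum:
  assumes F: "kface X 3 F" and G: "kface X a G" "G \<subseteq> rel_frontier F" and y: "y \<in> stratum X \<epsilon> G F"
  shows "offset y = \<epsilon> *\<^sub>R face_normal X F"
proof -
  have "offset y \<in> face_normal_cone X F" using stratum_point(2)[OF y F G] rel_interior_subset by blast
  then obtain s where s: "offset y = s *\<^sub>R face_normal X F" "s \<ge> 0" using facet(6)[OF F] by blast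
  then have "s = \<epsilon>" using stratum_point(3)[OF y F G] facet(1)[OF F] by simp
  then show ?thesis using s by simp
qed

text \<open>The foot point of the orbit lies in a 3-face or a 2-face. Since \<open>G\<close> is in
  the boundary of \<open>F\<close>, only a 2-face \<open>G\<close> bounding a 3-face
  \<open>F\<close> is possible. The stratum is then a translate of \<open>G\<close>, and the Reeb
  direction of \<open>F\<close> is transverse to \<open>G\<close> because \<open>G\<close> is
  symplectic.\<close>

lemma transverse_at:
  assumes y: "y \<in> frontier S" and cp: "closest_point X y \<in> En i \<union> Fn (Suc i) \<union> En (Suc i)"
    and F: "is_face X F" and G: "is_face X G" "G \<subseteq> rel_frontier F" and str: "y \<in> stratum X \<epsilon> G F"
  shows "tangent_hyperplane S y = span (insert (reeb_field S y) (tangent_vectors (stratum X \<epsilon> G F) y))"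
proof -
  obtain b where b: "kface X b F" using F by (auto simp: is_face_def)
  obtain a where a: "kface X a G" using G by (auto simp: is_face_def)
  note sp = stratum_point[OF str b a G(2)]
  have ab: "a < b" by (rule face_in_rel_frontier_dim[OF a b G(2)])
  have b3: "b \<le> 3" by (rule kface_dim[OF b])
  have GF: "G = Fn (Suc i)"
  proof (rule ccontr)
    assume ne: "G \<noteq> Fn (Suc i)"
    then have "closest_point X y \<notin> Fn (Suc i)"
      using face_unique[OF G(1) kface_is_face[OF sg_props(7)] sp(1)] by blast
    then obtain j where "closest_point X y \<in> En j" using cp by blast
    then have "G = En j" using face_unique[OF G(1) kface_is_face[OF sg_props(1)] sp(1)] by blast
    then have "aff_dim (closure G) = 3" using kface_rel_interior(3)[OF convex_X compact_X sg_props(1)] by simp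
    then have "a = 3" using kface_rel_interior(3)[OF convex_X compact_X a] by simp
    then show False using ab b3 by simp
  qed
  have "aff_dim (closure G) = 2" using GF kface_rel_interior(3)[OF convex_X compact_X sg_props(7)] by simp
  then have "a = 2" using kface_rel_interior(3)[OF convex_X compact_X a] by simp
  then have F3: "kface X 3 F" using ab b3 b by (metis le_antisym not_less_eq_eq numeral_2_eq_2 numeral_3_eq_3 not_le Suc_leI)
  define \<mu> where "\<mu> = face_normal X F"
  have \<mu>: "norm \<mu> = 1" "\<mu> \<bullet> \<mu> = 1" using facet(1)[OF F3] by (simp_all add: \<mu>_def dot_square_norm)
  have off: "offset y = \<epsilon> *\<^sub>R \<mu>" unfolding \<mu>_def by (rule facet_stratum[OF F3 a G(2) str])
  have nor: "outward_normal S y = \<mu>" using eps by (simp add: outward_normal_eq[OF y] off)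
  have "offset y \<bullet> y > 0" using offset_dot_pos[OF y] eps by (meson less_le_trans zero_less_power)
  then have "\<mu> \<bullet> y > 0" using eps by (simp add: off zero_less_mult_iff)
  then obtain \<rho> where \<rho>: "\<rho> > 0" "reeb_field S y = \<rho> *\<^sub>R (quat_i *v \<mu>)"
    by (intro that[of "2 / (\<mu> \<bullet> y)"]) (auto simp: reeb_field_def nor)
  have GclF: "G \<subseteq> closure F" using G(2) by (auto simp: rel_frontier_def)
  define x where "x = closest_point X y"
  have x: "x \<in> G" "y = x + \<epsilon> *\<^sub>R \<mu>" using sp(1) closest_plus_offset[of y] off by (simp_all add: x_def)
  \<comment> \<open>Of the two 3-faces that meet along the crossed 2-face, one differs from
    \<open>F\<close>; its normal is the second one that \<open>ridge_symplectic\<close> asks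
    for.\<close>
  obtain E2 where E2: "kface X 3 E2" "E2 \<noteq> F" "G \<subseteq> closure E2"
  proof (cases "En i = F")
    case True
    have "En (Suc i) \<noteq> En i"
    proof
      assume "En (Suc i) = En i"
      then have "crn.\<nu>' i = crn.\<nu> i" using crn.\<nu>'_def[of i] crn.\<nu>_def[of i] by metis
      then have "crn.\<sigma> i = (quat_i *v crn.\<nu> i) \<bullet> crn.\<nu> i" using crn.\<sigma>_def[of i] by metis
      then have "crn.\<sigma> i = 0" by simp
      then show False using crn.\<sigma>_pos[of i] by simp
    qed
    then show ?thesis using that[OF sg_props(1)[of "Suc i"]] True GF crn.FE' by metis
  next
    case False
    then show ?thesis using that[OF sg_props(1)[of i]] GF crn.FE by metis
  qed
  define \<mu>' where "\<mu>' = face_normal X E2"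
  have ind: "\<bar>\<mu> \<bullet> \<mu>'\<bar> < 1"
    unfolding \<mu>_def \<mu>'_def using facet_normals_independent[OF F3 E2(1), of x] x GclF E2 by blast
  have on: "\<mu> \<bullet> z = height F \<and> \<mu>' \<bullet> z = height E2" if "z \<in> G" for z
    using that GclF E2(3) facet(4)[OF F3] facet(4)[OF E2(1)] by (auto simp: \<mu>_def \<mu>'_def)
  have G2: "kface X 2 G" using sg_props(7) GF by simp
  have T: "tangent_space G = {v. \<mu> \<bullet> v = 0 \<and> \<mu>' \<bullet> v = 0}" and nz: "(quat_i *v \<mu>) \<bullet> \<mu>' \<noteq> 0"
    using ridge_symplectic(2,3)[OF G2 \<mu>(1) _ ind on] facet(1)[OF E2(1)] by (simp_all add: \<mu>'_def)
  have T_sub: "w \<in> tangent_vectors (stratum X \<epsilon> G F) y" if w: "w \<in> tangent_space G" for w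
  proof -
    have wt: "w \<in> tangent_space (Fn (Suc i))" using w GF by simp
    obtain d where d: "d > 0" "\<And>z. crn.\<nu> i \<bullet> z = crn.h i \<Longrightarrow> crn.\<nu>' i \<bullet> z = crn.h' i \<Longrightarrow> dist z x < d \<Longrightarrow> z \<in> Fn (Suc i)"
      using crn.open_F[of x i] x GF by metis
    define c where "c t = y + t *\<^sub>R w" for t
    have "((\<lambda>t. t * norm w) \<longlongrightarrow> 0 * norm w) (nhds (0::real))" by (intro tendsto_intros filterlim_ident)
    then have "\<forall>\<^sub>F t in nhds 0. dist (t * norm w) 0 < d" using d(1) by (auto dest: tendstoD)
    then have "\<forall>\<^sub>F t in nhds 0. c t \<in> stratum X \<epsilon> G F"
    proof eventually_elim
      case (elim t)
      have "x + t *\<^sub>R w \<in> Fn (Suc i)"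
        using elim wt crn.tangent_F[of i] crn.on_F[of x i] x GF
        by (intro d(2)) (auto simp: inner_add_right dist_norm abs_mult)
      then have "x + t *\<^sub>R w \<in> G" by (simp add: GF)
      moreover have "\<epsilon> *\<^sub>R \<mu> \<in> rel_interior (face_normal_cone X F)" "norm (\<epsilon> *\<^sub>R \<mu>) = \<epsilon>"
        using sp(2,3) by (simp_all only: off)
      moreover have "c t = (x + t *\<^sub>R w) + \<epsilon> *\<^sub>R \<mu>" by (simp add: c_def x(2))
      ultimately show ?case unfolding stratum_def by blast
    qed
    moreover have "(c has_vector_derivative w) (at 0)"
      unfolding c_def has_vector_derivative_def by (auto intro!: derivative_eq_intros)
    moreover have "c 0 = y" by (simp add: c_def)
    ultimately show ?thesis unfolding tangent_vectors_def by blast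
  qed
  \<comment> \<open>The stratum lies in a level set of the product with \<open>\<mu>\<close>, so its
    velocities are orthogonal to \<open>\<mu>\<close>. This gives the inclusion of the span in the
    tangent hyperplane.\<close>
  have tv_normal: "\<mu> \<bullet> w = 0" if "w \<in> tangent_vectors (stratum X \<epsilon> G F) y" for w
  proof -
    obtain c where c: "c 0 = y" "\<forall>\<^sub>F t in nhds (0::real). c t \<in> stratum X \<epsilon> G F" "(c has_vector_derivative w) (at 0)"
      using \<open>w \<in> _\<close> unfolding tangent_vectors_def by blast
    have st: "\<mu> \<bullet> z = height F + \<epsilon>" if "z \<in> stratum X \<epsilon> G F" for z
    proof -
      have "z = closest_point X z + \<epsilon> *\<^sub>R \<mu>"
        using facet_stratum[OF F3 a G(2) that] closest_plus_offset[of z] by (simp add: \<mu>_def)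
      then have "\<mu> \<bullet> z = \<mu> \<bullet> closest_point X z + \<epsilon> * (\<mu> \<bullet> \<mu>)" by (metis inner_add_right inner_scaleR_right)
      then show ?thesis using on stratum_point(1)[OF that b a G(2)] \<mu> by simp
    qed
    have "((\<lambda>t. \<mu> \<bullet> c t) has_vector_derivative \<mu> \<bullet> w) (at 0)"
      by (rule bounded_linear.has_vector_derivative[OF bounded_linear_inner_right c(3)])
    moreover have "((\<lambda>t. \<mu> \<bullet> c t) has_vector_derivative 0) (at 0)"
    proof -
      have ev: "\<forall>\<^sub>F t in nhds 0. height F + \<epsilon> = \<mu> \<bullet> c t" using c(2) by eventually_elim (simp add: st)
      have "((\<lambda>t::real. height F + \<epsilon>) has_vector_derivative 0) (at 0)" by (rule has_vector_derivative_const)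
      then show ?thesis
        unfolding has_vector_derivative_def
        by (rule has_derivative_transform_eventually)
           (use ev eventually_nhds_x_imp_x[OF ev] in \<open>auto simp: eventually_at_filter elim: eventually_mono\<close>)
    qed
    ultimately show ?thesis by (rule vector_derivative_unique_at)
  qed
  define V where "V = span (insert (reeb_field S y) (tangent_vectors (stratum X \<epsilon> G F) y))"
  show ?thesis
    unfolding V_def[symmetric]
  proof (intro equalityI subsetI)
    fix w assume "w \<in> tangent_hyperplane S y"
    then have w: "\<mu> \<bullet> w = 0" by (simp add: tangent_hyperplane_def nor inner_commute)
    define s where "s = (\<mu>' \<bullet> w) / ((quat_i *v \<mu>) \<bullet> \<mu>')"
    have "w - s *\<^sub>R (quat_i *v \<mu>) \<in> tangent_space G"
      using w nz by (simp add: T inner_diff_right s_def inner_commute)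
    then have "w - s *\<^sub>R (quat_i *v \<mu>) \<in> V" unfolding V_def by (intro span_base) (auto intro: T_sub)
    moreover have "(s / \<rho>) *\<^sub>R reeb_field S y \<in> V" unfolding V_def by (intro span_scale span_base) simp
    then have "s *\<^sub>R (quat_i *v \<mu>) \<in> V" using \<rho> by simp
    ultimately have "(w - s *\<^sub>R (quat_i *v \<mu>)) + s *\<^sub>R (quat_i *v \<mu>) \<in> V" unfolding V_def by (rule span_add)
    then show "w \<in> V" by simp
  next
    fix w assume "w \<in> V"
    moreover have "V \<subseteq> {w. \<mu> \<bullet> w = 0}"
      unfolding V_def
      by (rule span_minimal) (use \<rho> tv_normal in \<open>auto simp: subspace_def inner_add_right\<close>)
    ultimately show "w \<in> tangent_hyperplane S y" by (auto simp: tangent_hyperplane_def nor inner_commute)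
  qed
qed

lemma linearizable_orb: "linearizable X \<epsilon> orb"
  unfolding linearizable_def
proof (intro allI impI)
  fix F G t assume *: "is_face X F \<and> is_face X G \<and> G \<subseteq> rel_frontier F \<and> orb t \<in> stratum X \<epsilon> G F"
  obtain i where i: "closest_point X (orb t) \<in> En i \<union> Fn (Suc i) \<union> En (Suc i)" using closest_orb .
  have "orb t \<in> frontier S" using orb_trajectory by (simp add: reeb_trajectory_def)
  from transverse_at[OF this i] * show "tangent_hyperplane S (orb t)
          = span (insert (reeb_field S (orb t)) (tangent_vectors (stratum X \<epsilon> G F) (orb t)))" by blast
qed

text \<open>The constant depends only on the inner ball and is thus uniform in
  \<open>\<epsilon>\<close>; it will turn errors in time into errors in position.\<close>

lemma orb_lipschitz:
  assumes r: "r > 0" "cball 0 r \<subseteq> X"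
  shows "norm (orb a - orb b) \<le> (2 / r) * \<bar>a - b\<bar>"
proof -
  have t: "reeb_trajectory S (\<lambda>s. orb (s + b))" by (rule trajectory_shift[OF orb_trajectory])
  have "norm (orb ((a - b) + b) - orb (0 + b)) \<le> (2 / r) * \<bar>a - b\<bar> - (2 / r) * 0"
  proof (rule vector_derivative_bound_abs[of "\<lambda>s. orb (s + b)"])
    show "((\<lambda>s. orb (s + b)) has_vector_derivative reeb_field S (orb (s + b))) (at s)" for s
      using t by (simp add: reeb_trajectory_def)
    show "((\<lambda>t. (2 / r) * t) has_real_derivative 2 / r) (at s)" for s
      by (rule DERIV_cmult_Id)
    show "norm (reeb_field S (orb (s + b))) \<le> 2 / r" for s
      using t by (intro reeb_field_bound r) (simp add: reeb_trajectory_def)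
  qed
  then show ?thesis by simp
qed

end

section \<open>Convergence\<close>

context comb_orbit
begin

definition sl :: "nat \<Rightarrow> real" where "sl i = (\<Sum>j<i. len j)"

lemma sl_mono: "sl i < sl (Suc i)" and sl_0: "sl 0 = 0" and sl_nonneg: "0 \<le> sl i"
  using sg_props(5) by (auto simp: sl_def intro!: sum_nonneg less_imp_le[OF sg_props(5)])

lemma seg_action: "lambda0_integral 0 1 (linepath (p i) (p (Suc i))) = len i"
proof -
  have "lambda0 (linepath (p i) (p (Suc i)) t) (vector_derivative (linepath (p i) (p (Suc i))) (at t within {0..1})) = len i"
    if "t \<in> {0..1}" for t
  proof -
    have d: "vector_derivative (linepath (p i) (p (Suc i))) (at t within {0..1}) = p (Suc i) - p i"
      using that by (intro vector_derivative_linepath_within) auto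
    have "linepath (p i) (p (Suc i)) t = p i + t *\<^sub>R (p (Suc i) - p i)" by (simp add: linepath_def algebra_simps)
    then have "lambda0 (linepath (p i) (p (Suc i)) t) (p (Suc i) - p i) = ((quat_i *v p i) \<bullet> (p (Suc i) - p i)) / 2"
      by (simp add: lambda0_eq matrix_vector_right_distrib matrix_vector_mult_scaleR inner_add_left)
    also have "\<dots> = ((quat_i *v p i) \<bullet> ((len i * (2 / crn.h i)) *\<^sub>R (quat_i *v crn.\<nu> i))) / 2"
      by (subst sg_props(6)) (simp add: reeb_face)
    also have "\<dots> = len i"
      using Fn_on[OF sg_props(8)[of i]] crn.h_pos(1)[of i] by (simp add: inner_commute)
    finally show ?thesis by (simp add: d)
  qed
  then have "lambda0_integral 0 1 (linepath (p i) (p (Suc i))) = integral {0..1} (\<lambda>t::real. len i)"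
    unfolding lambda0_integral_def by (intro integral_cong)
  then show ?thesis by simp
qed

lemma comb_action_eq: "comb_action \<gamma> = sl k"
proof -
  have "comb_action \<gamma> = (\<Sum>i = 0..<k. (case \<gamma> ! i of (a, b) \<Rightarrow> lambda0_integral 0 1 (linepath a b)))"
    by (simp add: comb_action_def sum_list_sum_nth k_def)
  also have "\<dots> = (\<Sum>i = 0..<k. len i)"
  proof (rule sum.cong)
    fix i assume "i \<in> {0..<k}"
    then have "\<gamma> ! i = (p i, p (Suc i))" using sg_eq[of i] by (simp add: sg_def)
    then show "(case \<gamma> ! i of (a, b) \<Rightarrow> lambda0_integral 0 1 (linepath a b)) = len i" by (simp add: seg_action)
  qed simp
  finally show ?thesis by (simp add: sl_def atLeast0LessThan)
qed

lemma comb_path_drop: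
  assumes "j \<le> i" "i < k" "0 \<le> x" "x \<le> len i"
  shows "comb_path X (drop j \<gamma>) ((\<Sum>l\<in>{j..<i}. len l) + x) = p i + x *\<^sub>R face_reeb X (En i)"
  using assms(1)
proof (induction rule: inc_induct)
  case base
  have "drop i \<gamma> = sg i # drop (Suc i) \<gamma>" using assms(2) by (simp add: Cons_nth_drop_Suc k_def sg_def)
  then show ?case using assms by (simp add: len_def[symmetric] p_def En_def)
next
  case (step j)
  define rest where "rest = (\<Sum>l\<in>{Suc j..<i}. len l) + x"
  have d: "drop j \<gamma> = sg j # drop (Suc j) \<gamma>" using step assms(2) by (simp add: Cons_nth_drop_Suc k_def sg_def)
  have s: "(\<Sum>l\<in>{j..<i}. len l) + x = len j + rest"
    using step by (simp add: rest_def sum.atLeast_Suc_lessThan)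
  have r0: "rest \<ge> 0" unfolding rest_def using assms by (auto intro!: add_nonneg_nonneg sum_nonneg less_imp_le[OF sg_props(5)])
  show ?case
  proof (cases "rest = 0")
    \<comment> \<open>A time at the end of segment \<open>j\<close>: \<open>comb_path\<close> still
      evaluates segment \<open>j\<close>, while the claim names the start of the next one. The two
      points agree.\<close>
    case True
    have "x = 0" "(\<Sum>l\<in>{Suc j..<i}. len l) = 0"
      using True assms(3) sum_nonneg[of "{Suc j..<i}" len] sg_props(5) unfolding rest_def
      by (smt (verit, best) less_imp_le)+
    then have "{Suc j..<i} = {}"
      using sum_pos[of "{Suc j..<i}" len] sg_props(5) by (metis finite_atLeastLessThan less_irrefl)
    then have "i = Suc j" using step by auto
    then show ?thesis
      using sg_props(6)[of j] \<open>x = 0\<close> True by (simp add: s[simplified \<open>i = Suc j\<close>] d len_def[symmetric] p_def En_def)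
  next
    case False
    then have "\<not> len j + rest \<le> len j" using r0 by simp
    then have "comb_path X (drop j \<gamma>) (len j + rest) = comb_path X (drop (Suc j) \<gamma>) rest"
      by (simp add: d len_def[symmetric])
    then show ?thesis using step.IH by (simp add: s rest_def)
  qed
qed

lemma comb_path_eq:
  assumes "i < k" "0 \<le> x" "x \<le> len i"
  shows "comb_path X \<gamma> (sl i + x) = p i + x *\<^sub>R face_reeb X (En i)"
  using comb_path_drop[of 0 i x] assms by (simp add: sl_def atLeast0LessThan)

lemma sl_locate:
  assumes "0 \<le> t" "t < sl j"
  obtains i where "i < j" "sl i \<le> t" "t < sl (Suc i)"
  using assms
proof (induction j arbitrary: thesis)
  case 0
  then show ?case by (simp add: sl_0)
next
  case (Suc j)
  show ?case
  proof (cases "t < sl j")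
    case True
    then show ?thesis using Suc by (metis less_Suc_eq)
  next
    case False
    then show ?thesis using Suc.prems(1)[of j] Suc.prems(2,3) by simp
  qed
qed

text \<open>The smooth orbit is timed from midpoint to midpoint, the combinatorial path from corner
  to corner. This converts the limit of \<open>tt i\<close> between the two.\<close>

lemma half_sum: "(\<Sum>j<i. len j / 2 + len (Suc j) / 2) = sl i + len i / 2 - len 0 / 2"
  by (induction i) (simp_all add: sl_def)

end

section \<open>The family of orbits and its limit\<close>

locale framed_nondegenerate_orbit = nondegenerate_orbit + framed_orbit
begin

lemma comb_action_pos: "comb_action \<gamma> > 0"
  using sl_mono[of "k - 1"] sl_nonneg[of "k - 1"] k_pos by (simp add: comb_action_eq)

lemma tendsto_period: "((\<lambda>\<epsilon>. tt k \<epsilon>) \<longlongrightarrow> comb_action \<gamma>) (at_right 0)"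
proof -
  have "len k = len 0" using periodic(5)[of 0] by simp
  then have "(\<Sum>j<k. len j / 2 + len (Suc j) / 2) = comb_action \<gamma>" by (simp add: half_sum comb_action_eq)
  then show ?thesis using tendsto_tt[of k] by simp
qed

text \<open>\<open>orbit_smoothing\<close> fixes one good \<open>\<epsilon>\<close>, while a limit
  needs a family defined for every value.\<close>

definition orbit_at :: "real \<Rightarrow> real \<Rightarrow> real^4" where
  "orbit_at \<epsilon> t = reeb_flow (thicken X \<epsilon>) t (mm 0 \<epsilon> + \<epsilon> *\<^sub>R crn.\<nu> 0)"

lemma orbit_smoothing_at:
  assumes "\<epsilon> > 0" "\<And>i. good_at i \<epsilon>"
  shows "orbit_smoothing X \<gamma> J K \<epsilon>" "orbit_smoothing.orb X \<gamma> \<epsilon> = orbit_at \<epsilon>"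
proof -
  show s: "orbit_smoothing X \<gamma> J K \<epsilon>" by unfold_locales (use assms in auto)
  interpret s: orbit_smoothing X \<gamma> J K \<epsilon> by (rule s)
  show "s.orb = orbit_at \<epsilon>" by (simp add: fun_eq_iff s.orb_def s.y0_def orbit_at_def)
qed

text \<open>A combinatorial point is compared with the point at the same relative position on the
  flat part of the smooth orbit, where both are explicit. The discrepancy in time, which includes
  the time spent over the 2-faces, is covered by the uniform speed bound.\<close>

lemma point_distance:
  assumes "\<epsilon> > 0" "\<And>i. good_at i \<epsilon>" and i: "i < k" and x: "0 \<le> x" "x \<le> len i"
    and r: "r > 0" "cball 0 r \<subseteq> X"
  shows "dist (orbit_at \<epsilon> ((tt k \<epsilon> / comb_action \<gamma>) * (sl i + x - len 0 / 2))) (p i + x *\<^sub>R face_reeb X (En i))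
    \<le> norm (mm i \<epsilon> - mm i 0) + \<epsilon> + \<bar>\<tau> i \<epsilon> - \<tau> i 0\<bar> +
      (2 / r) * (\<bar>tt i \<epsilon> - (sl i + len i / 2 - len 0 / 2)\<bar> + \<bar>hflat i \<epsilon> - len i / 2\<bar>
         + \<bar>1 - tt k \<epsilon> / comb_action \<gamma>\<bar> * (2 * comb_action \<gamma>))"
proof -
  interpret s: orbit_smoothing X \<gamma> J K \<epsilon> by (rule orbit_smoothing_at(1)[OF assms(1,2)])
  have orb: "s.orb = orbit_at \<epsilon>" by (rule orbit_smoothing_at(2)[OF assms(1,2)])
  define A where "A = comb_action \<gamma>"
  define \<tau>' where "\<tau>' = sl i + x - len 0 / 2"
  \<comment> \<open>Position within the segment, from -1 at its start through 0 at the midpoint to 1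
    at its end; \<open>u\<close> is the time of the same position on the flat part.\<close>
  define q where "q = 2 * x / len i - 1"
  have li: "len i > 0" by (rule sg_props(5))
  have q: "\<bar>q\<bar> \<le> 1" using x li by (auto simp: q_def abs_le_iff field_simps)
  have qx: "q * (len i / 2) = x - len i / 2" using li by (simp add: q_def field_simps)
  define u where "u = q * hflat i \<epsilon>"
  have u: "\<bar>u\<bar> \<le> hflat i \<epsilon>"
    using mult_right_mono[OF q, of "hflat i \<epsilon>"] s.hflat_pos[of i] by (simp add: u_def abs_mult)
  have "2 * u / (crn.h i + \<epsilon>) = q * (\<tau> i \<epsilon> / 2)"
  proof -
    have "2 * (q * (t * y / 4)) / y = q * (t / 2)" if "y \<noteq> 0" for t y :: real using that by simp
    from this[OF s.fc.he(2)] show ?thesis by (simp only: u_def hflat_def)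
  qed
  then have 1: "s.orb (tt i \<epsilon> + u) = mm i \<epsilon> + \<epsilon> *\<^sub>R crn.\<nu> i + (q * (\<tau> i \<epsilon> / 2)) *\<^sub>R (quat_i *v crn.\<nu> i)"
    using s.orb_flat[OF u] by (simp add: s.y0_def)
  have "mm i 0 + (q * (\<tau> i 0 / 2)) *\<^sub>R (quat_i *v crn.\<nu> i) = p i + ((1 + q) * (\<tau> i 0 / 2)) *\<^sub>R (quat_i *v crn.\<nu> i)"
  proof -
    have "(1 + q) * (\<tau> i 0 / 2) = \<tau> i 0 / 2 + q * (\<tau> i 0 / 2)" by (simp add: distrib_right)
    then show ?thesis unfolding mm_def by (simp only: scaleR_left_distrib) simp
  qed
  also have "(1 + q) * (\<tau> i 0 / 2) = x * (2 / crn.h i)"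
    using li crn.h_pos(1)[of i] by (simp add: q_def \<tau>_0)
  finally have 2: "p i + x *\<^sub>R face_reeb X (En i) = mm i 0 + (q * (\<tau> i 0 / 2)) *\<^sub>R (quat_i *v crn.\<nu> i)"
    by (simp add: reeb_face)
  have "s.orb (tt i \<epsilon> + u) - (p i + x *\<^sub>R face_reeb X (En i))
      = (mm i \<epsilon> - mm i 0) + \<epsilon> *\<^sub>R crn.\<nu> i + (q * ((\<tau> i \<epsilon> - \<tau> i 0) / 2)) *\<^sub>R (quat_i *v crn.\<nu> i)"
    unfolding 1 2 by (simp add: algebra_simps diff_divide_distrib)
  also have "norm \<dots> \<le> norm (mm i \<epsilon> - mm i 0) + norm (\<epsilon> *\<^sub>R crn.\<nu> i) + norm ((q * ((\<tau> i \<epsilon> - \<tau> i 0) / 2)) *\<^sub>R (quat_i *v crn.\<nu> i))"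
    by (intro order_trans[OF norm_triangle_ineq] add_right_mono norm_triangle_ineq)
  also have "norm ((q * ((\<tau> i \<epsilon> - \<tau> i 0) / 2)) *\<^sub>R (quat_i *v crn.\<nu> i)) = \<bar>q\<bar> * (\<bar>\<tau> i \<epsilon> - \<tau> i 0\<bar> / 2)"
    by (simp add: abs_mult)
  also have "\<dots> \<le> 1 * (\<bar>\<tau> i \<epsilon> - \<tau> i 0\<bar>)" using q by (intro mult_mono) auto
  finally have E1: "norm (s.orb (tt i \<epsilon> + u) - (p i + x *\<^sub>R face_reeb X (En i)))
      \<le> norm (mm i \<epsilon> - mm i 0) + \<epsilon> + \<bar>\<tau> i \<epsilon> - \<tau> i 0\<bar>" using assms(1) by simp
  have "(tt k \<epsilon> / A) * \<tau>' - (tt i \<epsilon> + u) = - (tt i \<epsilon> - (sl i + len i / 2 - len 0 / 2))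
      - q * (hflat i \<epsilon> - len i / 2) - (1 - tt k \<epsilon> / A) * \<tau>'"
    using qx by (simp add: u_def \<tau>'_def algebra_simps)
  then have "\<bar>(tt k \<epsilon> / A) * \<tau>' - (tt i \<epsilon> + u)\<bar> \<le> \<bar>tt i \<epsilon> - (sl i + len i / 2 - len 0 / 2)\<bar>
      + \<bar>q * (hflat i \<epsilon> - len i / 2)\<bar> + \<bar>(1 - tt k \<epsilon> / A) * \<tau>'\<bar>" by linarith
  also have "\<bar>q * (hflat i \<epsilon> - len i / 2)\<bar> \<le> 1 * \<bar>hflat i \<epsilon> - len i / 2\<bar>"
    unfolding abs_mult using q by (intro mult_right_mono) auto
  also have "\<bar>(1 - tt k \<epsilon> / A) * \<tau>'\<bar> \<le> \<bar>1 - tt k \<epsilon> / A\<bar> * (2 * A)"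
  proof -
    have "sl (Suc i) \<le> sl k" using i sl_mono by (metis Suc_leI lift_Suc_mono_le less_imp_le)
    moreover have "len 0 \<le> sl k"
      using k_pos sl_mono lift_Suc_mono_le[of sl "Suc 0" k] by (auto simp: sl_def less_imp_le)
    ultimately have "\<bar>\<tau>'\<bar> \<le> 2 * A"
      using x sl_nonneg[of i] sg_props(5)[of 0] comb_action_pos
      by (auto simp: \<tau>'_def A_def comb_action_eq abs_le_iff sl_def)
    then show ?thesis unfolding abs_mult by (intro mult_left_mono) auto
  qed
  finally have E2: "\<bar>(tt k \<epsilon> / A) * \<tau>' - (tt i \<epsilon> + u)\<bar> \<le> \<bar>tt i \<epsilon> - (sl i + len i / 2 - len 0 / 2)\<bar>
      + \<bar>hflat i \<epsilon> - len i / 2\<bar> + \<bar>1 - tt k \<epsilon> / A\<bar> * (2 * A)" by simp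
  have "norm (s.orb ((tt k \<epsilon> / A) * \<tau>') - s.orb (tt i \<epsilon> + u)) \<le> (2 / r) * \<bar>(tt k \<epsilon> / A) * \<tau>' - (tt i \<epsilon> + u)\<bar>"
    by (rule s.orb_lipschitz[OF r])
  also have "\<dots> \<le> (2 / r) * (\<bar>tt i \<epsilon> - (sl i + len i / 2 - len 0 / 2)\<bar>
      + \<bar>hflat i \<epsilon> - len i / 2\<bar> + \<bar>1 - tt k \<epsilon> / A\<bar> * (2 * A))" using r by (intro mult_left_mono E2) auto
  finally have E3: "norm (s.orb ((tt k \<epsilon> / A) * \<tau>') - s.orb (tt i \<epsilon> + u)) \<le> (2 / r) * (\<bar>tt i \<epsilon> - (sl i + len i / 2 - len 0 / 2)\<bar>
      + \<bar>hflat i \<epsilon> - len i / 2\<bar> + \<bar>1 - tt k \<epsilon> / A\<bar> * (2 * A))" .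
  have "dist (s.orb ((tt k \<epsilon> / A) * \<tau>')) (p i + x *\<^sub>R face_reeb X (En i))
     \<le> norm (s.orb ((tt k \<epsilon> / A) * \<tau>') - s.orb (tt i \<epsilon> + u)) + norm (s.orb (tt i \<epsilon> + u) - (p i + x *\<^sub>R face_reeb X (En i)))"
    using dist_triangle[of "s.orb ((tt k \<epsilon> / A) * \<tau>')" "p i + x *\<^sub>R face_reeb X (En i)" "s.orb (tt i \<epsilon> + u)"]
    by (simp add: dist_norm)
  then show ?thesis using E1 E3 unfolding orb A_def[symmetric] \<tau>'_def[symmetric] by linarith
qed

lemma C0_convergence: "C0_converges (tt k) orbit_at (comb_action \<gamma>) (comb_loop X \<gamma>)"
proof -
  define A where "A = comb_action \<gamma>"
  have A: "A > 0" using comb_action_pos by (simp add: A_def)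
  \<comment> \<open>The smooth orbits start over the middle of segment 0 and the combinatorial loop
    at its first corner; this is half a segment as a fraction of the period.\<close>
  define s where "s = - (len 0 / (2 * A))"
  obtain r where r: "r > 0" "cball 0 r \<subseteq> X" using inner_ball_exists .
  define err where "err i \<epsilon> = norm (mm i \<epsilon> - mm i 0) + \<epsilon> + \<bar>\<tau> i \<epsilon> - \<tau> i 0\<bar> +
      (2 / r) * (\<bar>tt i \<epsilon> - (sl i + len i / 2 - len 0 / 2)\<bar> + \<bar>hflat i \<epsilon> - len i / 2\<bar>
         + \<bar>1 - tt k \<epsilon> / comb_action \<gamma>\<bar> * (2 * comb_action \<gamma>))" for i \<epsilon>
  have err0: "((\<lambda>\<epsilon>. err i \<epsilon>) \<longlongrightarrow> 0) (at_right 0)" for i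
  proof -
    have "((\<lambda>\<epsilon>. err i \<epsilon>) \<longlongrightarrow> norm (mm i 0 - mm i 0) + 0 + \<bar>\<tau> i 0 - \<tau> i 0\<bar> +
      (2 / r) * (\<bar>(sl i + len i / 2 - len 0 / 2) - (sl i + len i / 2 - len 0 / 2)\<bar> + \<bar>len i / 2 - len i / 2\<bar>
         + \<bar>1 - comb_action \<gamma> / comb_action \<gamma>\<bar> * (2 * comb_action \<gamma>))) (at_right 0)"
      unfolding err_def
      by (intro tendsto_intros tendsto_mm tendsto_\<tau> tendsto_hflat tendsto_period tendsto_tt[unfolded half_sum])
         (use comb_action_pos in auto)
    then show ?thesis using comb_action_pos by simp
  qed
  have "uniform_limit UNIV (\<lambda>\<epsilon> t. orbit_at \<epsilon> (tt k \<epsilon> * (t + s))) (\<lambda>t. comb_loop X \<gamma> (A * t)) (at_right 0)"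
    unfolding uniform_limit_iff
  proof (intro allI impI)
    fix e :: real assume e: "e > 0"
    have "\<forall>\<^sub>F \<epsilon> in at_right 0. \<forall>i\<in>{..<k}. err i \<epsilon> < e"
      using order_tendstoD(2)[OF err0 e] by (intro eventually_ball_finite) auto
    moreover have "\<forall>\<^sub>F \<epsilon> in at_right (0::real). \<epsilon> > 0" by (rule eventually_at_right_less)
    ultimately show "\<forall>\<^sub>F \<epsilon> in at_right 0. \<forall>t\<in>UNIV. dist (orbit_at \<epsilon> (tt k \<epsilon> * (t + s))) (comb_loop X \<gamma> (A * t)) < e"
      using good_eventually
    proof eventually_elim
      case (elim \<epsilon>)
      show ?case
      proof
        fix t :: real
        interpret s: orbit_smoothing X \<gamma> J K \<epsilon> using orbit_smoothing_at(1) elim by blast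
        have orb: "s.orb = orbit_at \<epsilon>" using orbit_smoothing_at(2) elim by blast
        define \<tau>' where "\<tau>' = A * frac t"
        have "0 \<le> \<tau>'" "\<tau>' < sl k"
          using A frac_lt_1[of t] by (auto simp: \<tau>'_def A_def comb_action_eq[symmetric])
        then obtain i where i: "i < k" "sl i \<le> \<tau>'" "\<tau>' < sl (Suc i)" using sl_locate by metis
        define x where "x = \<tau>' - sl i"
        have x: "0 \<le> x" "x \<le> len i" using i by (simp_all add: x_def sl_def)
        have "comb_loop X \<gamma> (A * t) = comb_path X \<gamma> \<tau>'"
          using A by (simp add: comb_loop_def A_def[symmetric] \<tau>'_def)
        also have "\<dots> = p i + x *\<^sub>R face_reeb X (En i)"
          using comb_path_eq[OF i(1) x] by (simp add: x_def)
        finally have d: "comb_loop X \<gamma> (A * t) = p i + x *\<^sub>R face_reeb X (En i)" .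
        have "tt k \<epsilon> * (t + s) = tt k \<epsilon> * (frac t + s) + of_int \<lfloor>t\<rfloor> * s.per"
          by (simp add: s.per_def frac_def algebra_simps)
        then have "orbit_at \<epsilon> (tt k \<epsilon> * (t + s)) = orbit_at \<epsilon> (tt k \<epsilon> * (frac t + s))"
          using s.orb_periodic_int by (simp add: orb)
        also have "tt k \<epsilon> * (frac t + s) = (tt k \<epsilon> / comb_action \<gamma>) * (sl i + x - len 0 / 2)"
          using A by (simp add: A_def[symmetric] x_def \<tau>'_def s_def field_simps)
        finally have "dist (orbit_at \<epsilon> (tt k \<epsilon> * (t + s))) (comb_loop X \<gamma> (A * t)) \<le> err i \<epsilon>"
          unfolding d err_def using point_distance[OF elim(2) _ i(1) x r] elim(3) by simp
        then show "dist (orbit_at \<epsilon> (tt k \<epsilon> * (t + s))) (comb_loop X \<gamma> (A * t)) < e"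
          using le_less_trans[of _ "err i \<epsilon>" e] elim(1) i(1) by blast
      qed
    qed
  qed
  then show ?thesis unfolding C0_converges_def A_def[symmetric] by (intro exI[of _ "\<lambda>_. s"])
qed

end

theorem theorem1p11:
  fixes X :: "(real^4) set" and J K :: "real^4^4" and \<gamma> :: "seg list"
  assumes "quaternionic_frame J K"
    and "symplectic_polytope X"
    and "comb_reeb_orbit X \<gamma>" and "type1 X \<gamma>" and "comb_nondegenerate X \<gamma>"
  shows "\<exists>\<epsilon>\<^sub>0>0. \<exists>(T :: real \<Rightarrow> real) (c :: real \<Rightarrow> real \<Rightarrow> real^4).
           (\<forall>\<epsilon>\<in>{0<..<\<epsilon>\<^sub>0}. reeb_orbit (thicken X \<epsilon>) (T \<epsilon>) (c \<epsilon>)) \<and>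
           C0_converges T c (comb_action \<gamma>) (comb_loop X \<gamma>) \<and>
           ((\<lambda>\<epsilon>. orbit_action (T \<epsilon>) (c \<epsilon>)) \<longlongrightarrow> comb_action \<gamma>) (at_right 0) \<and>
           (\<forall>\<epsilon>\<in>{0<..<\<epsilon>\<^sub>0}.
              linearizable X \<epsilon> (c \<epsilon>) \<and>
              orbit_nondegenerate (thicken X \<epsilon>) (T \<epsilon>) (c \<epsilon>) \<and>
              orbit_rho J K (thicken X \<epsilon>) (T \<epsilon>) (c \<epsilon>) = rho_comb J K X \<gamma> \<and>
              orbit_CZ J K (thicken X \<epsilon>) (T \<epsilon>) (c \<epsilon>) = CZ_comb J K X \<gamma>)"
proof -
  interpret o: framed_nondegenerate_orbit X \<gamma> J K
    by unfold_locales (use assms in auto)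
  obtain b where b: "b > 0" "\<And>\<epsilon> i. 0 < \<epsilon> \<Longrightarrow> \<epsilon> < b \<Longrightarrow> o.good_at i \<epsilon>"
    using o.good_eventually unfolding eventually_at_right_field by blast
  have all: "reeb_orbit (thicken X \<epsilon>) (o.tt o.k \<epsilon>) (o.orbit_at \<epsilon>) \<and>
      orbit_action (o.tt o.k \<epsilon>) (o.orbit_at \<epsilon>) = o.tt o.k \<epsilon> \<and>
      linearizable X \<epsilon> (o.orbit_at \<epsilon>) \<and>
      orbit_nondegenerate (thicken X \<epsilon>) (o.tt o.k \<epsilon>) (o.orbit_at \<epsilon>) \<and>
      orbit_rho J K (thicken X \<epsilon>) (o.tt o.k \<epsilon>) (o.orbit_at \<epsilon>) = rho_comb J K X \<gamma>"
    if e: "0 < \<epsilon>" "\<epsilon> < b" for \<epsilon>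
  proof -
    interpret s: orbit_smoothing X \<gamma> J K \<epsilon> using o.orbit_smoothing_at(1) b(2) e by blast
    have orb: "s.orb = o.orbit_at \<epsilon>" using o.orbit_smoothing_at(2) b(2) e by blast
    show ?thesis
      using s.reeb_orbit_orb s.action_eq_period[OF s.orb_trajectory s.per_pos] s.linearizable_orb
        s.nondegenerate s.rho_eq unfolding orb s.per_def by blast
  qed
  have "((\<lambda>\<epsilon>. orbit_action (o.tt o.k \<epsilon>) (o.orbit_at \<epsilon>)) \<longlongrightarrow> comb_action \<gamma>) (at_right 0)"
  proof (rule Lim_transform_eventually[OF o.tendsto_period])
    have "\<forall>\<^sub>F \<epsilon> in at_right (0::real). \<epsilon> \<in> {0<..<b}" by (rule eventually_at_right_real[OF b(1)])
    then show "\<forall>\<^sub>F \<epsilon> in at_right 0. o.tt o.k \<epsilon> = orbit_action (o.tt o.k \<epsilon>) (o.orbit_at \<epsilon>)"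
      by eventually_elim (use all in auto)
  qed
  then show ?thesis
    using b(1) all o.C0_convergence
    by (intro exI[of _ b] conjI exI[of _ "o.tt o.k"] exI[of _ o.orbit_at])
       (auto simp: orbit_CZ_def CZ_comb_def)
qed

end
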